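(* Let $L$ be a countably infinite set and consider the edgeless cube $Q_L$. Then: (1) $\mathcal S^{\mathrm{face}}\subsetneq \mathcal L[f_{\mathrm{solved}}]\subseteq \mathcal S$; (2) every configuration in $\mathcal S^{\mathrm{face}}$ is accessible from every configuration in $\mathcal S$ by a basic sequence of length at most $\omega^2$; (3) if $g$ is a legal configuration not in $\mathcal S$ and $f\in\mathcal S$, then $g$ is not accessible from $f$ and $f$ is not accessible from $g$.
   Context: Let $L$ be an infinite set, $-L=\{-r:r\in L\}$ a disjoint copy of $L$, and $0$ a new element; $L^\dagger=-L\cup\{0\}\cup L$ with $-(-r)=r$, $-0=0$. Adjoin $\pm\infty$ with $-(+\infty)=-\infty$ and set $\bar L^\dagger=L^\dagger\cup\{\pm\infty\}$. Points of $U=(\bar L^\dagger)^3$ have coordinates $x,y,z$. The edgeless cube $Q_L$ is the set of cells: points of $U$ with exactly one coordinate in $\{\pm\infty\}$. For $i\in\{x,y,z\}$, $\alpha\in\bar L^\dagger$, the quarter-turn twist $T_{i,\alpha}$ is the permutation of cells fixing every cell $p$ with $p_i\ne\alpha$ and acting on the others by $T_{x,\alpha}(\alpha,y,z)=(\alpha,-z,y)$, $T_{y,\alpha}(x,\alpha,z)=(z,\alpha,-x)$, $T_{z,\alpha}(x,y,\alpha)=(-y,x,\alpha)$; those with $\alpha=\pm\infty$ are face twists. Basic twists are $T,T^2,T^3$ for quarter-turn twists $T$. A basic sequence is a sequence $\langle\sigma_\eta:\eta<\theta\rangle$ of basic twists of ordinal length $\theta$. A configuration is a map $f$ from cells to the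 six colors red, white, green, orange, yellow, blue together with a special value NaC; it is legal if it never takes value NaC. The solved configuration $f_{\mathrm{solved}}$ colors a cell red, blue, white, orange, green, yellow according as $x=+\infty$, $y=+\infty$, $z=+\infty$, $x=-\infty$, $y=-\infty$, $z=-\infty$. A twist $\sigma$ acts by $(\sigma f)(c)=f(\sigma^{-1}c)$. Applying $\langle\sigma_\eta:\eta<\theta\rangle$ to $f_0$ produces $f_{\eta+1}=\sigma_\eta f_\eta$, and for limit $\lambda\le\theta$, $f_\lambda(c)$ is the eventually constant value of $f_\eta(c)$ ($\eta<\lambda$) if it exists and NaC otherwise; $f_\theta$ is the terminal configuration. $f$ is accessible from $f_0$ if it is the terminal configuration of some basic sequence applied to $f_0$. The cluster of a cell $c$ is its orbit under the group generated by all quarter-turn twists. The six center cells (two coordinates equal to $0$) form the center cluster; all other clusters are non-center. A configuration $f$ is standard if it is legal, each non-center cluster contains exactly four cells of each of the six colors, and there is a rotational symmetry $\rho$ of the cube (a map $U\to U$ given by a signed permutation of coordinates of determinant $1$, where the sign acts by the negation on $\bar L^\dagger$) with $f(c)=f_{\mathrm{solved}}(\rho c)$ for every center cell $c$. $\mathcal S$ is the set of standard configurations; $\mathcal S^{\mathrm{face}}$ is the set of standard configurations $f$ with $T f=f$ for every quarter-turn face twist $T$; $\mathcal L[f_{\mathrm{solved}}]$ is the set of legal configurations accessible from $f_{\mathrm{solved}}$. *)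

theory Defs
  imports Main "HOL-Library.Countable_Set" "HOL-Combinatorics.Permutations"
begin

text \<open>L is a type 'l. L-dagger = -L \<union> {0} \<union> L; bar L-dagger adds +inf and -inf.\<close>

datatype 'l dag = Neg 'l | Zero | Pos 'l
datatype 'l ext = Fin "'l dag" | PInf | MInf

fun neg_dag :: "'l dag \<Rightarrow> 'l dag" where
  "neg_dag (Neg r) = Pos r" | "neg_dag Zero = Zero" | "neg_dag (Pos r) = Neg r"

fun neg :: "'l ext \<Rightarrow> 'l ext" where
  "neg (Fin a) = Fin (neg_dag a)" | "neg PInf = MInf" | "neg MInf = PInf"

type_synonym 'l pt = "'l ext \<times> 'l ext \<times> 'l ext"

definition is_inf :: "'l ext \<Rightarrow> bool" where
  "is_inf a \<longleftrightarrow> a = PInf \<or> a = MInf"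

definition is_cell :: "'l pt \<Rightarrow> bool" where
  "is_cell p \<longleftrightarrow> (case p of (x, y, z) \<Rightarrow>
      (is_inf x \<and> \<not> is_inf y \<and> \<not> is_inf z) \<or>
      (\<not> is_inf x \<and> is_inf y \<and> \<not> is_inf z) \<or>
      (\<not> is_inf x \<and> \<not> is_inf y \<and> is_inf z))"

typedef 'l cell = "{p :: 'l pt. is_cell p}"
  by (rule exI[of _ "(PInf, Fin Zero, Fin Zero)"]) (simp add: is_cell_def is_inf_def)

datatype axis = AX | AY | AZ

fun qt_pt :: "axis \<Rightarrow> 'l ext \<Rightarrow> 'l pt \<Rightarrow> 'l pt" where
  "qt_pt AX \<alpha> (x, y, z) = (if x = \<alpha> then (x, neg z, y) else (x, y, z))"
| "qt_pt AY \<alpha> (x, y, z) = (if y = \<alpha> then (z, y, neg x) else (x, y, z))"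
| "qt_pt AZ \<alpha> (x, y, z) = (if z = \<alpha> then (neg y, x, z) else (x, y, z))"

definition qt :: "axis \<Rightarrow> 'l ext \<Rightarrow> 'l cell \<Rightarrow> 'l cell" where
  "qt i \<alpha> c = Abs_cell (qt_pt i \<alpha> (Rep_cell c))"

definition quarter_twists :: "('l cell \<Rightarrow> 'l cell) set" where
  "quarter_twists = {qt i \<alpha> | i \<alpha>. True}"

definition face_twists :: "('l cell \<Rightarrow> 'l cell) set" where
  "face_twists = {qt i \<alpha> | i \<alpha>. \<alpha> = PInf \<or> \<alpha> = MInf}"

definition basic_twists :: "('l cell \<Rightarrow> 'l cell) set" where
  "basic_twists = {T ^^ k | T k. T \<in> quarter_twists \<and> k \<in> {1, 2, 3}}"

datatype colour = Red | White | Green | Orange | Yellow | Blue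

text \<open>A configuration maps cells to a colour or NaC; NaC is represented by None.\<close>
type_synonym 'l config = "'l cell \<Rightarrow> colour option"

definition legal :: "'l config \<Rightarrow> bool" where
  "legal f \<longleftrightarrow> (\<forall>c. f c \<noteq> None)"

definition solved_pt :: "'l pt \<Rightarrow> colour option" where
  "solved_pt p = (case p of (x, y, z) \<Rightarrow>
     if x = PInf then Some Red else if y = PInf then Some Blue
     else if z = PInf then Some White else if x = MInf then Some Orange
     else if y = MInf then Some Green else if z = MInf then Some Yellow else None)"

definition f_solved :: "'l config" where
  "f_solved c = solved_pt (Rep_cell c)"

definition act :: "('l cell \<Rightarrow> 'l cell) \<Rightarrow> 'l config \<Rightarrow> 'l config" where
  "act \<sigma> f = (\<lambda>c. f (inv \<sigma> c))"

text \<open>A basic sequence of ordinal length theta is represented by a well-order r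
  (with order type theta) and a map sigma from Field r to basic twists.
  The value of the eventually constant sequence F(eta)(c), eta ranging over
  {eta. P eta}, or None (NaC) if it is not eventually constant.\<close>
definition evconst :: "'o rel \<Rightarrow> ('o \<Rightarrow> bool) \<Rightarrow> ('o \<Rightarrow> 'l config) \<Rightarrow> 'l config" where
  "evconst r P F = (\<lambda>c.
     if \<exists>v \<eta>0. P \<eta>0 \<and> (\<forall>\<eta>. P \<eta> \<and> (\<eta>0, \<eta>) \<in> r \<longrightarrow> F \<eta> c = v)
     then THE v. \<exists>\<eta>0. P \<eta>0 \<and> (\<forall>\<eta>. P \<eta> \<and> (\<eta>0, \<eta>) \<in> r \<longrightarrow> F \<eta> c = v)
     else None)"

text \<open>F eta is the configuration f_eta before applying sigma_eta (eta in Field r).\<close>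
definition run_ok :: "'o rel \<Rightarrow> ('o \<Rightarrow> 'l cell \<Rightarrow> 'l cell) \<Rightarrow> 'l config \<Rightarrow> ('o \<Rightarrow> 'l config) \<Rightarrow> bool" where
  "run_ok r \<sigma> f0 F \<longleftrightarrow> (\<forall>\<eta>\<in>Field r.
     F \<eta> = (if \<forall>\<zeta>\<in>Field r. (\<eta>, \<zeta>) \<in> r then f0
            else if \<exists>\<zeta>. (\<zeta>, \<eta>) \<in> r \<and> \<zeta> \<noteq> \<eta> \<and>
                        (\<forall>\<xi>. (\<zeta>, \<xi>) \<in> r \<and> (\<xi>, \<eta>) \<in> r \<longrightarrow> \<xi> = \<zeta> \<or> \<xi> = \<eta>)
            then (let \<zeta> = (THE \<zeta>. (\<zeta>, \<eta>) \<in> r \<and> \<zeta> \<noteq> \<eta> \<and>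
                        (\<forall>\<xi>. (\<zeta>, \<xi>) \<in> r \<and> (\<xi>, \<eta>) \<in> r \<longrightarrow> \<xi> = \<zeta> \<or> \<xi> = \<eta>))
                  in act (\<sigma> \<zeta>) (F \<zeta>))
            else evconst r (\<lambda>\<zeta>. (\<zeta>, \<eta>) \<in> r \<and> \<zeta> \<noteq> \<eta>) F))"

definition terminal :: "'o rel \<Rightarrow> ('o \<Rightarrow> 'l cell \<Rightarrow> 'l cell) \<Rightarrow> 'l config \<Rightarrow> ('o \<Rightarrow> 'l config) \<Rightarrow> 'l config" where
  "terminal r \<sigma> f0 F =
     (if Field r = {} then f0
      else if \<exists>m\<in>Field r. \<forall>\<zeta>\<in>Field r. (\<zeta>, m) \<in> r
      then (let m = (THE m. m \<in> Field r \<and> (\<forall>\<zeta>\<in>Field r. (\<zeta>, m) \<in> r)) in act (\<sigma> m) (F m))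
      else evconst r (\<lambda>\<zeta>. \<zeta> \<in> Field r) F)"

definition accessible_via :: "'o rel \<Rightarrow> 'l config \<Rightarrow> 'l config \<Rightarrow> bool" where
  "accessible_via r f0 g \<longleftrightarrow> Well_order r \<and>
     (\<exists>\<sigma> F. (\<forall>\<eta>\<in>Field r. \<sigma> \<eta> \<in> basic_twists) \<and> run_ok r \<sigma> f0 F \<and> g = terminal r \<sigma> f0 F)"

text \<open>Accessibility by basic sequences whose lengths are order types of
  well-orders on the index type 'o.\<close>
definition accessible :: "'o itself \<Rightarrow> 'l config \<Rightarrow> 'l config \<Rightarrow> bool" where
  "accessible _ f0 g \<longleftrightarrow> (\<exists>r :: 'o rel. accessible_via r f0 g)"

definition omega2 :: "(nat \<times> nat) rel" where
  "omega2 = {((a, b), (c, d)). a < c \<or> (a = c \<and> b \<le> d)}"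

definition twist_step :: "('l cell \<times> 'l cell) set" where
  "twist_step = {(c, d). \<exists>T\<in>quarter_twists. d = T c \<or> c = T d}"

text \<open>Orbit of c under the group generated by the quarter-turn twists.\<close>
definition cluster :: "'l cell \<Rightarrow> 'l cell set" where
  "cluster c = {d. (c, d) \<in> twist_step\<^sup>*}"

definition center_cell :: "'l cell \<Rightarrow> bool" where
  "center_cell c \<longleftrightarrow> (case Rep_cell c of (x, y, z) \<Rightarrow>
      (x = Fin Zero \<and> y = Fin Zero) \<or> (x = Fin Zero \<and> z = Fin Zero) \<or> (y = Fin Zero \<and> z = Fin Zero))"

definition noncenter_clusters :: "'l cell set set" where
  "noncenter_clusters = {cluster c | c. \<not> center_cell c}"

text \<open>Rotational symmetries: (rho p)_i = eps_i * p_{pi i}, a signed permutation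
  matrix, with determinant sign(pi) * prod eps_i = 1.\<close>
definition crd :: "'l pt \<Rightarrow> nat \<Rightarrow> 'l ext" where
  "crd p i = (case p of (x, y, z) \<Rightarrow> if i = 0 then x else if i = 1 then y else z)"

definition rot :: "(nat \<Rightarrow> nat) \<Rightarrow> (nat \<Rightarrow> bool) \<Rightarrow> 'l pt \<Rightarrow> 'l pt" where
  "rot \<pi> \<epsilon> p = (let s = (\<lambda>i v. if \<epsilon> i then neg v else v)
                  in (s 0 (crd p (\<pi> 0)), s 1 (crd p (\<pi> 1)), s 2 (crd p (\<pi> 2))))"

definition is_rotation :: "(nat \<Rightarrow> nat) \<Rightarrow> (nat \<Rightarrow> bool) \<Rightarrow> bool" where
  "is_rotation \<pi> \<epsilon> \<longleftrightarrow> \<pi> permutes {0, 1, 2} \<and>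
     sign \<pi> * (\<Prod>i\<in>{0::nat, 1, 2}. if \<epsilon> i then -1 else 1) = (1::int)"

definition standard :: "'l config \<Rightarrow> bool" where
  "standard f \<longleftrightarrow> legal f \<and>
     (\<forall>K\<in>noncenter_clusters. \<forall>col. card {c\<in>K. f c = Some col} = 4) \<and>
     (\<exists>\<pi> \<epsilon>. is_rotation \<pi> \<epsilon> \<and>
        (\<forall>c. center_cell c \<longrightarrow> f c = solved_pt (rot \<pi> \<epsilon> (Rep_cell c))))"

definition S_std :: "'l config set" where
  "S_std = {f. standard f}"

definition S_face :: "'l config set" where
  "S_face = {f. standard f \<and> (\<forall>T\<in>face_twists. act T f = f)}"

definition L_solved :: "'o itself \<Rightarrow> 'l config set" where
  "L_solved t = {f. legal f \<and> accessible t f_solved f}"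

end

theory Submission
  imports Defs
begin

text \<open>
  Index the layers by natural numbers: layer \<open>0\<close> consists of the coordinate \<open>0\<close> and layer \<open>n + 1\<close>
  of the two coordinates \<open>\<plusminus>a\<close> for the \<open>n\<close>-th element \<open>a\<close> of \<open>L\<close>.  The finite coordinates of a cell give
  two layers, and twists preserve them.

  Let \<open>p\<close> be a non-center cell, \<open>F\<close> the face twist and \<open>A\<close>, \<open>B\<close> the two slice twists through \<open>p\<close>.
  The only cell of the face that the commutator \<open>[A, B]\<close> moves is \<open>p\<close>, so \<open>[[A, B], F]\<close> is the 3-cycle
  \<open>(p, A p, F p)\<close> on the whole cube.  These 3-cycles connect each cluster and hence yield all its even
  permutations; since colours repeat, every recolouring of a cluster is reached.

  To reach \<open>g \<in> S_face\<close>, stage \<open>m\<close> solves all clusters whose smaller layer is \<open>m\<close>.  The clusters with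
  layers \<open>{m, n}\<close>, \<open>n > m\<close>, are treated simultaneously: in \<open>[[A, B], F]\<close> the twists \<open>A\<close> (of layer \<open>m\<close>) and
  \<open>F\<close> are shared, and \<open>B\<close> is replaced by a sequence of length \<open>\<omega>\<close> with one twist of layer \<open>n\<close> for each
  \<open>n > m\<close>.  Finitely many such segments suffice, with a bound that is uniform in \<open>n\<close>.  Clusters with both
  layers below \<open>m\<close> are never disturbed, because there the configuration is already invariant under face
  twists.

  Conversely, a finite cluster that becomes constant before a limit keeps its colour count, and NaC
  can never leave a cluster; so being standard is invariant under accessibility between legal
  configurations.
\<close>


section \<open>Twists and clusters\<close>

text \<open>The obstacle is convergence. At omega^2 every cell must have settled for good, yet every
  stage has to turn faces. The protection that face-invariance of g provides covers only cells with
  both layers below m. A solved cell with a layer at least m may change during stage m and is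
  restored only when the commutator closes; a cell with larger layer h is constant from stage h + 1
  on. Inside a stage no NaC arises, because a sequence that visits one layer after another meets
  each cell in at most two layers. The uniform bound comes from counting: for every n the cells with
  layers m and n number at most 512, hence admit boundedly many colourings, and a shortest path of
  3-cycles between two of them is no longer than the number of pairs of colourings. When both layers
  of a cluster equal m, no second layer is free for B. These clusters are dealt with before the
  others in their stage, one commutator at a time. The center cluster admits no such 3-cycle, as
  face twists fix the centers; turns of the middle slices arrange it.\<close>

lemma neg_dag_neg_dag [simp]: "neg_dag (neg_dag a) = a"
  by (cases a) auto

lemma neg_neg [simp]: "neg (neg a) = a"
  by (cases a) auto

lemma neg_dag_eq_iff [simp]: "neg_dag a = neg_dag b \<longleftrightarrow> a = b"
  by (metis neg_dag_neg_dag)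

lemma neg_eq_iff [simp]: "neg a = neg b \<longleftrightarrow> a = b"
  by (metis neg_neg)

lemma is_inf_simps [simp]: "is_inf PInf" "is_inf MInf" "\<not> is_inf (Fin a)" "is_inf (neg v) = is_inf v"
  by (cases v; simp add: is_inf_def)+

lemma neg_dag_eq_self: "neg_dag a = a \<longleftrightarrow> a = Zero"
  by (cases a) auto

lemma not_is_inf_iff: "\<not> is_inf a \<longleftrightarrow> (\<exists>d. a = Fin d)"
  by (cases a) auto

section \<open>Coordinates, inverse quarter turns and the action on configurations\<close>

fun co :: "axis \<Rightarrow> 'l pt \<Rightarrow> 'l ext" where
  "co AX (x, y, z) = x" | "co AY (x, y, z) = y" | "co AZ (x, y, z) = z"

abbreviation cc :: "axis \<Rightarrow> 'l cell \<Rightarrow> 'l ext" where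
  "cc i c \<equiv> co i (Rep_cell c)"

fun iqt_pt :: "axis \<Rightarrow> 'l ext \<Rightarrow> 'l pt \<Rightarrow> 'l pt" where
  "iqt_pt AX \<alpha> (x, y, z) = (if x = \<alpha> then (x, z, neg y) else (x, y, z))"
| "iqt_pt AY \<alpha> (x, y, z) = (if y = \<alpha> then (neg z, y, x) else (x, y, z))"
| "iqt_pt AZ \<alpha> (x, y, z) = (if z = \<alpha> then (y, neg x, z) else (x, y, z))"

definition iqt :: "axis \<Rightarrow> 'l ext \<Rightarrow> 'l cell \<Rightarrow> 'l cell" where
  "iqt i \<alpha> c = Abs_cell (iqt_pt i \<alpha> (Rep_cell c))"

lemma is_cell_Rep [simp]: "is_cell (Rep_cell c)"
  using Rep_cell[of c] by simp

lemma is_cell_qt_pt [simp]: "is_cell (qt_pt i \<alpha> p) = is_cell p"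
  by (cases p; cases i) (auto simp: is_cell_def)

lemma is_cell_iqt_pt [simp]: "is_cell (iqt_pt i \<alpha> p) = is_cell p"
  by (cases p; cases i) (auto simp: is_cell_def)

lemma Rep_qt: "Rep_cell (qt i \<alpha> c) = qt_pt i \<alpha> (Rep_cell c)"
  unfolding qt_def by (subst Abs_cell_inverse) auto

lemma Rep_iqt: "Rep_cell (iqt i \<alpha> c) = iqt_pt i \<alpha> (Rep_cell c)"
  unfolding iqt_def by (subst Abs_cell_inverse) auto

lemma qt_iqt_pt [simp]: "qt_pt i \<alpha> (iqt_pt i \<alpha> p) = p" "iqt_pt i \<alpha> (qt_pt i \<alpha> p) = p"
  by (cases p; cases i; simp)+

lemma qt_iqt [simp]: "qt i \<alpha> (iqt i \<alpha> c) = c" "iqt i \<alpha> (qt i \<alpha> c) = c"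
  by (simp_all add: Rep_cell_inject[symmetric] Rep_qt Rep_iqt)

lemma bij_qt [simp]: "bij (qt i \<alpha>)" and bij_iqt [simp]: "bij (iqt i \<alpha>)"
  by (rule o_bij[of "iqt i \<alpha>"], auto) (rule o_bij[of "qt i \<alpha>"], auto)

lemma inv_qt [simp]: "inv (qt i \<alpha>) = iqt i \<alpha>" and inv_iqt [simp]: "inv (iqt i \<alpha>) = qt i \<alpha>"
  by (rule inv_equality; simp)+

lemma qt_pt_iqt_pt3: "qt_pt i \<alpha> (qt_pt i \<alpha> (qt_pt i \<alpha> p)) = iqt_pt i \<alpha> p"
  by (cases p; cases i) auto

lemma iqt_eq_funpow: "iqt i \<alpha> = qt i \<alpha> ^^ 3"
  by (rule ext) (simp add: Rep_cell_inject[symmetric] Rep_qt Rep_iqt eval_nat_numeral qt_pt_iqt_pt3)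

lemma qt_basic [simp]: "qt i \<alpha> \<in> basic_twists"
  unfolding basic_twists_def quarter_twists_def by (rule CollectI, rule exI[of _ "qt i \<alpha>"], rule exI[of _ 1]) auto

lemma iqt_basic [simp]: "iqt i \<alpha> \<in> basic_twists"
  unfolding basic_twists_def quarter_twists_def by (rule CollectI, rule exI[of _ "qt i \<alpha>"], rule exI[of _ 3])
    (auto simp: iqt_eq_funpow)

lemma act_comp: "bij s \<Longrightarrow> bij t \<Longrightarrow> act (s \<circ> t) f = act s (act t f)"
  by (simp add: act_def o_inv_distrib)

lemma act_id [simp]: "act id f = f"
  by (simp add: act_def)

lemma act_qt_iqt [simp]: "act (qt i \<alpha>) (act (iqt i \<alpha>) f) = f" "act (iqt i \<alpha>) (act (qt i \<alpha>) f) = f"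
  by (simp_all add: act_def)

lemma act_funpow: "bij s \<Longrightarrow> act (s ^^ n) f = (act s ^^ n) f"
  by (induction n) (simp_all add: act_comp)

lemma basic_twists_bij: "T \<in> basic_twists \<Longrightarrow> bij T"
  by (auto simp: basic_twists_def quarter_twists_def intro: bij_fn)

text \<open>
  The orbit of the cell \<open>(PInf, a, b)\<close> under the rotations of the cube: the rotation by 120 degrees
  permutes the coordinates cyclically, and opposite faces are turned in opposite directions.
\<close>

definition turn_orbit :: "'l ext \<Rightarrow> 'l ext \<Rightarrow> 'l ext \<Rightarrow> 'l ext \<Rightarrow> bool" where
  "turn_orbit a b u v \<longleftrightarrow> (u = a \<and> v = b) \<or> (neg u = b \<and> v = a) \<or> (neg u = a \<and> neg v = b) \<or> (u = b \<and> neg v = a)"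

fun cluster_point :: "'l ext \<Rightarrow> 'l ext \<Rightarrow> 'l pt \<Rightarrow> bool" where
  "cluster_point a b (x, y, z) \<longleftrightarrow> (x = PInf \<and> turn_orbit a b y z) \<or> (x = MInf \<and> turn_orbit a b z y) \<or>
     (y = PInf \<and> turn_orbit a b z x) \<or> (y = MInf \<and> turn_orbit a b x z) \<or>
     (z = PInf \<and> turn_orbit a b x y) \<or> (z = MInf \<and> turn_orbit a b y x)"

lemma turn_orbit_rot: "turn_orbit a b (neg v) u = turn_orbit a b u v" "turn_orbit a b v (neg u) = turn_orbit a b u v"
  unfolding turn_orbit_def by auto

lemma neg_eq_inf_iff [simp]: "neg a = PInf \<longleftrightarrow> a = MInf" "neg a = MInf \<longleftrightarrow> a = PInf"
  by (cases a; simp)+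

lemma cluster_point_qt_pt [simp]: "cluster_point a b (qt_pt i \<alpha> p) = cluster_point a b p"
  by (cases p; cases i) (auto simp: turn_orbit_rot)

section \<open>Clusters as explicit finite orbits\<close>

lemma twist_step_qt: "(c, qt i \<alpha> c) \<in> twist_step" "(qt i \<alpha> c, c) \<in> twist_step"
  by (auto simp: twist_step_def quarter_twists_def)

lemma twist_step_cluster_point: "(c, d) \<in> twist_step \<Longrightarrow> cluster_point a b (Rep_cell c) = cluster_point a b (Rep_cell d)"
  by (auto simp: twist_step_def quarter_twists_def Rep_qt)

lemma cluster_cluster_point: "d \<in> cluster c \<Longrightarrow> cluster_point a b (Rep_cell d) = cluster_point a b (Rep_cell c)"
  unfolding cluster_def mem_Collect_eq
  by (induction rule: rtrancl_induct) (auto dest: twist_step_cluster_point)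

lemma sym_twist_step: "sym twist_step"
  by (auto simp: sym_def twist_step_def)

lemma cluster_sym: "d \<in> cluster c \<Longrightarrow> c \<in> cluster d"
  unfolding cluster_def using sym_rtrancl[OF sym_twist_step] by (auto simp: sym_def)

lemma cluster_self [simp]: "c \<in> cluster c"
  by (simp add: cluster_def)

lemma cluster_trans: "d \<in> cluster c \<Longrightarrow> e \<in> cluster d \<Longrightarrow> e \<in> cluster c"
  by (auto simp: cluster_def)

lemma cluster_eq: "d \<in> cluster c \<Longrightarrow> cluster d = cluster c"
  by (blast intro: cluster_trans cluster_sym)

lemma qt_cluster: "qt i \<alpha> c \<in> cluster c" "iqt i \<alpha> c \<in> cluster c"
  using twist_step_qt(1)[of c i \<alpha>] twist_step_qt(2)[of i \<alpha> "iqt i \<alpha> c"]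
  by (auto simp: cluster_def)

lemma is_inf_cases: "is_inf a \<longleftrightarrow> a = PInf \<or> a = MInf"
  by (simp add: is_inf_def)

text \<open>A slice through the cell, about an axis parallel to its face, carries it to the face x =
  +infinity; one turn suffices except from the opposite face, which takes two.\<close>

lemma cluster_point_front: "\<exists>d\<in>cluster c. cc AX d = PInf"
proof -
  obtain x y z where c: "Rep_cell c = (x, y, z)" by (cases "Rep_cell c")
  have "is_cell (x, y, z)" using is_cell_Rep[of c] by (simp add: c)
  then consider "x = PInf" | "y = PInf" | "z = PInf" | "x = MInf" | "y = MInf" | "z = MInf"
    by (auto simp: is_cell_def is_inf_cases)
  then show ?thesis
  proof cases
    case 1 then show ?thesis by (intro bexI[of _ c]) (auto simp: c)
  next
    case 2 then show ?thesis by (intro bexI[of _ "iqt AZ z c"]) (auto simp: c qt_cluster Rep_iqt)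
  next
    case 3 then show ?thesis by (intro bexI[of _ "qt AY y c"]) (auto simp: c qt_cluster Rep_qt)
  next
    case 4 then show ?thesis
      by (intro bexI[of _ "qt AZ z (qt AZ z c)"])
        (auto simp: c Rep_qt intro: cluster_trans qt_cluster)
  next
    case 5 then show ?thesis by (intro bexI[of _ "qt AZ z c"]) (auto simp: c qt_cluster Rep_qt)
  next
    case 6 then show ?thesis by (intro bexI[of _ "iqt AY y c"]) (auto simp: c qt_cluster Rep_iqt)
  qed
qed

lemma turn_orbit_connected:
  assumes "Rep_cell c = (PInf, a, b)" "Rep_cell d = (PInf, u, v)" "turn_orbit a b u v"
  shows "d \<in> cluster c"
proof -
  have eq: "d = e" if "Rep_cell e = (PInf, u, v)" for e
    using that assms(2) by (simp add: Rep_cell_inject[symmetric])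
  have n: "neg x = y \<Longrightarrow> x = neg y" for x y :: "'a ext" by auto
  from assms(3) consider "u = a" "v = b" | "u = neg b" "v = a" | "u = neg a" "v = neg b" | "u = b" "v = neg a"
    unfolding turn_orbit_def by (auto dest: n)
  then show ?thesis
  proof cases
    case 1 then have "d = c" by (intro eq) (simp add: assms)
    then show ?thesis by simp
  next
    case 2 then have "d = qt AX PInf c" by (intro eq) (simp add: assms Rep_qt)
    then show ?thesis by (simp add: qt_cluster)
  next
    case 3 then have "d = qt AX PInf (qt AX PInf c)" by (intro eq) (simp add: assms Rep_qt)
    then show ?thesis by (auto intro: cluster_trans qt_cluster)
  next
    case 4 then have "d = iqt AX PInf c" by (intro eq) (simp add: assms Rep_iqt)
    then show ?thesis by (simp add: qt_cluster)
  qed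
qed

text \<open>\<open>cluster_point a b\<close> is invariant under twists, which gives one inclusion.
  Conversely, a cell with this property can be brought to the front face, where turns of that face
  alone connect it with c.\<close>

lemma cluster_eq_cluster_point:
  assumes "Rep_cell c = (PInf, a, b)"
  shows "cluster c = {d. cluster_point a b (Rep_cell d)}"
proof -
  have c: "cluster_point a b (Rep_cell c)" by (simp add: assms turn_orbit_def)
  have "d \<in> cluster c" if "cluster_point a b (Rep_cell d)" for d
  proof -
    obtain d' where d': "d' \<in> cluster d" "cc AX d' = PInf" using cluster_point_front by blast
    obtain u v where uv: "Rep_cell d' = (PInf, u, v)" using d'(2) by (cases "Rep_cell d'") auto
    have "is_cell (PInf, u, v)" using is_cell_Rep[of d'] by (simp add: uv)
    moreover have "cluster_point a b (PInf, u, v)" using cluster_cluster_point[OF d'(1), of a b] that uv by simp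
    ultimately have "turn_orbit a b u v" by (auto simp: is_cell_def)
    then show ?thesis using turn_orbit_connected[OF assms uv] d'(1) cluster_sym cluster_trans by blast
  qed
  with c show ?thesis using cluster_cluster_point by blast
qed

lemma center_cell_qt [simp]: "center_cell (qt i \<alpha> c) = center_cell c"
proof -
  have n: "neg v = Fin Zero \<longleftrightarrow> v = Fin Zero" for v :: "'a ext"
    by (cases v) (auto, metis neg_dag_neg_dag neg_dag.simps(2))
  show ?thesis unfolding center_cell_def Rep_qt
    by (cases "Rep_cell c"; cases i) (auto simp: n)
qed

lemma center_cell_iqt [simp]: "center_cell (iqt i \<alpha> c) = center_cell c"
  by (metis center_cell_qt qt_iqt(1))

lemma center_cluster: "d \<in> cluster c \<Longrightarrow> center_cell d = center_cell c"
  unfolding cluster_def mem_Collect_eq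
  by (induction rule: rtrancl_induct) (auto simp: twist_step_def quarter_twists_def)

lemma Rep_cell_vimage_card:
  assumes "\<And>p. p \<in> A \<Longrightarrow> is_cell p"
  shows "card {c. Rep_cell c \<in> A} = card A"
proof -
  have "Rep_cell ` {c. Rep_cell c \<in> A} = A"
  proof (intro equalityI subsetI)
    fix p assume "p \<in> A"
    then have "p = Rep_cell (Abs_cell p)" using assms by (simp add: Abs_cell_inverse)
    then show "p \<in> Rep_cell ` {c. Rep_cell c \<in> A}" using \<open>p \<in> A\<close> by auto
  qed auto
  then show ?thesis
    by (metis card_image inj_onI Rep_cell_inject)
qed

text \<open>The four quarter turns of (a, b) are distinct everywhere on the face except at its
  center. This is why the count of four per colour is asked of non-center clusters.\<close>

lemma card_turn_orbit:
  assumes "\<not> is_inf a" "\<not> is_inf b" "a \<noteq> Fin Zero \<or> b \<noteq> Fin Zero"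
  shows "card {(u, v). turn_orbit a b u v} = 4"
proof -
  obtain r s where ab: "a = Fin r" "b = Fin s" using assms not_is_inf_iff by blast
  have n: "neg x = y \<longleftrightarrow> x = neg y" for x y :: "'a ext" by auto
  have "{(u, v). turn_orbit a b u v} = {(a, b), (neg b, a), (neg a, neg b), (b, neg a)}"
    unfolding turn_orbit_def by (auto simp: n[of _ a] n[of _ b])
  also have "card \<dots> = 4"
    using assms(3) unfolding ab by (cases r; cases s) auto
  finally show ?thesis .
qed

lemma turn_orbit_not_inf: "turn_orbit a b u v \<Longrightarrow> \<not> is_inf a \<Longrightarrow> \<not> is_inf b \<Longrightarrow> \<not> is_inf u \<and> \<not> is_inf v"
  unfolding turn_orbit_def by (metis is_inf_simps(4))

lemma card_f_solved_cluster:
  assumes "\<not> center_cell c"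
  shows "card {d \<in> cluster c. f_solved d = Some col} = 4"
proof -
  obtain c' where c': "c' \<in> cluster c" "cc AX c' = PInf" using cluster_point_front by blast
  obtain a b where ab: "Rep_cell c' = (PInf, a, b)" using c'(2) by (cases "Rep_cell c'") auto
  have "is_cell (PInf, a, b)" using is_cell_Rep[of c'] by (simp add: ab)
  then have fin: "\<not> is_inf a" "\<not> is_inf b" by (auto simp: is_cell_def)
  have "\<not> center_cell c'" using center_cluster[OF c'(1)] assms by simp
  then have nz: "a \<noteq> Fin Zero \<or> b \<noteq> Fin Zero" by (auto simp: center_cell_def ab)
  define R where "R = {(u, v). turn_orbit a b u v}"
  have R4: "card R = 4" unfolding R_def by (rule card_turn_orbit[OF fin nz])
  have cl: "cluster c = {d. cluster_point a b (Rep_cell d)}"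
    using cluster_eq_cluster_point[OF ab] cluster_eq[OF c'(1)] by simp
  \<comment> \<open>\<open>J\<close> puts the pair (u, v) on the face that \<open>f_solved\<close>
    paints with \<open>col\<close>, in the coordinate order that \<open>cluster_point\<close> uses
    for this face. The cells of colour \<open>col\<close> in the cluster are thus a copy of the turn
    orbit.\<close>
  define J :: "'a ext \<times> 'a ext \<Rightarrow> 'a pt" where
    "J = (\<lambda>(u, v). case col of Red \<Rightarrow> (PInf, u, v) | Orange \<Rightarrow> (MInf, v, u)
        | Blue \<Rightarrow> (v, PInf, u) | Green \<Rightarrow> (u, MInf, v) | White \<Rightarrow> (u, v, PInf) | Yellow \<Rightarrow> (v, u, MInf))"
  have "{d \<in> cluster c. f_solved d = Some col} = {d. Rep_cell d \<in> J ` R}"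
  proof (rule Collect_cong)
    fix d :: "'a cell"
    obtain x y z where d: "Rep_cell d = (x, y, z)" by (cases "Rep_cell d")
    have "is_cell (x, y, z)" using is_cell_Rep[of d] by (simp add: d)
    then show "d \<in> cluster c \<and> f_solved d = Some col \<longleftrightarrow> Rep_cell d \<in> J ` R"
      unfolding cl J_def R_def f_solved_def solved_pt_def
      by (cases col) (auto simp: d image_iff is_cell_def is_inf_cases dest: turn_orbit_not_inf[OF _ fin] split: if_splits)
  qed
  moreover have "card {d. Rep_cell d \<in> J ` R} = card (J ` R)"
    by (rule Rep_cell_vimage_card)
      (auto simp: J_def R_def is_cell_def dest: turn_orbit_not_inf[OF _ fin] split: colour.splits)
  moreover have "card (J ` R) = card R"
    by (rule card_image) (auto simp: inj_on_def J_def split: colour.splits)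
  ultimately show ?thesis using R4 by simp
qed

lemma finite_cluster: "finite (cluster c)"
proof -
  obtain c' where c': "c' \<in> cluster c" "cc AX c' = PInf" using cluster_point_front by blast
  obtain a b where ab: "Rep_cell c' = (PInf, a, b)" using c'(2) by (cases "Rep_cell c'") auto
  let ?S = "{PInf, MInf, a, b, neg a, neg b}"
  have cl: "cluster c = {d. cluster_point a b (Rep_cell d)}"
    using cluster_eq_cluster_point[OF ab] cluster_eq[OF c'(1)] by simp
  have n: "neg x = y \<Longrightarrow> x = neg y" for x y :: "'a ext" by auto
  have r: "u \<in> ?S \<and> v \<in> ?S" if "turn_orbit a b u v" for u v
    using that unfolding turn_orbit_def by (elim disjE conjE) (auto dest: n)
  have "cluster_point a b (x, y, z) \<Longrightarrow> x \<in> ?S \<and> y \<in> ?S \<and> z \<in> ?S" for x y z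
    unfolding cluster_point.simps using r by (elim disjE conjE) blast+
  then have "cluster_point a b p \<Longrightarrow> p \<in> ?S \<times> ?S \<times> ?S" for p
    by (cases p) blast
  then have "Rep_cell ` cluster c \<subseteq> ?S \<times> ?S \<times> ?S"
    unfolding cl by blast
  then have "finite (Rep_cell ` cluster c)" by (rule finite_subset) auto
  then show ?thesis by (rule finite_imageD) (auto simp: inj_on_def Rep_cell_inject)
qed

section \<open>Three-cycles and recolourings\<close>

text \<open>For distinct a, b, c this is the permutation (a b c) acting on colourings; it moves
  colours forward along the cycle, in accordance with \<open>act\<close>.\<close>

definition act3 :: "'c \<Rightarrow> 'c \<Rightarrow> 'c \<Rightarrow> ('c \<Rightarrow> 'v) \<Rightarrow> 'c \<Rightarrow> 'v" where
  "act3 a b c f = f(b := f a, c := f b, a := f c)"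

definition cycle_step :: "('c \<times> 'c \<times> 'c) set \<Rightarrow> (('c \<Rightarrow> 'v) \<times> ('c \<Rightarrow> 'v)) set" where
  "cycle_step E = {(f, act3 a b c f) | f a b c. (a, b, c) \<in> E}"

context
  fixes r :: "(('c \<Rightarrow> 'v) \<times> ('c \<Rightarrow> 'v)) set"
begin

text \<open>Reachability is demanded from every colouring, so that available 3-cycles may be
  composed and conjugated like permutations.\<close>

definition cycle_reachable :: "'c \<Rightarrow> 'c \<Rightarrow> 'c \<Rightarrow> bool" where
  "cycle_reachable a b c \<longleftrightarrow> distinct [a, b, c] \<and> (\<forall>f. (f, act3 a b c f) \<in> r\<^sup>*)"

lemma cycle_reachable_rot: "cycle_reachable a b c \<Longrightarrow> cycle_reachable b c a"
proof -
  assume T: "cycle_reachable a b c"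
  then have "act3 b c a f = act3 a b c f" for f :: "'c \<Rightarrow> 'v"
    unfolding act3_def cycle_reachable_def by (auto simp: fun_eq_iff)
  with T show ?thesis unfolding cycle_reachable_def by auto
qed

text \<open>Exchanging two entries inverts a 3-cycle, and the inverse of a 3-cycle is its
  square.\<close>

lemma cycle_reachable_flip: "cycle_reachable a b c \<Longrightarrow> cycle_reachable b a c"
proof -
  assume T: "cycle_reachable a b c"
  then have eq: "act3 b a c f = act3 a b c (act3 a b c f)" for f :: "'c \<Rightarrow> 'v"
    unfolding act3_def cycle_reachable_def by (auto simp: fun_eq_iff)
  have "(f, act3 b a c f) \<in> r\<^sup>*" for f
    unfolding eq using T unfolding cycle_reachable_def by (meson rtrancl_trans)
  with T show ?thesis unfolding cycle_reachable_def by auto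
qed

text \<open>Conjugation of (x y z) by (y z w), which sends y to z and z to w, gives (x z w).\<close>

lemma cycle_reachable_shared_two:
  assumes "cycle_reachable x y z" "cycle_reachable y z w" "w \<noteq> x"
  shows "cycle_reachable x z w"
proof -
  have d: "distinct [x, y, z, w]" using assms unfolding cycle_reachable_def by auto
  have eq: "act3 x z w f = act3 y z w (act3 x y z (act3 z y w f))" for f :: "'c \<Rightarrow> 'v"
    unfolding act3_def using d by (auto simp: fun_eq_iff)
  have "(f, act3 x z w f) \<in> r\<^sup>*" for f
    unfolding eq using assms(1,2) cycle_reachable_flip[OF assms(2)] unfolding cycle_reachable_def by (meson rtrancl_trans)
  then show ?thesis using d unfolding cycle_reachable_def by auto
qed

text \<open>Conjugation of (x y z) by (x w v), which sends x to w and fixes y and z, gives (w y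
  z).\<close>

lemma cycle_reachable_shared_one:
  assumes "cycle_reachable x y z" "cycle_reachable x w v" "distinct [x, y, z, w, v]"
  shows "cycle_reachable w y z"
proof -
  have eq: "act3 w y z f = act3 x w v (act3 x y z (act3 w x v f))" for f :: "'c \<Rightarrow> 'v"
    unfolding act3_def using assms(3) by (auto simp: fun_eq_iff)
  have "(f, act3 w y z f) \<in> r\<^sup>*" for f
    unfolding eq using assms(1,2) cycle_reachable_flip[OF assms(2)] unfolding cycle_reachable_def by (meson rtrancl_trans)
  then show ?thesis using assms(3) unfolding cycle_reachable_def by auto
qed

text \<open>Two 3-cycles through x yield one through x and a chosen entry of each. The cases record
  how far they overlap; in each a conjugation does the work. This makes \<open>joined\<close>
  transitive.\<close>

lemma cycle_reachable_extend:
  assumes "cycle_reachable x y z" "cycle_reachable x w v" "w \<noteq> y" "w \<noteq> z"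
  shows "cycle_reachable x y w"
proof -
  consider "v = y" | "v = z" | "distinct [x, y, z, w, v]"
    using assms unfolding cycle_reachable_def by auto
  then show ?thesis
  proof cases
    case 1
    then show ?thesis using assms(2) cycle_reachable_rot cycle_reachable_flip by blast
  next
    case 2
    then have "cycle_reachable x z w" using assms(2) cycle_reachable_rot cycle_reachable_flip by blast
    moreover have "cycle_reachable y z x" using assms(1) cycle_reachable_rot by blast
    ultimately show ?thesis
      using cycle_reachable_shared_two[of y z x w] cycle_reachable_shared_two[of y x z w] cycle_reachable_rot cycle_reachable_flip assms(3) by metis
  next
    case 3
    then have "cycle_reachable w y z" using cycle_reachable_shared_one assms by blast
    then show ?thesis using cycle_reachable_shared_two[of x z y w] cycle_reachable_rot cycle_reachable_flip assms(1) 3 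
      by (metis distinct_length_2_or_more)
  qed
qed

definition joined :: "'c \<Rightarrow> 'c \<Rightarrow> bool" where
  "joined x y \<longleftrightarrow> x = y \<or> (\<exists>z. cycle_reachable x y z)"

lemma joined_sym: "joined x y \<Longrightarrow> joined y x"
  unfolding joined_def using cycle_reachable_flip by blast

lemma joined_trans: "joined x y \<Longrightarrow> joined y w \<Longrightarrow> joined x w"
  unfolding joined_def using cycle_reachable_extend cycle_reachable_rot cycle_reachable_flip by metis

text \<open>Within a class of \<open>joined\<close> every 3-cycle is available, and with them all
  even permutations of the class.\<close>

lemma cycle_reachable_of_joined:
  assumes "joined x y" "joined x w" "distinct [x, y, w]"
  shows "cycle_reachable x y w"
  using assms unfolding joined_def using cycle_reachable_extend by (metis distinct_length_2_or_more)

text \<open>The product of the two 3-cycles is (x y)(z w). As z and w carry the same colour, only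
  the exchange of x and y is visible, so parity is no obstruction.\<close>

lemma reach_swap:
  assumes K: "\<And>x y. x \<in> K \<Longrightarrow> y \<in> K \<Longrightarrow> joined x y"
    and xyzw: "{x, y, z, w} \<subseteq> K" "distinct [x, y, z, w]" and eq: "f z = f w"
  shows "(f, f(x := f y, y := f x)) \<in> r\<^sup>*"
proof -
  have "cycle_reachable x y z" "cycle_reachable y z w" using K xyzw by (auto intro!: cycle_reachable_of_joined)
  then have "(f, act3 y z w f) \<in> r\<^sup>*" "(act3 y z w f, act3 x y z (act3 y z w f)) \<in> r\<^sup>*"
    unfolding cycle_reachable_def by auto
  moreover have "act3 x y z (act3 y z w f) = f(x := f y, y := f x)"
    unfolding act3_def using xyzw eq by (auto simp: fun_eq_iff)
  ultimately show ?thesis by simp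
qed

text \<open>Induction on the number of wrong cells. If x is wrong, equal colour counts provide a
  cell y that wrongly carries the colour g x. Exchanging the two corrects x and cannot spoil y,
  which was wrong already.\<close>

lemma recolour:
  assumes fin: "finite K" and K: "\<And>x y. x \<in> K \<Longrightarrow> y \<in> K \<Longrightarrow> joined x y"
    and f: "\<And>c. c \<in> K \<Longrightarrow> card {d \<in> K. f d = f c} = 4"
    and fg: "\<And>v. card {d \<in> K. f d = v} = card {d \<in> K. g d = v}"
  shows "(f, \<lambda>c. if c \<in> K then g c else f c) \<in> r\<^sup>*"
  using f fg
proof (induction "card {c \<in> K. f c \<noteq> g c}" arbitrary: f rule: less_induct)
  case less
  show ?case
  proof (cases "\<exists>x\<in>K. f x \<noteq> g x")
    case False
    then have "(\<lambda>c. if c \<in> K then g c else f c) = f" by auto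
    then show ?thesis by simp
  next
    case True
    then obtain x where x: "x \<in> K" "f x \<noteq> g x" by blast
    have "\<exists>y\<in>K. f y = g x \<and> g y \<noteq> g x"
    proof (rule ccontr)
      assume "\<not> ?thesis"
      then have "{d \<in> K. f d = g x} \<subseteq> {d \<in> K. g d = g x}" by auto
      then have "{d \<in> K. f d = g x} = {d \<in> K. g d = g x}"
        using fin less.prems(2)[of "g x"] by (intro card_subset_eq) auto
      then show False using x by auto
    qed
    then obtain y where y: "y \<in> K" "f y = g x" "g y \<noteq> g x" by blast
    \<comment> \<open>Four cells per colour leave cells z and w of the colour of x, other than x
      itself; they differ from y, whose colour is different. They are the silent partners in
      \<open>reach_swap\<close>.\<close>
    have "card ({d \<in> K. f d = f x} - {x}) = 3"
      using less.prems(1)[OF x(1)] x(1) by (subst card_Diff_singleton) auto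
    then obtain z w where zw: "z \<in> {d \<in> K. f d = f x} - {x}" "w \<in> {d \<in> K. f d = f x} - {x}" "z \<noteq> w"
      unfolding card_3_iff by (metis insertCI)
    let ?f = "f(x := f y, y := f x)"
    have ne: "x \<noteq> y" using x y by auto
    have "(f, ?f) \<in> r\<^sup>*"
      by (rule reach_swap[OF K, of K x y z w]) (use x y zw ne in auto)
    moreover have cnt: "card {d \<in> K. ?f d = v} = card {d \<in> K. f d = v}" for v
    proof -
      have "bij_betw (Transposition.transpose x y) {d \<in> K. ?f d = v} {d \<in> K. f d = v}"
        by (rule bij_betw_byWitness[of _ "Transposition.transpose x y"])
          (use x y ne in \<open>auto simp: Transposition.transpose_def split: if_splits\<close>)
      then show ?thesis by (rule bij_betw_same_card)
    qed
    have "(?f, \<lambda>c. if c \<in> K then g c else ?f c) \<in> r\<^sup>*"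
    proof (rule less.hyps)
      show "card {c \<in> K. ?f c \<noteq> g c} < card {c \<in> K. f c \<noteq> g c}"
        by (rule psubset_card_mono) (use fin x y ne in auto)
      show "card {d \<in> K. ?f d = ?f c} = 4" if "c \<in> K" for c
        unfolding cnt using less.prems(1)[OF that] less.prems(1)[OF x(1)] less.prems(1)[OF y(1)] by auto
      show "card {d \<in> K. ?f d = v} = card {d \<in> K. g d = v}" for v
        unfolding cnt using less.prems(2) .
    qed
    moreover have "(\<lambda>c. if c \<in> K then g c else ?f c) = (\<lambda>c. if c \<in> K then g c else f c)"
      using x y by auto
    ultimately show ?thesis by (metis rtrancl_trans)
  qed
qed

end

section \<open>Transfinite invariants\<close>

lemma evconst_eqI:
  assumes tot: "\<And>x y. P x \<Longrightarrow> P y \<Longrightarrow> (x, y) \<in> r \<or> (y, x) \<in> r"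
    and "P \<eta>0" "\<And>\<eta>. P \<eta> \<Longrightarrow> (\<eta>0, \<eta>) \<in> r \<Longrightarrow> F \<eta> c = v"
  shows "evconst r P F c = v"
proof -
  have ex: "\<exists>v \<eta>0. P \<eta>0 \<and> (\<forall>\<eta>. P \<eta> \<and> (\<eta>0, \<eta>) \<in> r \<longrightarrow> F \<eta> c = v)"
    using assms by blast
  have "(THE v. \<exists>\<eta>0. P \<eta>0 \<and> (\<forall>\<eta>. P \<eta> \<and> (\<eta>0, \<eta>) \<in> r \<longrightarrow> F \<eta> c = v)) = v"
  proof (rule the_equality)
    show "\<exists>\<eta>0. P \<eta>0 \<and> (\<forall>\<eta>. P \<eta> \<and> (\<eta>0, \<eta>) \<in> r \<longrightarrow> F \<eta> c = v)"
      using assms by blast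
    fix w assume "\<exists>\<eta>0. P \<eta>0 \<and> (\<forall>\<eta>. P \<eta> \<and> (\<eta>0, \<eta>) \<in> r \<longrightarrow> F \<eta> c = w)"
    then obtain \<eta>1 where *: "P \<eta>1" "\<And>\<eta>. P \<eta> \<Longrightarrow> (\<eta>1, \<eta>) \<in> r \<Longrightarrow> F \<eta> c = w" by blast
    from tot[OF assms(2) *(1)] show "w = v"
      using tot[OF assms(2) assms(2)] tot[OF *(1) *(1)] assms(2,3) * by metis
  qed
  with ex show ?thesis unfolding evconst_def by simp
qed

lemma evconst_tail:
  assumes tot: "\<And>x y. P x \<Longrightarrow> P y \<Longrightarrow> (x, y) \<in> r \<or> (y, x) \<in> r"
    and "evconst r P F c \<noteq> None"
  shows "\<exists>\<eta>0. P \<eta>0 \<and> (\<forall>\<eta>. P \<eta> \<and> (\<eta>0, \<eta>) \<in> r \<longrightarrow> F \<eta> c = evconst r P F c)"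
proof -
  from assms(2) obtain v \<eta>0 where *: "P \<eta>0" "\<forall>\<eta>. P \<eta> \<and> (\<eta>0, \<eta>) \<in> r \<longrightarrow> F \<eta> c = v"
    unfolding evconst_def by (auto split: if_splits)
  then have "evconst r P F c = v" using evconst_eqI[of P r, OF tot] by metis
  with * show ?thesis by blast
qed

text \<open>Among finitely many thresholds there is a latest one. Hence on a finite set a limit free
  of NaC coincides with an earlier configuration.\<close>

lemma evconst_finite:
  assumes tot: "\<And>x y. P x \<Longrightarrow> P y \<Longrightarrow> (x, y) \<in> r \<or> (y, x) \<in> r" and tr: "trans r"
    and "finite K" "\<exists>x. P x" "\<forall>c\<in>K. evconst r P F c \<noteq> None"
  shows "\<exists>\<eta>0. P \<eta>0 \<and> (\<forall>\<eta>. P \<eta> \<and> (\<eta>0, \<eta>) \<in> r \<longrightarrow> (\<forall>c\<in>K. F \<eta> c = evconst r P F c))"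
  using assms(3-)
proof (induction K rule: finite_induct)
  case empty
  then show ?case by blast
next
  case (insert a K)
  then obtain \<eta>0 where *: "P \<eta>0" "\<forall>\<eta>. P \<eta> \<and> (\<eta>0, \<eta>) \<in> r \<longrightarrow> (\<forall>c\<in>K. F \<eta> c = evconst r P F c)" by auto
  obtain \<eta>1 where **: "P \<eta>1" "\<forall>\<eta>. P \<eta> \<and> (\<eta>1, \<eta>) \<in> r \<longrightarrow> F \<eta> a = evconst r P F a"
    using evconst_tail[of P r F a, OF tot] insert.prems by auto
  from tot[OF *(1) **(1)] show ?case
  proof
    assume "(\<eta>0, \<eta>1) \<in> r"
    then show ?thesis using * ** tr[THEN transD] by (intro exI[of _ \<eta>1]) blast
  next
    assume "(\<eta>1, \<eta>0) \<in> r"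
    then show ?thesis using * ** tr[THEN transD] by (intro exI[of _ \<eta>0]) blast
  qed
qed

section \<open>Local invariants along transfinite runs\<close>

definition twist_closed :: "'l cell set \<Rightarrow> bool" where
  "twist_closed K \<longleftrightarrow> (\<forall>T\<in>basic_twists. \<forall>c. T c \<in> K \<longleftrightarrow> c \<in> K)"

text \<open>The clauses correspond to the two kinds of steps in a run: equivalence under basic
  twists serves successors, and dependence on a finite set of cells alone serves limits, by
  \<open>evconst_finite\<close>.\<close>

definition local_invariant :: "'l cell set \<Rightarrow> ('l config \<Rightarrow> bool) \<Rightarrow> bool" where
  "local_invariant K \<Psi> \<longleftrightarrow> finite K \<and> twist_closed K \<and>
     (\<forall>T\<in>basic_twists. \<forall>f. \<Psi> (act T f) = \<Psi> f) \<and>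
     (\<forall>f f'. (\<forall>c\<in>K. f c = f' c) \<longrightarrow> \<Psi> f = \<Psi> f')"

lemma act_apply: "T \<in> basic_twists \<Longrightarrow> act T f (T c) = f c"
  using basic_twists_bij[of T] by (simp add: act_def bij_is_inj)

text \<open>A cell of \<open>K\<close> that has become NaC can only be moved around within \<open>K\<close>.\<close>

lemma local_invariant_run:
  assumes wo: "Well_order r" and tw: "\<And>\<eta>. \<eta> \<in> Field r \<Longrightarrow> \<sigma> \<eta> \<in> basic_twists"
    and run: "run_ok r \<sigma> f0 F" and inv: "local_invariant K \<Psi>"
    and "\<eta> \<in> Field r" "\<forall>c\<in>K. F \<eta> c \<noteq> None"
  shows "\<Psi> (F \<eta>) = \<Psi> f0"
proof -
  note [simp] = Let_def
  have wf: "wf (r - Id)" and tr: "trans r" and anti: "antisym r" and total: "total_on (Field r) r"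
    and refl: "refl_on (Field r) r"
    using wo by (auto simp: well_order_on_def linear_order_on_def partial_order_on_def preorder_on_def)
  have tot: "(x, y) \<in> r \<or> (y, x) \<in> r" if "x \<in> Field r" "y \<in> Field r" for x y
    using that total refl by (cases "x = y") (auto simp: total_on_def refl_on_def)
  from wf assms(5,6) show ?thesis
  proof (induction \<eta> rule: wf_induct_rule)
    case (less \<eta>)
    let ?pred = "\<lambda>\<zeta>. (\<zeta>, \<eta>) \<in> r \<and> \<zeta> \<noteq> \<eta> \<and> (\<forall>\<xi>. (\<zeta>, \<xi>) \<in> r \<and> (\<xi>, \<eta>) \<in> r \<longrightarrow> \<xi> = \<zeta> \<or> \<xi> = \<eta>)"
    consider (min) "\<forall>\<zeta>\<in>Field r. (\<eta>, \<zeta>) \<in> r" 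
      | (suc) \<zeta> where "\<not> (\<forall>\<zeta>\<in>Field r. (\<eta>, \<zeta>) \<in> r)" "?pred \<zeta>"
      | (lim) "\<not> (\<forall>\<zeta>\<in>Field r. (\<eta>, \<zeta>) \<in> r)" "\<not> (\<exists>\<zeta>. ?pred \<zeta>)" by blast
    then show ?case
    proof cases
      case min
      then show ?thesis using run less.prems(1) unfolding run_ok_def by simp
    next
      case (suc \<zeta>)
      have z: "\<zeta> \<in> Field r" "(\<zeta>, \<eta>) \<in> r - Id" using suc(2) by (auto simp: Field_def)
      have "(THE \<zeta>. ?pred \<zeta>) = \<zeta>"
      proof (rule the_equality)
        show "?pred \<zeta>" by (rule suc(2))
      next
        fix \<xi> assume x: "?pred \<xi>"
        then have "\<xi> \<in> Field r" by (auto simp: Field_def)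
        from tot[OF this z(1)] show "\<xi> = \<zeta>" using x suc(2) by blast
      qed
      then have F: "F \<eta> = act (\<sigma> \<zeta>) (F \<zeta>)"
        using run less.prems(1) suc unfolding run_ok_def by auto
      have b: "\<sigma> \<zeta> \<in> basic_twists" using tw z by blast
      have "\<forall>c\<in>K. F \<zeta> c \<noteq> None"
        using less.prems(2) act_apply[OF b, of "F \<zeta>"] inv b
        unfolding F local_invariant_def twist_closed_def by metis
      then have "\<Psi> (F \<zeta>) = \<Psi> f0" using less.IH[OF z(2,1)] by blast
      then show ?thesis using inv b unfolding local_invariant_def F by blast
    next
      case lim
      let ?P = "\<lambda>\<zeta>. (\<zeta>, \<eta>) \<in> r \<and> \<zeta> \<noteq> \<eta>"
      have F: "F \<eta> = evconst r ?P F"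
        using run less.prems(1) lim unfolding run_ok_def by auto
      have totP: "(x, y) \<in> r \<or> (y, x) \<in> r" if "?P x" "?P y" for x y
        using tot that by (auto simp: Field_def)
      have "\<exists>x. ?P x" using lim(1) tot less.prems(1) refl by (auto simp: refl_on_def)
      \<comment> \<open>On the finite set K the limit is already attained at some earlier index, to
        which the induction hypothesis applies.\<close>
      then obtain \<zeta> where z: "?P \<zeta>" "\<forall>\<xi>. ?P \<xi> \<and> (\<zeta>, \<xi>) \<in> r \<longrightarrow> (\<forall>c\<in>K. F \<xi> c = F \<eta> c)"
        using evconst_finite[of ?P r K F, OF totP tr] inv less.prems(2) 
        unfolding F local_invariant_def by auto
      then have zF: "\<zeta> \<in> Field r" by (auto simp: Field_def)
      with z refl have eq: "\<forall>c\<in>K. F \<zeta> c = F \<eta> c" by (auto simp: refl_on_def)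
      then have "\<forall>c\<in>K. F \<zeta> c \<noteq> None" using less.prems(2) by simp
      then have "\<Psi> (F \<zeta>) = \<Psi> f0" using less.IH[OF _ zF] z(1) by blast
      with eq inv show ?thesis unfolding local_invariant_def by metis
    qed
  qed
qed

text \<open>The terminal configuration is not indexed by a member of \<open>Field r\<close>, so the
  distinction between start, successor and limit has to be made once more for it.\<close>

lemma local_invariant_accessible:
  assumes acc: "accessible_via r f0 g" and inv: "local_invariant K \<Psi>"
    and g: "\<forall>c\<in>K. g c \<noteq> None"
  shows "\<Psi> g = \<Psi> f0"
proof -
  from acc obtain \<sigma> F where wo: "Well_order r" and tw: "\<And>\<eta>. \<eta> \<in> Field r \<Longrightarrow> \<sigma> \<eta> \<in> basic_twists"
    and run: "run_ok r \<sigma> f0 F" and t: "g = terminal r \<sigma> f0 F"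
    unfolding accessible_via_def by blast
  note R = local_invariant_run[OF wo tw run inv]
  have tr: "trans r" and anti: "antisym r" and total: "total_on (Field r) r"
    and refl: "refl_on (Field r) r"
    using wo by (auto simp: well_order_on_def linear_order_on_def partial_order_on_def preorder_on_def)
  have tot: "(x, y) \<in> r \<or> (y, x) \<in> r" if "x \<in> Field r" "y \<in> Field r" for x y
    using that total refl by (cases "x = y") (auto simp: total_on_def refl_on_def)
  let ?max = "\<lambda>m. m \<in> Field r \<and> (\<forall>\<zeta>\<in>Field r. (\<zeta>, m) \<in> r)"
  consider (emp) "Field r = {}" | (suc) m where "Field r \<noteq> {}" "?max m"
    | (lim) "Field r \<noteq> {}" "\<not> (\<exists>m. ?max m)" by blast
  then show ?thesis
  proof cases
    case emp
    then show ?thesis using t by (simp add: terminal_def)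
  next
    case (suc m)
    have "(THE m. ?max m) = m"
      by (rule the_equality) (use suc(2) anti in \<open>auto simp: antisym_def\<close>)
    moreover have "\<exists>m\<in>Field r. \<forall>\<zeta>\<in>Field r. (\<zeta>, m) \<in> r" using suc by blast
    ultimately have G: "g = act (\<sigma> m) (F m)"
      using t suc(1) by (simp add: terminal_def Let_def)
    have b: "\<sigma> m \<in> basic_twists" using tw suc by blast
    have "\<forall>c\<in>K. F m c \<noteq> None"
      using g act_apply[OF b, of "F m"] inv b
      unfolding G local_invariant_def twist_closed_def by metis
    then have "\<Psi> (F m) = \<Psi> f0" using R suc by blast
    then show ?thesis using inv b unfolding local_invariant_def G by blast
  next
    case lim
    then have G: "g = evconst r (\<lambda>\<zeta>. \<zeta> \<in> Field r) F"
      using t unfolding terminal_def by auto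
    obtain \<zeta> where z: "\<zeta> \<in> Field r"
        "\<forall>\<xi>. \<xi> \<in> Field r \<and> (\<zeta>, \<xi>) \<in> r \<longrightarrow> (\<forall>c\<in>K. F \<xi> c = g c)"
      using evconst_finite[of "\<lambda>\<zeta>. \<zeta> \<in> Field r" r K F, OF tot tr] inv g lim(1)
      unfolding G local_invariant_def by auto
    with refl have eq: "\<forall>c\<in>K. F \<zeta> c = g c" by (auto simp: refl_on_def)
    then have "\<forall>c\<in>K. F \<zeta> c \<noteq> None" using g by simp
    then have "\<Psi> (F \<zeta>) = \<Psi> f0" using R z(1) by blast
    with eq inv show ?thesis unfolding local_invariant_def by metis
  qed
qed

lemma twist_closedI:
  assumes "\<And>i \<alpha> c. qt i \<alpha> c \<in> K \<longleftrightarrow> c \<in> K"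
  shows "twist_closed K"
proof -
  have "(qt i \<alpha> ^^ n) c \<in> K \<longleftrightarrow> c \<in> K" for i \<alpha> n c
    by (induction n) (auto simp: assms)
  then show ?thesis by (auto simp: twist_closed_def basic_twists_def quarter_twists_def)
qed

lemma twist_closed_cluster: "twist_closed (cluster c)"
  by (rule twist_closedI) (metis cluster_sym cluster_trans qt_cluster(1))

lemma twist_closed_center: "twist_closed {c. center_cell c}"
  by (rule twist_closedI) simp

lemma center_cell_cases:
  assumes "center_cell c"
  obtains s where "is_inf s"
    "Rep_cell c = (s, Fin Zero, Fin Zero) \<or> Rep_cell c = (Fin Zero, s, Fin Zero) \<or> Rep_cell c = (Fin Zero, Fin Zero, s)"
proof -
  obtain x y z where c: "Rep_cell c = (x, y, z)" by (cases "Rep_cell c")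
  have "is_cell (x, y, z)" using is_cell_Rep[of c] by (simp add: c)
  then show ?thesis using assms that unfolding center_cell_def c is_cell_def by fastforce
qed

lemma finite_center: "finite {c :: 'l cell. center_cell c}"
proof -
  let ?S = "{PInf, MInf, Fin Zero} :: 'l ext set"
  have "Rep_cell c \<in> ?S \<times> ?S \<times> ?S" if c: "center_cell c" for c :: "'l cell"
    by (rule center_cell_cases[OF c]) (auto simp: is_inf_cases)
  then have "Rep_cell ` {c :: 'l cell. center_cell c} \<subseteq> ?S \<times> ?S \<times> ?S" by blast
  then have "finite (Rep_cell ` {c :: 'l cell. center_cell c})" by (rule finite_subset) auto
  then show ?thesis by (rule finite_imageD) (auto simp: inj_on_def Rep_cell_inject)
qed

lemma card_act:
  assumes "T \<in> basic_twists" "twist_closed K"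
  shows "card {c \<in> K. act T f c = v} = card {c \<in> K. f c = v}"
proof -
  have "bij_betw T {c \<in> K. f c = v} {c \<in> K. act T f c = v}"
  proof (rule bij_betw_imageI)
    show "inj_on T {c \<in> K. f c = v}" using basic_twists_bij[OF assms(1)]
      by (meson bij_betw_imp_inj_on inj_on_subset subset_UNIV)
    show "T ` {c \<in> K. f c = v} = {c \<in> K. act T f c = v}"
    proof (intro equalityI subsetI)
      fix d assume d: "d \<in> {c \<in> K. act T f c = v}"
      obtain c where c: "d = T c" using basic_twists_bij[OF assms(1)] by (rule bij_pointE)
      with d have "c \<in> K" "f c = v"
        using assms act_apply[OF assms(1), of f] by (auto simp: twist_closed_def)
      with c show "d \<in> T ` {c \<in> K. f c = v}" by blast
    qed (use assms act_apply[OF assms(1), of f] in \<open>auto simp: twist_closed_def\<close>)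
  qed
  then show ?thesis by (rule bij_betw_same_card[symmetric])
qed

lemma local_invariant_card: "local_invariant (cluster c) (\<lambda>f. card {d \<in> cluster c. f d = v} = n)"
  unfolding local_invariant_def
proof (intro conjI ballI allI impI)
  fix f f' :: "'a config" assume "\<forall>d\<in>cluster c. f d = f' d"
  then have "{d \<in> cluster c. f d = v} = {d \<in> cluster c. f' d = v}" by auto
  then show "(card {d \<in> cluster c. f d = v} = n) = (card {d \<in> cluster c. f' d = v} = n)" by simp
qed (simp_all add: finite_cluster twist_closed_cluster card_act)

section \<open>Rotations of the cube and the center cluster as a local invariant\<close>

lemma pt_eqI: "(\<And>i. i < 3 \<Longrightarrow> crd p i = crd q i) \<Longrightarrow> p = q"
proof -
  assume *: "\<And>i. i < 3 \<Longrightarrow> crd p i = crd q i"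
  show "p = q" using *[of 0] *[of 1] *[of 2] by (cases p; cases q) (simp add: crd_def)
qed

lemma crd_rot: "i < 3 \<Longrightarrow> crd (rot \<pi> \<epsilon> p) i = (if \<epsilon> i then neg (crd p (\<pi> i)) else crd p (\<pi> i))"
proof -
  assume "i < 3"
  then consider "i = 0" | "i = 1" | "i = 2" by linarith
  then show ?thesis by cases (auto simp: crd_def rot_def Let_def split: prod.splits)
qed

text \<open>\<open>rot\<close> reads coordinate \<pi> i for position i. Permutations therefore
  compose in reverse order, and the inner sign is looked up at \<pi> i.\<close>

lemma rot_rot:
  assumes "\<pi> permutes {0, 1, 2}"
  shows "rot \<pi> \<epsilon> (rot \<pi>' \<epsilon>' p) = rot (\<pi>' \<circ> \<pi>) (\<lambda>i. \<epsilon> i \<noteq> \<epsilon>' (\<pi> i)) p"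
proof -
  have "\<pi> i < 3" if "i < 3" for i
  proof -
    have "\<pi> i \<in> {0, 1, 2}" using that permutes_in_image[OF assms, of i] by auto
    then show ?thesis by auto
  qed
  then have *: "crd (rot \<pi>' \<epsilon>' p) (\<pi> i) =
      (if \<epsilon>' (\<pi> i) then neg (crd p (\<pi>' (\<pi> i))) else crd p (\<pi>' (\<pi> i)))" if "i < 3" for i
    using that by (intro crd_rot)
  show ?thesis by (rule pt_eqI) (auto simp: crd_rot *)
qed

lemma is_rotation_comp:
  assumes "is_rotation \<pi> \<epsilon>" "is_rotation \<pi>' \<epsilon>'"
  shows "is_rotation (\<pi>' \<circ> \<pi>) (\<lambda>i. \<epsilon> i \<noteq> \<epsilon>' (\<pi> i))"
proof -
  define s where "s \<epsilon> i = (if \<epsilon> i then - 1 else 1 :: int)" for \<epsilon> and i :: nat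
  have rot_iff: "is_rotation \<pi> \<epsilon> \<longleftrightarrow> \<pi> permutes {0, 1, 2} \<and> sign \<pi> * prod (s \<epsilon>) {0, 1, 2} = 1" for \<pi> \<epsilon>
    unfolding is_rotation_def s_def[abs_def] ..
  have p: "\<pi> permutes {0, 1, 2}" "\<pi>' permutes {0, 1, 2}"
    and s: "sign \<pi> * prod (s \<epsilon>) {0, 1, 2} = 1" "sign \<pi>' * prod (s \<epsilon>') {0, 1, 2} = 1"
    using assms unfolding rot_iff by simp_all
  have "prod (s (\<lambda>i. \<epsilon> i \<noteq> \<epsilon>' (\<pi> i))) A = prod (s \<epsilon>) A * prod (\<lambda>i. s \<epsilon>' (\<pi> i)) A" for A
    unfolding prod.distrib[symmetric] by (rule prod.cong) (auto simp: s_def)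
  \<comment> \<open>The inner signs are merely reindexed by \<pi>, so the determinant is
    multiplicative.\<close>
  moreover have "prod (\<lambda>i. s \<epsilon>' (\<pi> i)) {0, 1, 2} = prod (s \<epsilon>') {0, 1, 2}"
    using prod.permute[OF p(1), of "s \<epsilon>'"] by (simp only: comp_def)
  moreover have "sign (\<pi>' \<circ> \<pi>) = sign \<pi>' * sign \<pi>"
    by (intro sign_compose permutes_imp_permutation[OF _ p(1)] permutes_imp_permutation[OF _ p(2)]) auto
  ultimately have eq: "sign (\<pi>' \<circ> \<pi>) * prod (s (\<lambda>i. \<epsilon> i \<noteq> \<epsilon>' (\<pi> i))) {0, 1, 2} =
      (sign \<pi> * prod (s \<epsilon>) {0, 1, 2}) * (sign \<pi>' * prod (s \<epsilon>') {0, 1, 2})"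
    by (simp only: mult.assoc mult.commute mult.left_commute)
  show ?thesis unfolding rot_iff eq s using permutes_compose[OF p] by simp
qed

text \<open>Together with \<open>qtr_sign\<close> this encodes the inverse quarter turn of the whole
  cube, since \<open>act\<close> evaluates a configuration at the inverse image of a cell.\<close>

fun qtr_perm :: "axis \<Rightarrow> nat \<Rightarrow> nat" where
  "qtr_perm AX = Transposition.transpose 1 2"
| "qtr_perm AY = Transposition.transpose 0 2"
| "qtr_perm AZ = Transposition.transpose 0 1"

fun qtr_sign :: "axis \<Rightarrow> nat \<Rightarrow> bool" where
  "qtr_sign AX = (\<lambda>i. i = 2)"
| "qtr_sign AY = (\<lambda>i. i = 0)"
| "qtr_sign AZ = (\<lambda>i. i = 1)"

lemma is_rotation_qtr: "is_rotation (qtr_perm i) (qtr_sign i)"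
proof -
  have "Transposition.transpose a b permutes {0, 1, 2}" if "a \<in> {0, 1, 2}" "b \<in> {0, 1, 2}" for a b :: nat
    using that by (rule permutes_swap_id)
  then show ?thesis unfolding is_rotation_def
    by (cases i) (auto simp: sign_swap_id)
qed

text \<open>A face twist fixes the center of its face. The middle slice about an axis contains
  exactly the four centers off this axis, so on centers its turn agrees with a rotation of the whole
  cube.\<close>

lemma iqt_center:
  assumes "center_cell c"
  shows "Rep_cell (iqt i \<alpha> c) = (if \<alpha> = Fin Zero then rot (qtr_perm i) (qtr_sign i) (Rep_cell c) else Rep_cell c)"
  by (rule center_cell_cases[OF assms]; cases i)
    (auto simp: is_inf_cases Rep_iqt rot_def crd_def Let_def Transposition.transpose_def)

definition center_standard :: "'l config \<Rightarrow> bool" where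
  "center_standard f \<longleftrightarrow> (\<exists>\<pi> \<epsilon>. is_rotation \<pi> \<epsilon> \<and>
     (\<forall>c. center_cell c \<longrightarrow> f c = solved_pt (rot \<pi> \<epsilon> (Rep_cell c))))"

lemma center_standardI:
  "is_rotation \<pi> \<epsilon> \<Longrightarrow> (\<And>c. center_cell c \<Longrightarrow> f c = solved_pt (rot \<pi> \<epsilon> (Rep_cell c))) \<Longrightarrow> center_standard f"
  unfolding center_standard_def by (intro exI conjI allI impI)

lemma center_standard_qt: 
  assumes "center_standard f"
  shows "center_standard (act (qt i \<alpha>) f)"
proof -
  obtain \<pi> \<epsilon> where r: "is_rotation \<pi> \<epsilon>" "\<And>c. center_cell c \<Longrightarrow> f c = solved_pt (rot \<pi> \<epsilon> (Rep_cell c))"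
    using assms unfolding center_standard_def by (elim exE conjE) simp
  have eq: "act (qt i \<alpha>) f c = solved_pt (rot \<pi> \<epsilon> (if \<alpha> = Fin Zero then rot (qtr_perm i) (qtr_sign i) (Rep_cell c) else Rep_cell c))"
    if "center_cell c" for c
    using r(2)[of "iqt i \<alpha> c"] that by (simp add: act_def iqt_center)
  show ?thesis
  proof (cases "\<alpha> = Fin Zero")
    case True
    have p: "\<pi> permutes {0, 1, 2}" using r(1) by (simp add: is_rotation_def)
    have "act (qt i \<alpha>) f c = solved_pt (rot (qtr_perm i \<circ> \<pi>) (\<lambda>k. \<epsilon> k \<noteq> qtr_sign i (\<pi> k)) (Rep_cell c))"
      if "center_cell c" for c
      unfolding eq[OF that] by (simp only: True if_True rot_rot[OF p] simp_thms)
    then show ?thesis by (rule center_standardI[OF is_rotation_comp[OF r(1) is_rotation_qtr[of i]]])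
  next
    case False
    then show ?thesis by (intro center_standardI[OF r(1)]) (simp add: eq)
  qed
qed

text \<open>Preservation in one direction suffices: four quarter turns compose to the identity, so
  three further turns lead back.\<close>

lemma local_invariantI:
  fixes K :: "'l cell set"
  assumes "finite K" "twist_closed K" "\<And>f f'. (\<And>c. c \<in> K \<Longrightarrow> f c = f' c) \<Longrightarrow> \<Psi> f \<Longrightarrow> \<Psi> f'"
    and step: "\<And>i \<alpha> f. \<Psi> f \<Longrightarrow> \<Psi> (act (qt i \<alpha>) f)"
  shows "local_invariant K \<Psi>"
proof -
  have "\<Psi> (act (qt i \<alpha>) f) \<Longrightarrow> \<Psi> f" for i \<alpha> f
  proof -
    assume "\<Psi> (act (qt i \<alpha>) f)"
    then have "\<Psi> (act (qt i \<alpha>) (act (qt i \<alpha>) (act (qt i \<alpha>) (act (qt i \<alpha>) f))))"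
      using step by blast
    moreover have "act (qt i \<alpha>) (act (qt i \<alpha>) (act (qt i \<alpha>) g)) = act (iqt i \<alpha>) g" for g :: "'l config"
      by (simp add: iqt_eq_funpow eval_nat_numeral act_comp bij_comp)
    moreover from this have "act (qt i \<alpha>) (act (qt i \<alpha>) (act (qt i \<alpha>) (act (qt i \<alpha>) f))) = f" by (metis act_qt_iqt(1))
    ultimately show "\<Psi> f" by (simp only:)
  qed
  with step have eq: "\<Psi> (act (qt i \<alpha>) f) = \<Psi> f" for i \<alpha> f by blast
  have "\<Psi> ((act (qt i \<alpha>) ^^ n) f) = \<Psi> f" for i \<alpha> f n
    by (induction n) (simp_all add: eq)
  then have "\<Psi> (act (qt i \<alpha> ^^ n) f) = \<Psi> f" for i \<alpha> f n
    unfolding act_funpow[OF bij_qt] .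
  then have "\<Psi> (act T f) = \<Psi> f" if "T \<in> basic_twists" for T f
    using that by (auto simp: basic_twists_def quarter_twists_def)
  moreover have "\<Psi> f = \<Psi> f'" if "\<forall>c\<in>K. f c = f' c" for f f'
    using assms(3)[of f f'] assms(3)[of f' f] that by auto
  ultimately show ?thesis using assms(1,2) unfolding local_invariant_def by blast
qed

lemma local_invariant_center: "local_invariant {c. center_cell c} center_standard"
proof (rule local_invariantI[OF finite_center twist_closed_center])
  fix f f' :: "'a config"
  assume eq: "\<And>c. c \<in> {c. center_cell c} \<Longrightarrow> f c = f' c" and "center_standard f"
  from this(2) obtain \<pi> \<epsilon> where r: "is_rotation \<pi> \<epsilon>"
    and *: "\<And>c. center_cell c \<Longrightarrow> f c = solved_pt (rot \<pi> \<epsilon> (Rep_cell c))"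
    unfolding center_standard_def by (elim exE conjE) simp
  have f': "f' c = solved_pt (rot \<pi> \<epsilon> (Rep_cell c))" if "center_cell c" for c
    using eq[of c] *[OF that] that by simp
  show "center_standard f'" by (rule center_standardI[OF r f'])
qed (rule center_standard_qt)

lemma standard_alt: "standard f \<longleftrightarrow> legal f \<and>
   (\<forall>c col. \<not> center_cell c \<longrightarrow> card {d \<in> cluster c. f d = Some col} = 4) \<and> center_standard f"
proof -
  have "(\<forall>K\<in>noncenter_clusters. P K) \<longleftrightarrow> (\<forall>c. \<not> center_cell c \<longrightarrow> P (cluster c))" for P :: "'a cell set \<Rightarrow> bool"
    by (auto simp: noncenter_clusters_def)
  then show ?thesis unfolding standard_def center_standard_def by simp
qed

text \<open>The colour counts and the condition on the centers are local invariants, hence transfer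
  in both directions. Both claims of non-accessibility follow from this equivalence.\<close>

lemma accessible_standard_iff:
  assumes "accessible TYPE('o) f g" "legal f" "legal g"
  shows "standard f \<longleftrightarrow> standard g"
proof -
  obtain r :: "'o rel" where r: "accessible_via r f g" using assms by (auto simp: accessible_def)
  note * = local_invariant_accessible[OF r]
  have "card {d \<in> cluster c. g d = Some col} = 4 \<longleftrightarrow> card {d \<in> cluster c. f d = Some col} = 4" for c col
    by (rule *[OF local_invariant_card]) (use assms in \<open>auto simp: legal_def\<close>)
  moreover have "center_standard g = center_standard f"
    by (rule *[OF local_invariant_center]) (use assms in \<open>auto simp: legal_def\<close>)
  ultimately show ?thesis using assms unfolding standard_alt by auto
qed

lemma legal_f_solved: "legal f_solved"
  unfolding legal_def
proof
  fix c :: "'a cell"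
  obtain x y z where c: "Rep_cell c = (x, y, z)" by (cases "Rep_cell c")
  have "is_cell (x, y, z)" using is_cell_Rep[of c] by (simp add: c)
  then show "f_solved c \<noteq> None"
    by (auto simp: f_solved_def solved_pt_def is_cell_def is_inf_cases c)
qed

lemma standard_f_solved: "standard (f_solved :: 'a config)"
proof -
  have r: "is_rotation id (\<lambda>i. False)" by (simp add: is_rotation_def permutes_id)
  have p: "rot id (\<lambda>i. False) p = p" for p :: "'a pt"
    by (cases p) (simp add: rot_def crd_def)
  have "center_standard (f_solved :: 'a config)"
    by (rule center_standardI[OF r]) (simp only: p f_solved_def)
  then show ?thesis using legal_f_solved card_f_solved_cluster unfolding standard_alt by blast
qed

section \<open>Commutators of twists\<close>

text \<open>Among the cells of S, which contains all cells moved by F, D moves only p, and it moves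
  p out of S. Conjugating F by D therefore replaces p by D p in the cycles of F and changes nothing
  else; after composition with the inverse of F a 3-cycle remains.\<close>

lemma commutator_act3:
  assumes D: "bij D" and F: "bij F" and p: "p \<in> S" "F p \<noteq> p" "D p \<notin> S"
    and FS: "\<And>c. c \<notin> S \<Longrightarrow> F c = c" "\<And>c. c \<in> S \<Longrightarrow> F c \<in> S"
    and DS: "\<And>c. c \<in> S \<Longrightarrow> c \<noteq> p \<Longrightarrow> D c = c"
  shows "act D (act F (act (inv D) (act (inv F) f))) = act3 p (D p) (F p) f"
proof
  fix x
  \<comment> \<open>Writing x as D (F v) removes the inverses: the left side at x becomes f (F (D
    v)).\<close>
  define u where "u = inv D x"
  define v where "v = inv F u"
  have u: "x = D u" using D by (simp add: u_def bij_is_surj surj_f_inv_f)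
  have v: "u = F v" using F by (simp add: v_def bij_is_surj surj_f_inv_f)
  have injD: "D a = D b \<longleftrightarrow> a = b" for a b using D by (metis bij_pointE)
  have injF: "F a = F b \<longleftrightarrow> a = b" for a b using F by (metis bij_pointE)
  have "act D (act F (act (inv D) (act (inv F) f))) x = f (F (D v))"
    using D F by (simp add: act_def inv_inv_eq u_def v_def)
  also have "\<dots> = act3 p (D p) (F p) f (D (F v))"
  proof -
    have FpS: "F p \<in> S" using FS(2) p(1) by blast
    have DFp: "D (F p) = F p" using DS[OF FpS] p(2) by blast
    have DpF: "F (D p) = D p" using FS(1) p(3) by blast
    have ne: "D p \<noteq> p" "D p \<noteq> F p" using p FpS by auto
    consider "v = p" | "F v = p" | "v \<noteq> p" "F v \<noteq> p" "v \<notin> S" | "v \<noteq> p" "F v \<noteq> p" "v \<in> S" by blast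
    then show ?thesis
    proof cases
      case 1
      then show ?thesis using DFp DpF ne p(2) by (simp add: act3_def)
    next
      case 2
      then have vS: "v \<in> S" "v \<noteq> p" using FS(1)[of v] p by metis+
      then have "D v = v" using DS by blast
      then show ?thesis using 2 ne p(2) by (simp add: act3_def)
    next
      case 3
      then have Fv: "F v = v" using FS(1) by blast
      show ?thesis
      proof (cases "D v = p")
        case True
        then show ?thesis using Fv ne p(2) by (simp add: act3_def)
      next
        case False
        have "D v \<notin> S"
        proof
          assume "D v \<in> S"
          then have "D (D v) = D v" using DS False by blast
          then have "D v = v" using injD by blast
          then show False using \<open>D v \<in> S\<close> 3 by simp
        qed
        then have "F (D v) = D v" "D v \<noteq> F p" using FS(1) FpS by auto
        then show ?thesis using Fv False 3 injD by (simp add: act3_def)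
      qed
    next
      case 4
      then have "D v = v" "D (F v) = F v" "F v \<noteq> D p" using DS FS(2) p(3) by metis+
      then show ?thesis using 4 injF by (simp add: act3_def)
    qed
  qed
  finally show "act D (act F (act (inv D) (act (inv F) f))) x = act3 p (D p) (F p) f x"
    using u v by simp
qed

lemma qt_fix: "cc i c \<noteq> \<alpha> \<Longrightarrow> qt i \<alpha> c = c"
  by (cases "Rep_cell c"; cases i) (auto simp: Rep_cell_inject[symmetric] Rep_qt)

lemma iqt_fix: "cc i c \<noteq> \<alpha> \<Longrightarrow> iqt i \<alpha> c = c"
  by (metis qt_fix qt_iqt(2))

lemma cc_qt_same [simp]: "cc i (qt i \<alpha> c) = cc i c"
  by (cases "Rep_cell c"; cases i) (auto simp: Rep_qt)

lemma cell_not_inf: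
  assumes "is_inf (cc k c)" "i \<noteq> k"
  shows "\<not> is_inf (cc i c)"
proof -
  obtain x y z where c: "Rep_cell c = (x, y, z)" by (cases "Rep_cell c")
  have "is_cell (x, y, z)" using is_cell_Rep[of c] by (simp add: c)
  with assms show ?thesis unfolding c by (cases i; cases k) (simp_all add: is_cell_def)
qed

lemma inf_axis: obtains k where "is_inf (cc k c)"
proof -
  obtain x y z where c: "Rep_cell c = (x, y, z)" by (cases "Rep_cell c")
  have "is_cell (x, y, z)" using is_cell_Rep[of c] by (simp add: c)
  then have "is_inf (cc AX c) \<or> is_inf (cc AY c) \<or> is_inf (cc AZ c)" unfolding c by (auto simp: is_cell_def)
  then show ?thesis using that by blast
qed

lemma third_axis: fixes i k :: axis assumes "i \<noteq> k" obtains j where "i \<noteq> j" "j \<noteq> k"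
proof -
  have "\<exists>j. i \<noteq> j \<and> j \<noteq> k" using assms
    by (cases i; cases k) (auto intro: exI[of _ AX] exI[of _ AY] exI[of _ AZ])
  then show ?thesis using that by blast
qed

lemma other_axes: fixes k :: axis obtains i j where "i \<noteq> j" "j \<noteq> k" "i \<noteq> k"
proof -
  obtain i where "i \<noteq> k" by (cases k) auto
  with third_axis[of i k] show ?thesis using that by blast
qed

lemma axis_exhaust: fixes i j k l :: axis assumes "i \<noteq> j" "j \<noteq> k" "i \<noteq> k" shows "l = i \<or> l = j \<or> l = k"
  using assms by (cases i; cases j; cases k; cases l) auto

lemma qt_slice_leaves_face:
  assumes "is_inf (cc k c)" "i \<noteq> k"
  shows "\<not> is_inf (cc k (qt i (cc i c) c))"
proof -
  obtain x y z where c: "Rep_cell c = (x, y, z)" by (cases "Rep_cell c")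
  have "is_cell (x, y, z)" using is_cell_Rep[of c] by (simp add: c)
  with assms show ?thesis unfolding Rep_qt c by (cases i; cases k) (simp_all add: is_cell_def)
qed

lemma neg_eq_self_iff: "neg v = v \<longleftrightarrow> v = Fin Zero"
  by (cases v) (auto simp: neg_dag_eq_self)

lemma qt_face_moves:
  assumes "is_inf (cc k c)" "\<not> center_cell c"
  shows "qt k (cc k c) c \<noteq> c"
proof
  assume "qt k (cc k c) c = c"
  then have eq: "qt_pt k (cc k c) (Rep_cell c) = Rep_cell c" by (metis Rep_qt)
  obtain x y z where c: "Rep_cell c = (x, y, z)" by (cases "Rep_cell c")
  have "center_cell c" using eq unfolding c center_cell_def
    by (cases k) (auto simp: neg_eq_self_iff)
  with assms show False by simp
qed

lemma iqt_slice_inf: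
  assumes "i \<noteq> j" "j \<noteq> k" "i \<noteq> k" "is_inf (cc k c)"
  shows "is_inf (cc i (iqt j (cc j c) c))"
  using assms by (cases "Rep_cell c"; cases i; cases j; cases k) (simp_all add: Rep_iqt)

text \<open>A slice twist about j takes a cell of the face k to a face perpendicular to i, which the
  slices about i do not meet; likewise with i and j exchanged. So a twist and its inverse cancel at
  every cell of the face except where the two slices cross.\<close>

lemma slice_commutator_on_face:
  assumes d: "i \<noteq> j" "j \<noteq> k" "i \<noteq> k" and "\<not> is_inf \<alpha>" "\<not> is_inf \<beta>" "is_inf (cc k c)"
  shows "qt i \<alpha> (qt j \<beta> (iqt i \<alpha> (iqt j \<beta> c))) = (if cc i c = \<alpha> \<and> cc j c = \<beta> then qt i \<alpha> c else c)"
proof (cases "cc j c = \<beta>")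
  case True
  then have "cc i (iqt j \<beta> c) \<noteq> \<alpha>" using iqt_slice_inf[OF d] assms by blast
  then have "qt j \<beta> (iqt i \<alpha> (iqt j \<beta> c)) = c" by (simp add: iqt_fix)
  then show ?thesis using True by (simp add: qt_fix)
next
  case False
  then have B: "iqt j \<beta> c = c" by (rule iqt_fix)
  have "qt i \<alpha> (qt j \<beta> (iqt i \<alpha> c)) = c"
  proof (cases "cc i c = \<alpha>")
    case True
    then have "cc j (iqt i \<alpha> c) \<noteq> \<beta>" using iqt_slice_inf[of j i k] d assms by blast
    then show ?thesis by (simp add: qt_fix)
  next
    case i: False
    then show ?thesis using False by (simp add: iqt_fix qt_fix)
  qed
  then show ?thesis using False B by simp
qed

lemma commutator_twists:
  fixes p :: "'l cell"
  assumes d: "i \<noteq> j" "j \<noteq> k" "i \<noteq> k" and inf: "is_inf (cc k p)" and nc: "\<not> center_cell p"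
  defines "A \<equiv> qt i (cc i p)" and "A' \<equiv> iqt i (cc i p)" and "B \<equiv> qt j (cc j p)" and "B' \<equiv> iqt j (cc j p)"
    and "F \<equiv> qt k (cc k p)" and "F' \<equiv> iqt k (cc k p)"
  shows "act A (act B (act A' (act B' (act F (act B (act A (act B' (act A' (act F' f))))))))) = act3 p (A p) (F p) f"
proof -
  define D where "D = A \<circ> B \<circ> A' \<circ> B'"
  have b: "bij A" "bij B" "bij A'" "bij B'" "bij F" "bij F'"
    by (simp_all add: A_def B_def A'_def B'_def F_def F'_def)
  have i: "inv A = A'" "inv B = B'" "inv A' = A" "inv B' = B" "inv F = F'"
    by (simp_all add: A_def B_def A'_def B'_def F_def F'_def)
  have bD: "bij D" using b by (simp add: D_def bij_comp)
  have iD: "inv D = B \<circ> A \<circ> B' \<circ> A'" using b by (simp add: D_def o_inv_distrib bij_comp i comp_assoc)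
  define S where "S = {c. cc k c = cc k p}"
  have fin: "\<not> is_inf (cc i p)" "\<not> is_inf (cc j p)" using cell_not_inf inf d by blast+
  have DS: "D c = (if cc i c = cc i p \<and> cc j c = cc j p then A c else c)" if "c \<in> S" for c
  proof -
    have "is_inf (cc k c)" using that inf by (simp add: S_def)
    from slice_commutator_on_face[OF d fin this] show ?thesis
      unfolding D_def A_def B_def A'_def B'_def comp_def .
  qed
  have pS: "p \<in> S" by (simp add: S_def)
  have Dp: "D p = A p" using DS[OF pS] by simp
  have "act D (act F (act (inv D) (act (inv F) f))) = act3 p (D p) (F p) f"
  proof (rule commutator_act3[OF bD b(5) pS])
    show "F p \<noteq> p" unfolding F_def by (rule qt_face_moves[OF inf nc])
    show "D p \<notin> S" unfolding Dp A_def S_def using qt_slice_leaves_face[OF inf d(3)] inf by auto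
    show "F c = c" if "c \<notin> S" for c using that unfolding F_def S_def by (auto intro: qt_fix)
    show "F c \<in> S" if "c \<in> S" for c using that unfolding F_def S_def by simp
    show "D c = c" if "c \<in> S" "c \<noteq> p" for c
    proof -
      have "\<not> (cc i c = cc i p \<and> cc j c = cc j p)"
      proof
        assume "cc i c = cc i p \<and> cc j c = cc j p"
        then have "cc l c = cc l p" for l using axis_exhaust[OF d, of l] that(1) by (auto simp: S_def)
        then have "Rep_cell c = Rep_cell p"
          by (metis co.simps prod_cases3)
        then show False using that(2) by (simp add: Rep_cell_inject)
      qed
      then show ?thesis by (simp only: DS[OF that(1)] if_False)
    qed
  qed
  then have "act D (act F (act (B \<circ> A \<circ> B' \<circ> A') (act F' f))) = act3 p (A p) (F p) f"
    unfolding Dp iD i .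
  then show ?thesis unfolding D_def using b by (simp only: act_comp bij_comp)
qed

lemma qt_commute: "qt i \<alpha> (qt i \<beta> c) = qt i \<beta> (qt i \<alpha> c)"
proof (cases "\<alpha> = \<beta>")
  case False
  then show ?thesis by (cases "cc i c = \<alpha>"; cases "cc i c = \<beta>") (simp_all add: qt_fix)
qed simp

lemma act_qt_commute: "act (qt i \<alpha>) (act (qt i \<beta>) f) = act (qt i \<beta>) (act (qt i \<alpha>) f)"
  by (simp add: act_comp[symmetric] comp_def qt_commute)

text \<open>Two twists about one axis commute, so the pattern of \<open>commutator_twists\<close>
  collapses. It then serves as an idle move for those layers n that want no 3-cycle while others
  carry one out.\<close>

lemma commutator_same_axis:
  fixes i k :: axis and \<alpha> \<beta> \<gamma> :: "'l ext"
  defines "A \<equiv> qt i \<alpha>" and "A' \<equiv> iqt i \<alpha>" and "B \<equiv> qt i \<beta>" and "B' \<equiv> iqt i \<beta>"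
    and "F \<equiv> qt k \<gamma>" and "F' \<equiv> iqt k \<gamma>"
  shows "act A (act B (act A' (act B' (act F (act B (act A (act B' (act A' (act F' f))))))))) = f"
proof -
  have c: "act A' (act B' g) = act B' (act A' g)" for g
    unfolding A'_def B'_def using act_qt_commute[of i \<alpha> \<beta> "act (iqt i \<beta>) (act (iqt i \<alpha>) g)"]
    by (metis act_qt_iqt)
  have e1: "act A (act B (act A' (act B' g))) = g" for g
    unfolding c by (simp add: A_def B_def A'_def B'_def)
  have e2: "act B (act A (act B' (act A' g))) = g" for g
    unfolding c[symmetric] by (simp add: A_def B_def A'_def B'_def)
  show ?thesis unfolding e1 e2 by (simp add: F_def F'_def)
qed

text \<open>The value at the infinite coordinates is a default without meaning, which happens to
  equal the index of the middle layer; uses of \<open>idx\<close> are guarded by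
  \<open>is_inf\<close>.\<close>

fun idx :: "('l \<Rightarrow> nat) \<Rightarrow> 'l ext \<Rightarrow> nat" where
  "idx e (Fin (Pos r)) = Suc (e r)"
| "idx e (Fin (Neg r)) = Suc (e r)"
| "idx e (Fin Zero) = 0"
| "idx e PInf = 0"
| "idx e MInf = 0"

lemma idx_neg [simp]: "idx e (neg v) = idx e v"
proof (cases v)
  case (Fin a)
  then show ?thesis by (cases a) auto
qed auto

section \<open>Layer indices and recolouring of clusters\<close>

definition coord_index :: "('l \<Rightarrow> nat) \<Rightarrow> 'l ext \<Rightarrow> nat set" where
  "coord_index e v = (if is_inf v then {} else {idx e v})"

definition index_set :: "('l \<Rightarrow> nat) \<Rightarrow> 'l cell \<Rightarrow> nat set" where
  "index_set e c = coord_index e (cc AX c) \<union> coord_index e (cc AY c) \<union> coord_index e (cc AZ c)"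

lemma coord_index_neg [simp]: "coord_index e (neg v) = coord_index e v"
  by (simp add: coord_index_def)

lemma index_set_qt [simp]: "index_set e (qt i \<alpha> c) = index_set e c"
  unfolding index_set_def Rep_qt by (cases "Rep_cell c"; cases i) (simp_all add: Un_ac)

lemma index_set_iqt [simp]: "index_set e (iqt i \<alpha> c) = index_set e c"
  by (metis index_set_qt qt_iqt(1))

lemma index_set_axis: "\<not> is_inf (cc i c) \<Longrightarrow> idx e (cc i c) \<in> index_set e c"
  by (cases i) (simp_all add: index_set_def coord_index_def)

lemma index_set_face:
  assumes "i \<noteq> j" "j \<noteq> k" "i \<noteq> k" "is_inf (cc k c)"
  shows "index_set e c = {idx e (cc i c), idx e (cc j c)}"
proof -
  have "\<not> is_inf (cc i c)" "\<not> is_inf (cc j c)" using cell_not_inf assms by blast+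
  with assms show ?thesis unfolding index_set_def coord_index_def by (cases i; cases j; cases k) auto
qed

lemma qt_trivial: "\<not> is_inf \<alpha> \<Longrightarrow> idx e \<alpha> \<notin> index_set e c \<Longrightarrow> qt i \<alpha> c = c"
  using index_set_axis qt_fix by metis

lemma iqt_trivial: "\<not> is_inf \<alpha> \<Longrightarrow> idx e \<alpha> \<notin> index_set e c \<Longrightarrow> iqt i \<alpha> c = c"
  using index_set_axis iqt_fix by metis

definition lo_index :: "('l \<Rightarrow> nat) \<Rightarrow> 'l cell \<Rightarrow> nat" where "lo_index e c = Min (index_set e c)"
definition hi_index :: "('l \<Rightarrow> nat) \<Rightarrow> 'l cell \<Rightarrow> nat" where "hi_index e c = Max (index_set e c)"

lemma index_set_pair: obtains a b where "index_set e c = {a, b}"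
proof -
  obtain k where k: "is_inf (cc k c)" using inf_axis .
  obtain i j where "i \<noteq> j" "j \<noteq> k" "i \<noteq> k" using other_axes .
  from index_set_face[OF this k] show ?thesis using that by blast
qed

lemma index_set_lo_index_hi_index: "index_set e c = {lo_index e c, hi_index e c}" and lo_index_le_hi_index: "lo_index e c \<le> hi_index e c"
proof -
  obtain a b where "index_set e c = {a, b}" using index_set_pair .
  then have "index_set e c = {lo_index e c, hi_index e c} \<and> lo_index e c \<le> hi_index e c"
    unfolding lo_index_def hi_index_def by (cases a b rule: linorder_cases) (auto simp: min_def max_def)
  then show "index_set e c = {lo_index e c, hi_index e c}" "lo_index e c \<le> hi_index e c" by auto
qed

lemma lo_index_hi_index_eq: "index_set e d = index_set e c \<Longrightarrow> lo_index e d = lo_index e c" "index_set e d = index_set e c \<Longrightarrow> hi_index e d = hi_index e c"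
  by (simp_all add: lo_index_def hi_index_def)

lemma lo_index_hi_index_twist [simp]: "lo_index e (qt i \<alpha> c) = lo_index e c" "hi_index e (qt i \<alpha> c) = hi_index e c"
  "lo_index e (iqt i \<alpha> c) = lo_index e c" "hi_index e (iqt i \<alpha> c) = hi_index e c"
  by (simp_all add: lo_index_def hi_index_def)

lemma idx_eq_0: "\<not> is_inf v \<Longrightarrow> idx e v = 0 \<longleftrightarrow> v = Fin Zero"
  by (cases "(e, v)" rule: idx.cases) auto

lemma center_cell_iff_hi_index: "center_cell c \<longleftrightarrow> hi_index e c = 0"
proof -
  obtain x y z where c: "Rep_cell c = (x, y, z)" by (cases "Rep_cell c")
  have cell: "is_cell (x, y, z)" using is_cell_Rep[of c] by (simp add: c)
  have "hi_index e c = 0 \<longleftrightarrow> index_set e c \<subseteq> {0}"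
    using index_set_lo_index_hi_index[of e c] lo_index_le_hi_index[of e c] by auto
  also have "\<dots> \<longleftrightarrow> center_cell c"
    unfolding index_set_def coord_index_def center_cell_def c using cell
    by (auto simp: idx_eq_0 is_cell_def)
  finally show ?thesis by simp
qed

text \<open>The layer m is imposed on the slice twist that occurs in the 3-cycle, the twist A common
  to all n. The second slice through p enters only the commutator and is left free here.\<close>

definition twist_cycles :: "('l \<Rightarrow> nat) \<Rightarrow> 'l cell set \<Rightarrow> nat \<Rightarrow> ('l cell \<times> 'l cell \<times> 'l cell) set" where
  "twist_cycles e P m = {(p, qt i (cc i p) p, qt k (cc k p) p) | p i k.
     p \<in> P \<and> i \<noteq> k \<and> is_inf (cc k p) \<and> idx e (cc i p) = m}"

text \<open>A detour around a j-slice turn of p: turn the face, turn the slice about j through the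
  new position, and turn a face in one direction or the other. The middle turn has the layer of
  \<open>cc i p\<close> in place of that of \<open>cc j p\<close>.\<close>

lemma slice_path:
  fixes p :: "'l cell"
  assumes "i \<noteq> j" "j \<noteq> k" "i \<noteq> k" "is_inf (cc k p)"
  defines "q \<equiv> qt k (cc k p) p"
  defines "a \<equiv> qt j (cc j q) q" and "b \<equiv> qt j (cc j p) p"
  shows "is_inf (cc i a)" "is_inf (cc i b)" "idx e (cc j q) = idx e (cc i p)"
    "a = qt i (cc i b) b \<or> b = qt i (cc i a) a"
proof -
  obtain x y z where c: "Rep_cell p = (x, y, z)" by (cases "Rep_cell p")
  note R = a_def b_def q_def Rep_qt c
  show "is_inf (cc i a)" "is_inf (cc i b)" "idx e (cc j q) = idx e (cc i p)"
    using assms(1-4) unfolding R by (cases i; cases j; cases k; simp)+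
  show "a = qt i (cc i b) b \<or> b = qt i (cc i a) a"
    using assms(1-4) unfolding Rep_cell_inject[symmetric] R
    by (cases i; cases j; cases k) simp_all
qed

context
  fixes e :: "'l \<Rightarrow> nat" and P :: "'l cell set" and m :: nat and r :: "('l config \<times> 'l config) set"
  assumes P: "twist_closed P" "\<And>c. c \<in> P \<Longrightarrow> \<not> center_cell c" "\<And>c. c \<in> P \<Longrightarrow> m \<in> index_set e c"
  defines "r \<equiv> cycle_step (twist_cycles e P m)"
begin

lemma cycle_reachable_twist_cycles:
  assumes "p \<in> P" "i \<noteq> k" "is_inf (cc k p)" "idx e (cc i p) = m"
  shows "cycle_reachable r p (qt i (cc i p) p) (qt k (cc k p) p)"
proof -
  have "(p, qt i (cc i p) p, qt k (cc k p) p) \<in> twist_cycles e P m"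
    unfolding twist_cycles_def using assms by blast
  then have "(f, act3 p (qt i (cc i p) p) (qt k (cc k p) p) f) \<in> r" for f
    unfolding r_def cycle_step_def by blast
  moreover have "qt i (cc i p) p \<noteq> p" "qt k (cc k p) p \<noteq> p" "qt i (cc i p) p \<noteq> qt k (cc k p) p"
    using qt_slice_leaves_face[OF assms(3,2)] qt_face_moves[OF assms(3) P(2)[OF assms(1)]] assms(3)
    by (metis, blast, metis cc_qt_same)
  ultimately show ?thesis unfolding cycle_reachable_def by (simp add: r_into_rtrancl) 
qed

lemma joined_slice: "p \<in> P \<Longrightarrow> i \<noteq> k \<Longrightarrow> is_inf (cc k p) \<Longrightarrow> idx e (cc i p) = m \<Longrightarrow> joined r p (qt i (cc i p) p)"
  unfolding joined_def using cycle_reachable_twist_cycles by blast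

lemma qt_P: "qt i \<alpha> c \<in> P \<longleftrightarrow> c \<in> P"
  using P(1) by (simp add: twist_closed_def)

text \<open>Every 3-cycle contains p, A p and F p, so it joins p with its image under the face twist
  as well.\<close>

lemma joined_face:
  assumes "p \<in> P" "is_inf (cc k p)"
  shows "joined r p (qt k (cc k p) p)"
proof -
  obtain i j where ij: "i \<noteq> j" "j \<noteq> k" "i \<noteq> k" using other_axes .
  have "m \<in> {idx e (cc i p), idx e (cc j p)}"
    using P(3)[OF assms(1)] index_set_face[OF ij assms(2)] by simp
  then obtain l where l: "l \<noteq> k" "idx e (cc l p) = m" using ij by auto
  have "cycle_reachable r p (qt k (cc k p) p) (qt l (cc l p) p)"
    using cycle_reachable_twist_cycles[OF assms(1) l(1) assms(2) l(2)] cycle_reachable_rot cycle_reachable_flip by metis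
  then show ?thesis unfolding joined_def by blast
qed

lemma joined_qt:
  assumes "c \<in> P"
  shows "joined r c (qt l \<alpha> c)"
proof (cases "cc l c = \<alpha>")
  case False
  then show ?thesis by (simp add: qt_fix joined_def)
next
  case l: True
  obtain k where k: "is_inf (cc k c)" using inf_axis .
  show ?thesis
  proof (cases "l = k")
    case True
    then show ?thesis using joined_face[OF assms k] l by simp
  next
    case False
    then obtain i where i: "l \<noteq> i" "i \<noteq> k" using third_axis by metis
    show ?thesis
    proof (cases "idx e (cc l c) = m")
      case True
      then show ?thesis using joined_slice[OF assms False k] l by simp
    next
      case nm: False
      then have im: "idx e (cc i c) = m"
        using P(3)[OF assms] index_set_face[OF i(1) i(2) False k, of e] by auto
      \<comment> \<open>The slice about l has the wrong layer for a 3-cycle. The detour of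
        \<open>slice_path\<close> through q and a reaches b by face turns and one slice turn of
        layer m.\<close>
      define q where "q = qt k (cc k c) c"
      define a where "a = qt l (cc l q) q"
      define b where "b = qt l (cc l c) c"
      note path = slice_path[OF i(1)[symmetric] False i(2) k, folded q_def, folded a_def b_def]
      have inP: "q \<in> P" "a \<in> P" "b \<in> P" using assms by (simp_all add: q_def a_def b_def qt_P)
      have "joined r c q" unfolding q_def by (rule joined_face[OF assms k])
      moreover have "joined r q a" unfolding a_def
        by (rule joined_slice[OF inP(1) False]) (use k im path(3)[of e] in \<open>simp_all add: q_def\<close>)
      moreover have "joined r a b"
        using path(4) joined_face[OF inP(2) path(1)] joined_face[OF inP(3) path(2)] joined_sym[of r] by metis
      ultimately have "joined r c b" using joined_trans[of r] by metis
      then show ?thesis unfolding b_def l .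
    qed
  qed
qed

lemma joined_cluster:
  assumes "c \<in> P" "d \<in> cluster c"
  shows "joined r c d \<and> d \<in> P"
  using assms(2) unfolding cluster_def mem_Collect_eq
proof (induction rule: rtrancl_induct)
  case base
  then show ?case using assms(1) by (simp add: joined_def)
next
  case (step d d')
  from step(2) obtain i \<alpha> where "d' = qt i \<alpha> d \<or> d = qt i \<alpha> d'"
    by (auto simp: twist_step_def quarter_twists_def)
  then have "joined r d d' \<and> d' \<in> P" using step(3) joined_qt qt_P joined_sym[of r] by metis
  then show ?case using step(3) joined_trans[of r] by metis
qed

text \<open>A pair of layers can carry several clusters: for distinct nonzero layers, (a, b) and (b,
  a) on the same face are not connected. They are repaired one at a time, by induction on the number
  of wrong cells.\<close>

lemma recolour_P:
  assumes "finite P"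
    and "\<And>c v. c \<in> P \<Longrightarrow> card {d \<in> cluster c. f d = v} = card {d \<in> cluster c. g d = v}"
    and "\<And>c. c \<in> P \<Longrightarrow> card {d \<in> cluster c. f d = f c} = 4"
  shows "(f, \<lambda>c. if c \<in> P then g c else f c) \<in> r\<^sup>*"
  using assms(2,3)
proof (induction "card {c \<in> P. f c \<noteq> g c}" arbitrary: f rule: less_induct)
  case less
  show ?case
  proof (cases "\<exists>x\<in>P. f x \<noteq> g x")
    case False
    then have "(\<lambda>c. if c \<in> P then g c else f c) = f" by auto
    then show ?thesis by simp
  next
    case True
    then obtain x where x: "x \<in> P" "f x \<noteq> g x" by blast
    let ?K = "cluster x"
    let ?f = "\<lambda>c. if c \<in> ?K then g c else f c"
    have KP: "?K \<subseteq> P" using joined_cluster[OF x(1)] by blast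
    have a: "(f, ?f) \<in> r\<^sup>*"
    proof (rule recolour[of "cluster x"])
      show "finite ?K" by (rule finite_cluster)
      show "joined r c d" if "c \<in> ?K" "d \<in> ?K" for c d
        using joined_cluster[OF x(1)] that joined_sym[of r] joined_trans[of r] by metis
      show "card {d \<in> ?K. f d = f c} = 4" if "c \<in> ?K" for c
        using less.prems(2)[of c] cluster_eq[OF that] KP that by auto
    qed (rule less.prems(1)[OF x(1)])
    have b: "(?f, \<lambda>c. if c \<in> P then g c else ?f c) \<in> r\<^sup>*"
    proof (rule less.hyps)
      show "card {c \<in> P. ?f c \<noteq> g c} < card {c \<in> P. f c \<noteq> g c}"
      proof (rule psubset_card_mono)
        have "x \<in> {c \<in> P. f c \<noteq> g c}" "x \<notin> {c \<in> P. ?f c \<noteq> g c}" using x by auto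
        moreover have "{c \<in> P. ?f c \<noteq> g c} \<subseteq> {c \<in> P. f c \<noteq> g c}" by (auto split: if_splits)
        ultimately show "{c \<in> P. ?f c \<noteq> g c} \<subset> {c \<in> P. f c \<noteq> g c}" by blast
      qed (use assms(1) in simp)
      have same: "{d \<in> cluster c. ?f d = v} = (if c \<in> ?K then {d \<in> cluster c. g d = v} else {d \<in> cluster c. f d = v})" for c v
      proof (cases "c \<in> ?K")
        case True
        then have "cluster c = ?K" by (rule cluster_eq)
        then show ?thesis using True by auto
      next
        case False
        then have "d \<notin> ?K" if "d \<in> cluster c" for d
          using that cluster_sym cluster_trans by blast
        then show ?thesis using False by auto
      qed
      show cnt: "card {d \<in> cluster c. ?f d = v} = card {d \<in> cluster c. g d = v}" if "c \<in> P" for c v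
        unfolding same using less.prems(1)[OF that] by simp
      show "card {d \<in> cluster c. ?f d = ?f c} = 4" if "c \<in> P" for c
      proof (cases "c \<in> ?K")
        case False
        then show ?thesis unfolding same using less.prems(2)[OF that] by simp
      next
        case True
        \<comment> \<open>The condition of four cells is known for colours that f uses. Equal counts
          show that g c is among them on this cluster.\<close>
        have "card {d \<in> cluster x. f d = g c} \<noteq> 0"
        proof -
          have "c \<in> {d \<in> cluster x. g d = g c}" using True by simp
          then have "card {d \<in> cluster x. g d = g c} \<noteq> 0" using finite_cluster[of x] by auto
          then show ?thesis using less.prems(1)[OF x(1)] by simp
        qed
        then obtain d where d: "d \<in> cluster x" "f d = g c" by (auto simp: card_eq_0_iff)
        have "card {d' \<in> cluster d. f d' = f d} = 4" using less.prems(2) d KP by blast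
        then have "card {d' \<in> cluster x. g d' = g c} = 4"
          using cluster_eq[OF d(1)] d(2) less.prems(1)[OF x(1)] by simp
        then show ?thesis unfolding same using True cluster_eq[OF True] by simp
      qed
    qed
    have "(\<lambda>c. if c \<in> P then g c else ?f c) = (\<lambda>c. if c \<in> P then g c else f c)"
      using KP by (intro ext) auto
    with rtrancl_trans[OF a b] show ?thesis by (simp only:)
  qed
qed

end

section \<open>The center cluster\<close>

text \<open>The six entries belong to the centers at +x, -x, +y, -y, +z, -z, in this order.\<close>

fun center_turn :: "axis \<Rightarrow> 'v \<times> 'v \<times> 'v \<times> 'v \<times> 'v \<times> 'v \<Rightarrow> 'v \<times> 'v \<times> 'v \<times> 'v \<times> 'v \<times> 'v" where
  "center_turn AX (a, a', b, b', c, c') = (a, a', c', c, b, b')"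
| "center_turn AY (a, a', b, b', c, c') = (c, c', b, b', a', a)"
| "center_turn AZ (a, a', b, b', c, c') = (b', b, a, a', c, c')"

definition center_colours :: "'l config \<Rightarrow> colour option \<times> colour option \<times> colour option \<times> colour option \<times> colour option \<times> colour option" where
  "center_colours f = (f (Abs_cell (PInf, Fin Zero, Fin Zero)), f (Abs_cell (MInf, Fin Zero, Fin Zero)),
     f (Abs_cell (Fin Zero, PInf, Fin Zero)), f (Abs_cell (Fin Zero, MInf, Fin Zero)),
     f (Abs_cell (Fin Zero, Fin Zero, PInf)), f (Abs_cell (Fin Zero, Fin Zero, MInf)))"

lemma iqt_Abs: "is_cell p \<Longrightarrow> iqt i \<alpha> (Abs_cell p) = Abs_cell (iqt_pt i \<alpha> p)"
  by (simp add: iqt_def Abs_cell_inverse)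

lemma center_colours_act: "center_colours (act (qt i (Fin Zero)) f) = center_turn i (center_colours f)"
  unfolding center_colours_def by (cases i) (simp_all add: act_def iqt_Abs is_cell_def)

lemma center_colours_eqD:
  assumes "center_colours f = center_colours g" "center_cell c"
  shows "f c = g c"
proof (rule center_cell_cases[OF assms(2)])
  fix s assume s: "is_inf s"
    and c: "Rep_cell c = (s, Fin Zero, Fin Zero) \<or> Rep_cell c = (Fin Zero, s, Fin Zero) \<or> Rep_cell c = (Fin Zero, Fin Zero, s)"
  have "c = Abs_cell (Rep_cell c)" by (simp add: Rep_cell_inverse)
  then have "c = Abs_cell (s, Fin Zero, Fin Zero) \<or> c = Abs_cell (Fin Zero, s, Fin Zero) \<or> c = Abs_cell (Fin Zero, Fin Zero, s)"
    using c by metis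
  then show "f c = g c" using s assms(1) unfolding is_inf_cases center_colours_def by auto
qed

lemma permutes_3_cases:
  fixes \<pi> :: "nat \<Rightarrow> nat"
  assumes "\<pi> permutes {0, 1, 2}"
  obtains "\<pi> = id" | "\<pi> = Transposition.transpose 0 1" | "\<pi> = Transposition.transpose 0 2" | "\<pi> = Transposition.transpose 1 2"
    | "\<pi> = Transposition.transpose 0 1 \<circ> Transposition.transpose 1 2"
    | "\<pi> = Transposition.transpose 1 2 \<circ> Transposition.transpose 0 1"
proof -
  have v: "\<pi> 0 \<in> {0, 1, 2}" "\<pi> 1 \<in> {0, 1, 2}" "\<pi> 2 \<in> {0, 1, 2}"
    using permutes_in_image[OF assms] by auto
  have i: "\<pi> 0 \<noteq> \<pi> 1" "\<pi> 0 \<noteq> \<pi> 2" "\<pi> 1 \<noteq> \<pi> 2"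
    using permutes_inj[OF assms] by (auto simp: inj_eq)
  have o: "\<pi> x = x" if "x \<notin> {0, 1, 2}" for x
    using permutes_not_in[OF assms that] .
  have eqI: "\<pi> = \<tau>" if "\<pi> 0 = \<tau> 0" "\<pi> 1 = \<tau> 1" "\<pi> 2 = \<tau> 2" "\<And>x. x \<notin> {0, 1, 2} \<Longrightarrow> \<tau> x = x" for \<tau>
  proof
    fix x show "\<pi> x = \<tau> x" using that o[of x] by (cases "x \<in> {0, 1, 2}") auto
  qed
  consider "\<pi> 0 = 0" "\<pi> 1 = 1" "\<pi> 2 = 2" | "\<pi> 0 = 1" "\<pi> 1 = 0" "\<pi> 2 = 2" | "\<pi> 0 = 2" "\<pi> 1 = 1" "\<pi> 2 = 0"
    | "\<pi> 0 = 0" "\<pi> 1 = 2" "\<pi> 2 = 1" | "\<pi> 0 = 1" "\<pi> 1 = 2" "\<pi> 2 = 0" | "\<pi> 0 = 2" "\<pi> 1 = 0" "\<pi> 2 = 1"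
    using v i by auto
  then show ?thesis
  proof cases
    case 1 show ?thesis by (rule that(1), rule eqI) (use 1 in auto)
  next
    case 2 show ?thesis by (rule that(2), rule eqI) (use 2 in \<open>auto simp: Transposition.transpose_def\<close>)
  next
    case 3 show ?thesis by (rule that(3), rule eqI) (use 3 in \<open>auto simp: Transposition.transpose_def\<close>)
  next
    case 4 show ?thesis by (rule that(4), rule eqI) (use 4 in \<open>auto simp: Transposition.transpose_def\<close>)
  next
    case 5 show ?thesis by (rule that(5), rule eqI) (use 5 in \<open>auto simp: Transposition.transpose_def\<close>)
  next
    case 6 show ?thesis by (rule that(6), rule eqI) (use 6 in \<open>auto simp: Transposition.transpose_def\<close>)
  qed
qed

definition unscrambles :: "colour option \<times> colour option \<times> colour option \<times> colour option \<times> colour option \<times> colour option \<Rightarrow> bool" where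
  "unscrambles t \<longleftrightarrow> (\<exists>ws. fold center_turn ws t = (Some Red, Some Orange, Some Blue, Some Green, Some White, Some Yellow))"

text \<open>The facts g0 to g23 list the 24 rotated arrangements of the centers. Each is one turn
  away from an arrangement listed before it, so they form a tree rooted at the solved one.\<close>

lemma unscrambles_center_standard:
  fixes f :: "'l config"
  assumes "center_standard f"
  shows "unscrambles (center_colours f)"
proof -
  have step: "unscrambles t" if unscrambles: "unscrambles (center_turn i t)" for i t
  proof -
    obtain ws where "fold center_turn ws (center_turn i t) = (Some Red, Some Orange, Some Blue, Some Green, Some White, Some Yellow)"
      using unscrambles unfolding unscrambles_def by blast
    then show ?thesis unfolding unscrambles_def by (intro exI[of _ "i # ws"]) simp
  qed
  have g0: "unscrambles (Some Red, Some Orange, Some Blue, Some Green, Some White, Some Yellow)" unfolding unscrambles_def by (rule exI[of _ "[]"]) simp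
  have g1: "unscrambles (Some Blue, Some Green, Some Orange, Some Red, Some White, Some Yellow)" by (rule step[of AZ]) (simp add: g0)
  have g2: "unscrambles (Some Blue, Some Green, Some White, Some Yellow, Some Red, Some Orange)" by (rule step[of AX]) (simp add: g1)
  have g3: "unscrambles (Some Orange, Some Red, Some Green, Some Blue, Some White, Some Yellow)" by (rule step[of AZ]) (simp add: g1)
  have g4: "unscrambles (Some Orange, Some Red, Some White, Some Yellow, Some Blue, Some Green)" by (rule step[of AX]) (simp add: g3)
  have g5: "unscrambles (Some Red, Some Orange, Some White, Some Yellow, Some Green, Some Blue)" by (rule step[of AX]) (simp add: g0)
  have g6: "unscrambles (Some White, Some Yellow, Some Green, Some Blue, Some Red, Some Orange)" by (rule step[of AZ]) (simp add: g2)
  have g7: "unscrambles (Some White, Some Yellow, Some Orange, Some Red, Some Green, Some Blue)" by (rule step[of AZ]) (simp add: g5)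
  have g8: "unscrambles (Some White, Some Yellow, Some Red, Some Orange, Some Blue, Some Green)" by (rule step[of AX]) (simp add: g6)
  have g9: "unscrambles (Some Yellow, Some White, Some Blue, Some Green, Some Red, Some Orange)" by (rule step[of AY]) (simp add: g0)
  have g10: "unscrambles (Some Yellow, Some White, Some Green, Some Blue, Some Orange, Some Red)" by (rule step[of AY]) (simp add: g3)
  have g11: "unscrambles (Some Yellow, Some White, Some Orange, Some Red, Some Blue, Some Green)" by (rule step[of AX]) (simp add: g10)
  have g12: "unscrambles (Some Yellow, Some White, Some Red, Some Orange, Some Green, Some Blue)" by (rule step[of AX]) (simp add: g9)
  have g13: "unscrambles (Some Blue, Some Green, Some Red, Some Orange, Some Yellow, Some White)" by (rule step[of AX]) (simp add: g2)
  have g14: "unscrambles (Some Blue, Some Green, Some Yellow, Some White, Some Orange, Some Red)" by (rule step[of AX]) (simp add: g13)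
  have g15: "unscrambles (Some Green, Some Blue, Some Orange, Some Red, Some Yellow, Some White)" by (rule step[of AY]) (simp add: g11)
  have g16: "unscrambles (Some Green, Some Blue, Some Red, Some Orange, Some White, Some Yellow)" by (rule step[of AY]) (simp add: g8)
  have g17: "unscrambles (Some Green, Some Blue, Some White, Some Yellow, Some Orange, Some Red)" by (rule step[of AX]) (simp add: g16)
  have g18: "unscrambles (Some Green, Some Blue, Some Yellow, Some White, Some Red, Some Orange)" by (rule step[of AX]) (simp add: g15)
  have g19: "unscrambles (Some Orange, Some Red, Some Blue, Some Green, Some Yellow, Some White)" by (rule step[of AX]) (simp add: g4)
  have g20: "unscrambles (Some Orange, Some Red, Some Yellow, Some White, Some Green, Some Blue)" by (rule step[of AX]) (simp add: g19)
  have g21: "unscrambles (Some Red, Some Orange, Some Green, Some Blue, Some Yellow, Some White)" by (rule step[of AX]) (simp add: g5)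
  have g22: "unscrambles (Some Red, Some Orange, Some Yellow, Some White, Some Blue, Some Green)" by (rule step[of AX]) (simp add: g21)
  have g23: "unscrambles (Some White, Some Yellow, Some Blue, Some Green, Some Orange, Some Red)" by (rule step[of AX]) (simp add: g8)
  note goods = g0 g1 g2 g3 g4 g5 g6 g7 g8 g9 g10 g11 g12 g13 g14 g15 g16 g17 g18 g19 g20 g21 g22 g23
  obtain \<pi> \<epsilon> where r: "is_rotation \<pi> \<epsilon>"
    and f: "\<And>c. center_cell c \<Longrightarrow> f c = solved_pt (rot \<pi> \<epsilon> (Rep_cell c))"
    using assms unfolding center_standard_def by (elim exE conjE) simp
  have fA: "f (Abs_cell p) = solved_pt (rot \<pi> \<epsilon> p)" if "is_cell p" "center_cell (Abs_cell p)" for p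
    using f[OF that(2)] that(1) by (simp add: Abs_cell_inverse)
  have cv: "center_colours f = (let s = \<lambda>x :: 'l pt. solved_pt (rot \<pi> \<epsilon> x) in
     (s (PInf, Fin Zero, Fin Zero), s (MInf, Fin Zero, Fin Zero), s (Fin Zero, PInf, Fin Zero),
      s (Fin Zero, MInf, Fin Zero), s (Fin Zero, Fin Zero, PInf), s (Fin Zero, Fin Zero, MInf)))"
    unfolding center_colours_def Let_def
    by (simp add: fA center_cell_def is_cell_def Abs_cell_inverse)
  have sg: "sign \<pi> * ((if \<epsilon> 0 then - 1 else 1) * ((if \<epsilon> 1 then - 1 else 1) * (if \<epsilon> 2 then - 1 else 1))) = 1"
    and p: "\<pi> permutes {0, 1, 2}"
    using r unfolding is_rotation_def by simp_all
  have sc: "sign (Transposition.transpose a b \<circ> Transposition.transpose c d :: nat \<Rightarrow> nat) = 1" if "a \<noteq> b" "c \<noteq> d" for a b c d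
    using that by (simp add: sign_compose sign_swap_id permutation_swap_id)
  note simps = rot_def crd_def Let_def Transposition.transpose_def solved_pt_def
  from p show ?thesis
  \<comment> \<open>For each of the six permutations the determinant condition leaves four of the
    eight sign patterns.\<close>
  proof (cases rule: permutes_3_cases)
    case 1
    then have "(\<epsilon> 0 \<longleftrightarrow> \<epsilon> 1) \<longleftrightarrow> \<not> \<epsilon> 2" using sg by (simp add: sign_id split: if_splits)
    then show ?thesis unfolding cv 1
      by (cases "\<epsilon> 0"; cases "\<epsilon> 1"; cases "\<epsilon> 2") (simp_all add: simps goods)
  next
    case 2
    then have "(\<epsilon> 0 \<longleftrightarrow> \<epsilon> 1) \<longleftrightarrow> \<epsilon> 2" using sg by (simp add: sign_swap_id split: if_splits)
    then show ?thesis unfolding cv 2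
      by (cases "\<epsilon> 0"; cases "\<epsilon> 1"; cases "\<epsilon> 2") (simp_all add: simps goods)
  next
    case 3
    then have "(\<epsilon> 0 \<longleftrightarrow> \<epsilon> 1) \<longleftrightarrow> \<epsilon> 2" using sg by (simp add: sign_swap_id split: if_splits)
    then show ?thesis unfolding cv 3
      by (cases "\<epsilon> 0"; cases "\<epsilon> 1"; cases "\<epsilon> 2") (simp_all add: simps goods)
  next
    case 4
    then have "(\<epsilon> 0 \<longleftrightarrow> \<epsilon> 1) \<longleftrightarrow> \<epsilon> 2" using sg by (simp add: sign_swap_id split: if_splits)
    then show ?thesis unfolding cv 4
      by (cases "\<epsilon> 0"; cases "\<epsilon> 1"; cases "\<epsilon> 2") (simp_all add: simps goods)
  next
    case 5
    then have "(\<epsilon> 0 \<longleftrightarrow> \<epsilon> 1) \<longleftrightarrow> \<not> \<epsilon> 2" using sg by (simp add: sc split: if_splits)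
    then show ?thesis unfolding cv 5
      by (cases "\<epsilon> 0"; cases "\<epsilon> 1"; cases "\<epsilon> 2") (simp_all add: simps goods)
  next
    case 6
    then have "(\<epsilon> 0 \<longleftrightarrow> \<epsilon> 1) \<longleftrightarrow> \<not> \<epsilon> 2" using sg by (simp add: sc split: if_splits)
    then show ?thesis unfolding cv 6
      by (cases "\<epsilon> 0"; cases "\<epsilon> 1"; cases "\<epsilon> 2") (simp_all add: simps goods)
  qed
qed

lemma center_turn_inverse: "\<exists>ws'. fold center_turn ws' (fold center_turn ws t) = t"
proof (induction ws arbitrary: t)
  case Nil
  show ?case by (rule exI[of _ "[]"]) simp
next
  case (Cons i ws)
  obtain ws' where ws': "fold center_turn ws' (fold center_turn ws (center_turn i t)) = center_turn i t" using Cons by blast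
  have "fold center_turn [i, i, i] (center_turn i t) = t" by (cases "(i, t)" rule: center_turn.cases) auto
  then show ?case using ws' by (intro exI[of _ "ws' @ [i, i, i]"]) simp
qed

text \<open>The way leads through the solved arrangement: unscramble f, then undo the unscrambling
  of g.\<close>

lemma center_reach:
  fixes f g :: "'l config"
  assumes "center_standard f" "center_standard g"
  shows "\<exists>ws. \<forall>c. center_cell c \<longrightarrow> fold (\<lambda>i. act (qt i (Fin Zero))) ws f c = g c"
proof -
  obtain w1 where w1: "fold center_turn w1 (center_colours f) = (Some Red, Some Orange, Some Blue, Some Green, Some White, Some Yellow)"
    using unscrambles_center_standard[OF assms(1)] unfolding unscrambles_def by blast
  obtain w2 where w2: "fold center_turn w2 (center_colours g) = (Some Red, Some Orange, Some Blue, Some Green, Some White, Some Yellow)"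
    using unscrambles_center_standard[OF assms(2)] unfolding unscrambles_def by blast
  obtain w3 where w3: "fold center_turn w3 (fold center_turn w2 (center_colours g)) = center_colours g" using center_turn_inverse by blast
  have cv: "center_colours (fold (\<lambda>i. act (qt i (Fin Zero))) ws h) = fold center_turn ws (center_colours h)" for ws and h :: "'l config"
    by (induction ws arbitrary: h) (simp_all add: center_colours_act)
  have "center_colours (fold (\<lambda>i. act (qt i (Fin Zero))) (w1 @ w3) f) = center_colours g"
    unfolding cv using w1 w2 w3 by simp
  then show ?thesis using center_colours_eqD by blast
qed

section \<open>Segments of length omega\<close>

text \<open>On D the colours must not change even temporarily. Equality of the two ends would not
  do, since a limit of infinitely many segments needs cells that are constant from some point
  on.\<close>

definition omega_segment :: "'l cell set \<Rightarrow> 'l config \<Rightarrow> 'l config \<Rightarrow> bool" where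
  "omega_segment D f f' \<longleftrightarrow> (\<exists>\<sigma> F. (\<forall>k::nat. \<sigma> k \<in> basic_twists) \<and> F 0 = f \<and> (\<forall>k. F (Suc k) = act (\<sigma> k) (F k)) \<and>
     (\<forall>c. \<exists>K. \<forall>k\<ge>K. F k c = f' c) \<and> (\<forall>c\<in>D. \<forall>k. F k c = f c))"

lemma wsegI:
  assumes "\<And>k::nat. \<sigma> k \<in> basic_twists" "F 0 = f" "\<And>k. F (Suc k) = act (\<sigma> k) (F k)"
    "\<And>c. \<exists>K. \<forall>k\<ge>K. F k c = f' c" "\<And>c k. c \<in> D \<Longrightarrow> F k c = f c"
  shows "omega_segment D f f'"
  unfolding omega_segment_def using assms by blast

lemma omega_segment_const:
  assumes "omega_segment D f f'" "c \<in> D"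
  shows "f' c = f c"
proof -
  obtain F :: "nat \<Rightarrow> 'a config" where F: "\<forall>c. \<exists>K. \<forall>k\<ge>K. F k c = f' c" "\<forall>c\<in>D. \<forall>k. F k c = f c"
    using assms(1) unfolding omega_segment_def by blast
  obtain K where "\<forall>k\<ge>K. F k c = f' c" using F(1) by blast
  then show ?thesis using F(2) assms(2) by auto
qed

text \<open>Because 1 + omega = omega, a twist put in front does not lengthen a segment.\<close>

lemma omega_segment_prepend:
  assumes T: "T \<in> basic_twists" and D: "\<And>c. c \<in> D \<Longrightarrow> act T f c = f c" and w: "omega_segment D (act T f) f'"
  shows "omega_segment D f f'"
proof -
  obtain \<sigma> F where F: "\<And>k::nat. \<sigma> k \<in> basic_twists" "F 0 = act T f" "\<And>k. F (Suc k) = act (\<sigma> k) (F k)"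
     "\<And>c. \<exists>K. \<forall>k\<ge>K. F k c = f' c" "\<And>c k. c \<in> D \<Longrightarrow> F k c = act T f c"
    using w unfolding omega_segment_def by blast
  show ?thesis
  proof (rule wsegI[of "case_nat T \<sigma>" "case_nat f F"])
    show "case_nat T \<sigma> k \<in> basic_twists" for k using T F(1) by (cases k) auto
    show "case_nat f F (Suc k) = act (case_nat T \<sigma> k) (case_nat f F k)" for k
      using F(2,3) by (cases k) auto
    show "\<exists>K. \<forall>k\<ge>K. case_nat f F k c = f' c" for c
    proof -
      obtain K where K: "\<forall>k\<ge>K. F k c = f' c" using F(4) by blast
      have "case_nat f F k c = f' c" if "k \<ge> Suc K" for k using that K by (cases k) auto
      then show ?thesis by blast
    qed
    show "case_nat f F k c = f c" if "c \<in> D" for c k using F(5)[OF that] D[OF that] by (cases k) auto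
  qed simp
qed

lemma eventually_eq_finite:
  fixes F :: "nat \<Rightarrow> 'c \<Rightarrow> 'v"
  assumes "finite K" "\<And>c. \<exists>N. \<forall>k\<ge>N. F k c = f c"
  shows "\<exists>N. \<forall>c\<in>K. F N c = f c"
proof -
  obtain N where N: "\<And>c k. k \<ge> N c \<Longrightarrow> F k c = f c" using assms(2) by metis
  have "F (Max (insert 0 (N ` K))) c = f c" if "c \<in> K" for c
    by (rule N) (use assms(1) that in \<open>auto intro: Max_ge\<close>)
  then show ?thesis by blast
qed

text \<open>On a finite set the limit equals some configuration reached after finitely many twists,
  so local invariants pass to it.\<close>

lemma omega_segment_standard:
  assumes w: "omega_segment D f f'" and f: "standard f"
  shows "standard f'"
proof -
  obtain \<sigma> F where F: "\<And>k::nat. \<sigma> k \<in> basic_twists" "F 0 = f" "\<And>k. F (Suc k) = act (\<sigma> k) (F k)"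
     "\<And>c. \<exists>K. \<forall>k\<ge>K. F k c = f' c"
    using w unfolding omega_segment_def by blast
  have inv: "\<Psi> f' = \<Psi> f" if inv: "local_invariant K \<Psi>" for K \<Psi>
  proof -
    have "\<Psi> (F k) = \<Psi> f" for k
      using inv F(1-3) by (induction k) (auto simp: local_invariant_def)
    moreover obtain N where "\<forall>c\<in>K. F N c = f' c"
      using eventually_eq_finite[of K F f'] inv F(4) unfolding local_invariant_def by blast
    then have "\<Psi> (F N) = \<Psi> f'" using inv unfolding local_invariant_def by blast
    ultimately show ?thesis by simp
  qed
  have "F k c \<noteq> None" for k c
    using F(2,3) f by (induction k arbitrary: c) (auto simp: standard_def legal_def act_def)
  then have "legal f'" unfolding legal_def using F(4) by (metis order_refl)
  moreover have "card {d \<in> cluster c. f' d = Some col} = 4 \<longleftrightarrow> card {d \<in> cluster c. f d = Some col} = 4" for c col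
    by (rule inv[OF local_invariant_card])
  moreover have "center_standard f' = center_standard f" by (rule inv[OF local_invariant_center])
  ultimately show ?thesis using f unfolding standard_alt by simp
qed

section \<open>One stage: segments that leave the solved inner layers unchanged\<close>

definition slice :: "('l \<Rightarrow> nat) \<Rightarrow> nat \<Rightarrow> ('l cell \<Rightarrow> 'l cell) \<Rightarrow> bool" where
  "slice e n T \<longleftrightarrow> (\<exists>i \<alpha>. \<not> is_inf \<alpha> \<and> idx e \<alpha> = n \<and> (T = qt i \<alpha> \<or> T = iqt i \<alpha>))"

lemma sliceI: "\<not> is_inf \<alpha> \<Longrightarrow> idx e \<alpha> = n \<Longrightarrow> slice e n (qt i \<alpha>)" "\<not> is_inf \<alpha> \<Longrightarrow> idx e \<alpha> = n \<Longrightarrow> slice e n (iqt i \<alpha>)"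
  unfolding slice_def by blast+

lemma slice_basic: "slice e n T \<Longrightarrow> T \<in> basic_twists"
  unfolding slice_def by auto

lemma slice_inv: "slice e n T \<Longrightarrow> index_set e (inv T c) = index_set e c"
  unfolding slice_def by auto

lemma slice_trivial: "slice e n T \<Longrightarrow> n \<notin> index_set e c \<Longrightarrow> act T f c = f c"
  unfolding slice_def act_def using qt_trivial iqt_trivial by fastforce

locale stage =
  fixes e :: "'l \<Rightarrow> nat" and g :: "'l config" and m :: nat
  assumes e: "bij e" and g_std: "standard g" and g_face: "\<And>T. T \<in> face_twists \<Longrightarrow> act T g = g"
begin

abbreviation "lo_i \<equiv> lo_index e"
abbreviation "hi_i \<equiv> hi_index e"

definition layer_coord :: "nat \<Rightarrow> 'l ext" where
  "layer_coord n = (if n = 0 then Fin Zero else Fin (Pos (inv e (n - 1))))"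

lemma layer_coord: "\<not> is_inf (layer_coord n)" "idx e (layer_coord n) = n"
  using e by (auto simp: layer_coord_def bij_is_surj surj_f_inv_f)

definition seg :: "'l config \<Rightarrow> 'l config \<Rightarrow> bool" where
  "seg = omega_segment {c. hi_i c < m}"

definition agrees :: "'l config \<Rightarrow> bool" where
  "agrees h \<longleftrightarrow> (\<forall>c. hi_i c < m \<longrightarrow> h c = g c)"

lemma not_in_index_set: "n > hi_i c \<Longrightarrow> n \<notin> index_set e c"
  using index_set_lo_index_hi_index[of e c] lo_index_le_hi_index[of e c] by auto

lemma seg_refl: "seg f f"
  unfolding seg_def
  \<comment> \<open>Twist one layer after another, undoing each twist at once.\<close>
proof (rule wsegI)
  let ?n = "\<lambda>k::nat. m + k div 2"
  let ?F = "\<lambda>k. if even k then f else act (qt AX (layer_coord (?n k))) f"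
  let ?\<sigma> = "\<lambda>k. if even k then qt AX (layer_coord (?n k)) else iqt AX (layer_coord (?n k))"
  show "?\<sigma> k \<in> basic_twists" for k by simp
  show "?F 0 = f" by simp
  show "?F (Suc k) = act (?\<sigma> k) (?F k)" for k by auto
  have triv: "?F k c = f c" if "?n k > hi_i c" for k c
    using slice_trivial[OF sliceI(1)[OF layer_coord] not_in_index_set[OF that]] by auto
  show "\<exists>K. \<forall>k\<ge>K. ?F k c = f c" for c
  proof (intro exI allI impI)
    fix k assume "k \<ge> 2 * Suc (hi_i c)"
    then have "2 * Suc (hi_i c) div 2 \<le> k div 2" by (rule div_le_mono)
    then show "?F k c = f c" by (intro triv) simp
  qed
  show "?F k c = f c" if "c \<in> {c. hi_i c < m}" for c k using that by (intro triv) auto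
qed

text \<open>The twist is followed by an idle segment. This padding is harmless for the total length:
  omega many stages of finitely many segments still amount to omega^2.\<close>

lemma seg_act:
  assumes "T \<in> basic_twists" "\<And>c. hi_i c < m \<Longrightarrow> act T f c = f c"
  shows "seg f (act T f)"
  using omega_segment_prepend[OF assms(1), of "{c. hi_i c < m}" f] assms(2) seg_refl unfolding seg_def by blast

lemma seg_slice: "slice e n T \<Longrightarrow> n \<ge> m \<Longrightarrow> seg f (act T f)"
  by (rule seg_act) (auto intro: slice_basic slice_trivial dest: not_in_index_set[OF order.strict_trans2])

lemma seg_agrees: "seg f f' \<Longrightarrow> agrees f \<Longrightarrow> agrees f'"
  unfolding seg_def agrees_def using omega_segment_const by fastforce

lemma seg_standard: "seg f f' \<Longrightarrow> standard f \<Longrightarrow> standard f'"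
  unfolding seg_def by (rule omega_segment_standard)

lemma rtranclp_seg_agrees: "seg\<^sup>*\<^sup>* f f' \<Longrightarrow> agrees f \<Longrightarrow> agrees f'"
  by (induction rule: rtranclp_induct) (auto intro: seg_agrees)

lemma rtranclp_seg_standard: "seg\<^sup>*\<^sup>* f f' \<Longrightarrow> standard f \<Longrightarrow> standard f'"
  by (induction rule: rtranclp_induct) (auto intro: seg_standard)

lemma g_face_qt: "is_inf \<gamma> \<Longrightarrow> g (qt k \<gamma> c) = g c"
proof -
  assume "is_inf \<gamma>"
  then have "qt k \<gamma> \<in> face_twists" unfolding face_twists_def is_inf_cases by blast
  then have "act (qt k \<gamma>) g (qt k \<gamma> c) = g (qt k \<gamma> c)" by (simp add: g_face)
  then show ?thesis by (simp add: act_def)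
qed

text \<open>Here the face-invariance of g enters. A face twist does move cells with both layers
  below m, but f agrees with g there, so their colours stay as they are.\<close>

lemma seg_face:
  assumes "is_inf \<gamma>" "agrees f"
  shows "seg f (act (qt k \<gamma>) f)" "seg f (act (iqt k \<gamma>) f)"
proof -
  have "act (qt k \<gamma>) f c = f c" "act (iqt k \<gamma>) f c = f c" if "hi_i c < m" for c
  proof -
    have "g (iqt k \<gamma> c) = g c" using g_face_qt[OF assms(1), of k "iqt k \<gamma> c"] by simp
    then show "act (qt k \<gamma>) f c = f c" "act (iqt k \<gamma>) f c = f c"
      using assms(2) that g_face_qt[OF assms(1), of k c] unfolding agrees_def act_def by auto
  qed
  then show "seg f (act (qt k \<gamma>) f)" "seg f (act (iqt k \<gamma>) f)" by (auto intro!: seg_act)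
qed

text \<open>The twists for the layers m + 1, m + 2, ... are applied in this order. A cell with
  smaller layer at most m meets at most one of them, the one for its larger layer. A cell with both
  layers above m may meet two, so nothing is claimed about it beyond convergence.\<close>

lemma xseg:
  assumes B: "\<And>n. n > m \<Longrightarrow> slice e n (B n)"
  shows "\<exists>f'. seg f f' \<and> (\<forall>c. lo_i c \<le> m \<longrightarrow> f' c = (if hi_i c > m then act (B (hi_i c)) f c else f c))"
proof -
  define F where "F = rec_nat f (\<lambda>k. act (B (Suc (m + k))))"
  have F0: "F 0 = f" and FS: "\<And>k. F (Suc k) = act (B (Suc (m + k))) (F k)" by (simp_all add: F_def)
  have sl: "slice e (Suc (m + k)) (B (Suc (m + k)))" for k by (rule B) simp
  have late: "F (Suc k) c = F k c" if "Suc (m + k) > hi_i c" for k c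
    unfolding FS using slice_trivial[OF sl] not_in_index_set[OF that] by blast
  have late': "F k c = F (Suc (hi_i c)) c" if "k \<ge> Suc (hi_i c)" for k c
    using that by (induction rule: dec_induct) (auto simp: late)
  have val: "F k c = (if m < hi_i c \<and> hi_i c \<le> m + k then act (B (hi_i c)) f c else f c)" if "lo_i c \<le> m" for k c
    using that
  proof (induction k arbitrary: c)
    case 0
    show ?case by (auto simp: F0)
  next
    case (Suc k)
    show ?case
    proof (cases "hi_i c = Suc (m + k)")
      case True
      let ?d = "inv (B (Suc (m + k))) c"
      have d: "lo_i ?d = lo_i c" "hi_i ?d = hi_i c" using lo_index_hi_index_eq[OF slice_inv[OF sl]] by auto
      have "F (Suc k) c = F k ?d" unfolding FS by (simp add: act_def)
      also have "\<dots> = f ?d" using Suc.IH[of ?d] Suc.prems d True by simp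
      finally show ?thesis using True by (simp add: act_def)
    next
      case False
      then have "Suc (m + k) \<notin> index_set e c" using index_set_lo_index_hi_index[of e c] Suc.prems by auto
      then have "F (Suc k) c = F k c" unfolding FS using slice_trivial[OF sl] by blast
      then show ?thesis using Suc.IH[OF Suc.prems] False by auto
    qed
  qed
  define f' where "f' c = F (Suc (hi_i c)) c" for c
  have "seg f f'" unfolding seg_def
  proof (rule wsegI[of "\<lambda>k. B (Suc (m + k))" F])
    show "\<exists>K. \<forall>k\<ge>K. F k c = f' c" for c unfolding f'_def using late' by blast
    show "F k c = f c" if "c \<in> {c. hi_i c < m}" for c k
      using that val[of c k] lo_index_le_hi_index[of e c] by simp
  qed (use F0 FS slice_basic[OF sl] in auto)
  moreover have "f' c = (if hi_i c > m then act (B (hi_i c)) f c else f c)" if "lo_i c \<le> m" for c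
    unfolding f'_def using val[OF that] by simp
  ultimately show ?thesis by blast
qed

text \<open>\<open>w n\<close> is the configuration that would result if the n-th twist were the
  only one carried out in each infinite segment. Cells with larger layer n cannot tell the
  difference, so each n experiences a finite word of twists.\<close>

definition tracks :: "'l config \<Rightarrow> (nat \<Rightarrow> 'l config) \<Rightarrow> bool" where
  "tracks h w \<longleftrightarrow> (\<forall>c. lo_i c \<le> m \<longrightarrow> h c = w (hi_i c) c)"

lemma tracks_qt: "tracks h w \<Longrightarrow> tracks (act (qt i \<alpha>) h) (\<lambda>n. act (qt i \<alpha>) (w n))"
  and tracks_iqt: "tracks h w \<Longrightarrow> tracks (act (iqt i \<alpha>) h) (\<lambda>n. act (iqt i \<alpha>) (w n))"
  unfolding tracks_def act_def by simp_all

lemma tracks_xseg: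
  assumes "tracks h w" "\<And>n. n > m \<Longrightarrow> slice e n (B n)"
  shows "\<exists>h'. seg h h' \<and> tracks h' (\<lambda>n. if n > m then act (B n) (w n) else w n)"
proof -
  obtain h' where h': "seg h h'" "\<forall>c. lo_i c \<le> m \<longrightarrow> h' c = (if hi_i c > m then act (B (hi_i c)) h c else h c)"
    using xseg[OF assms(2)] by blast
  have "tracks h' (\<lambda>n. if n > m then act (B n) (w n) else w n)"
    unfolding tracks_def
  proof (intro allI impI)
    fix c assume c: "lo_i c \<le> m"
    show "h' c = (if hi_i c > m then act (B (hi_i c)) (w (hi_i c)) else w (hi_i c)) c"
    proof (cases "hi_i c > m")
      case True
      let ?d = "inv (B (hi_i c)) c"
      have d: "lo_i ?d = lo_i c" "hi_i ?d = hi_i c" using lo_index_hi_index_eq[OF slice_inv[OF assms(2)[OF True]]] by auto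
      have "act (B (hi_i c)) h c = h ?d" by (simp add: act_def)
      also have "\<dots> = w (hi_i c) ?d" using assms(1) c d unfolding tracks_def by auto
      finally show ?thesis using h'(2) c True by (simp add: act_def)
    next
      case False
      then show ?thesis using h'(2) c assms(1) unfolding tracks_def by simp
    qed
  qed
  with h'(1) show ?thesis by blast
qed

text \<open>The commutator word is run through once, with one infinite segment in place of each
  occurrence of B or its inverse; the axis and the coordinate of B may depend on n.\<close>

lemma commutator_pattern:
  fixes i k :: axis and j :: "nat \<Rightarrow> axis"
  assumes f: "agrees f" and \<alpha>: "\<not> is_inf \<alpha>" "idx e \<alpha> = m" and \<gamma>: "is_inf \<gamma>"
    and \<beta>: "\<And>n. n > m \<Longrightarrow> \<not> is_inf (\<beta> n)" "\<And>n. n > m \<Longrightarrow> idx e (\<beta> n) = n"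
  defines "A \<equiv> act (qt i \<alpha>)" and "A' \<equiv> act (iqt i \<alpha>)"
    and "F \<equiv> act (qt k \<gamma>)" and "F' \<equiv> act (iqt k \<gamma>)"
    and "B \<equiv> \<lambda>n. act (qt (j n) (\<beta> n))" and "B' \<equiv> \<lambda>n. act (iqt (j n) (\<beta> n))"
  shows "\<exists>f'. seg\<^sup>*\<^sup>* f f' \<and> (\<forall>c. lo_i c \<le> m \<longrightarrow> f' c =
    (if hi_i c > m then A (B (hi_i c) (A' (B' (hi_i c) (F (B (hi_i c) (A (B' (hi_i c) (A' (F' f))))))))) c else f c))"
proof -
  have WA: "seg h (A h)" "seg h (A' h)" for h
    unfolding A_def A'_def by (rule seg_slice[of m]; simp add: sliceI \<alpha>)+
  have WF: "seg h (F h)" "seg h (F' h)" if "agrees h" for h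
    unfolding F_def F'_def by (rule seg_face[OF \<gamma> that])+
  note ts = tracks_qt[of _ _ i \<alpha>, folded A_def] tracks_iqt[of _ _ i \<alpha>, folded A'_def]
    tracks_qt[of _ _ k \<gamma>, folded F_def] tracks_iqt[of _ _ k \<gamma>, folded F'_def]
  \<comment> \<open>The infinite segments start at layer m + 1, so for n at most m the word lacks
    every B.\<close>
  define X where "X n h = (if n > m then B n h else h)" for n h
  define X' where "X' n h = (if n > m then B' n h else h)" for n h
  have tX: "\<exists>h'. seg h h' \<and> tracks h' (\<lambda>n. X n (w n))" if "tracks h w" for h w
    using tracks_xseg[OF that, of "\<lambda>n. qt (j n) (\<beta> n)"] \<beta> unfolding X_def B_def by (auto simp: sliceI)
  have tX': "\<exists>h'. seg h h' \<and> tracks h' (\<lambda>n. X' n (w n))" if "tracks h w" for h w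
    using tracks_xseg[OF that, of "\<lambda>n. iqt (j n) (\<beta> n)"] \<beta> unfolding X'_def B'_def by (auto simp: sliceI)
  have t0: "tracks (A' (F' f)) (\<lambda>n. A' (F' f))" by (simp add: tracks_def)
  obtain h1 where h1: "seg (A' (F' f)) h1" "tracks h1 (\<lambda>n. X' n (A' (F' f)))" using tX'[OF t0] by blast
  obtain h2 where h2: "seg (A h1) h2" "tracks h2 (\<lambda>n. X n (A (X' n (A' (F' f)))))"
    using tX[OF ts(1)[OF h1(2)]] by blast
  obtain h3 where h3: "seg (F h2) h3" "tracks h3 (\<lambda>n. X' n (F (X n (A (X' n (A' (F' f)))))))"
    using tX'[OF ts(3)[OF h2(2)]] by blast
  obtain h4 where h4: "seg (A' h3) h4" "tracks h4 (\<lambda>n. X n (A' (X' n (F (X n (A (X' n (A' (F' f)))))))))"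
    using tX[OF ts(2)[OF h3(2)]] by blast
  have t5: "tracks (A h4) (\<lambda>n. A (X n (A' (X' n (F (X n (A (X' n (A' (F' f))))))))))"
    by (rule ts(1)[OF h4(2)])
  have W2: "seg\<^sup>*\<^sup>* f h2"
    using WF(2)[OF f] WA(2)[of "F' f"] h1(1) WA(1)[of h1] h2(1)
    by (meson converse_rtranclp_into_rtranclp rtranclp.rtrancl_refl)
  \<comment> \<open>The second face twist is again a legitimate segment only if the inner layers
    still show the colours of g.\<close>
  have "agrees h2" using rtranclp_seg_agrees[OF W2 f] .
  then have "seg\<^sup>*\<^sup>* h2 (A h4)"
    using WF(1) h3(1) WA(2)[of h3] h4(1) WA(1)[of h4]
    by (meson converse_rtranclp_into_rtranclp rtranclp.rtrancl_refl)
  with W2 have "seg\<^sup>*\<^sup>* f (A h4)" by (rule rtranclp_trans)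
  moreover have "A h4 c =
    (if hi_i c > m then A (B (hi_i c) (A' (B' (hi_i c) (F (B (hi_i c) (A (B' (hi_i c) (A' (F' f))))))))) c else f c)"
    if "lo_i c \<le> m" for c
  proof (cases "hi_i c > m")
    case True
    then show ?thesis using t5 that unfolding tracks_def X_def X'_def by simp
  next
    case False
    \<comment> \<open>Without the B's the word cancels completely.\<close>
    have "A (A' h) = h" "F (F' h) = h" for h unfolding A_def A'_def F_def F'_def by simp_all
    then show ?thesis using False t5 that unfolding tracks_def X_def X'_def by simp
  qed
  ultimately show ?thesis by blast
qed

end

section \<open>Simultaneous moves in infinitely many clusters\<close>

lemma act3_cong: "h a = f a \<Longrightarrow> h b = f b \<Longrightarrow> h c = f c \<Longrightarrow> h x = f x \<Longrightarrow> act3 a b c h x = act3 a b c f x"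
  by (simp add: act3_def)

context stage
begin

definition layer_cells :: "nat \<Rightarrow> 'l cell set" where
  "layer_cells n = {c. lo_i c = m \<and> hi_i c = n}"

lemma layer_cells_qt [simp]: "qt i \<alpha> c \<in> layer_cells n \<longleftrightarrow> c \<in> layer_cells n"
  by (simp add: layer_cells_def)

text \<open>A triple (p, i, k) names a 3-cycle by its cell p, the axis i of the slice twist A and
  the axis k of the face of p. \<open>valid n\<close> says that the 3-cycle belongs to the layers m
  and n.\<close>

definition move :: "'l cell \<times> axis \<times> axis \<Rightarrow> 'l config \<Rightarrow> 'l config" where
  "move = (\<lambda>(p, i, k). act3 p (qt i (cc i p) p) (qt k (cc k p) p))"

definition valid :: "nat \<Rightarrow> 'l cell \<times> axis \<times> axis \<Rightarrow> bool" where
  "valid n = (\<lambda>(p, i, k). p \<in> layer_cells n \<and> i \<noteq> k \<and> is_inf (cc k p) \<and> idx e (cc i p) = m)"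

lemma move_cong:
  assumes "valid n t" "\<And>c. c \<in> layer_cells n \<Longrightarrow> h c = f c" "c \<in> layer_cells n"
  shows "move t h c = move t f c"
proof -
  obtain p i k where t: "t = (p, i, k)" by (cases t)
  have "p \<in> layer_cells n" using assms(1) by (simp add: t valid_def)
  then show ?thesis unfolding t move_def prod.case by (intro act3_cong assms(2)) (simp_all add: assms(3))
qed

lemma move_outside:
  assumes "valid n t" "c \<notin> layer_cells n"
  shows "move t f c = f c"
proof -
  obtain p i k where t: "t = (p, i, k)" by (cases t)
  have p: "p \<in> layer_cells n" using assms(1) by (simp add: t valid_def)
  have "c \<noteq> p" "c \<noteq> qt j \<alpha> p" for j \<alpha> using p assms(2) layer_cells_qt by blast+
  then show ?thesis by (simp add: t move_def act3_def)
qed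

text \<open>The data of a move that must be the same for all \<open>n\<close> treated simultaneously.\<close>

definition kind :: "'l cell \<times> axis \<times> axis \<Rightarrow> axis \<times> 'l ext \<times> axis \<times> 'l ext" where
  "kind = (\<lambda>(p, i, k). (i, cc i p, k, cc k p))"

text \<open>Equal kinds mean equal twists A and F, so one run of the commutator pattern performs all
  these moves; the cell p chosen for n fixes B as its slice about the third axis.\<close>

lemma one_kind:
  assumes f: "agrees f" and q: "\<And>n t. n > m \<Longrightarrow> q n = Some t \<Longrightarrow> valid n t \<and> kind t = \<kappa>"
  shows "\<exists>f'. seg\<^sup>*\<^sup>* f f' \<and> (\<forall>c. lo_i c \<le> m \<longrightarrow> f' c =
    (if hi_i c > m then (case q (hi_i c) of None \<Rightarrow> f c | Some t \<Rightarrow> move t f c) else f c))"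
proof (cases "\<exists>n>m. q n \<noteq> None")
  case False
  then show ?thesis by (intro exI[of _ f]) (auto split: option.split)
next
  case True
  obtain i \<alpha> k \<gamma> where \<kappa>: "\<kappa> = (i, \<alpha>, k, \<gamma>)" by (cases \<kappa>)
  from True obtain n0 t0 where t0: "valid n0 t0" "kind t0 = \<kappa>" using q by blast
  then have ik: "i \<noteq> k" "is_inf \<gamma>" "idx e \<alpha> = m" "\<not> is_inf \<alpha>"
    using cell_not_inf by (auto simp: valid_def kind_def \<kappa>)
  obtain j where j: "i \<noteq> j" "j \<noteq> k" using third_axis[OF ik(1)] .
  have qS: "\<exists>p. t = (p, i, k) \<and> p \<in> layer_cells n \<and> cc i p = \<alpha> \<and> cc k p = \<gamma> \<and> \<not> is_inf (cc j p) \<and> idx e (cc j p) = n \<and> \<not> center_cell p"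
    if n: "n > m" "q n = Some t" for n t
  proof -
    obtain p where p: "t = (p, i, k)" "p \<in> layer_cells n" "cc i p = \<alpha>" "cc k p = \<gamma>"
      using q[OF n] by (auto simp: valid_def kind_def \<kappa>)
    have inf: "is_inf (cc k p)" using p ik by simp
    have "{m, n} = {idx e (cc i p), idx e (cc j p)}"
      using index_set_face[OF j ik(1) inf, of e] index_set_lo_index_hi_index[of e p] p(2) by (simp add: layer_cells_def)
    then have "{m, n} = {m, idx e (cc j p)}" by (simp only: p(3) ik(3))
    then have "idx e (cc j p) = n" using n(1) by (simp add: doubleton_eq_iff)
    moreover have "\<not> is_inf (cc j p)" by (rule cell_not_inf[OF inf j(2)])
    moreover have "\<not> center_cell p" using center_cell_iff_hi_index[of p e] p(2) n(1) by (simp add: layer_cells_def)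
    ultimately show ?thesis using p by blast
  qed
  \<comment> \<open>If no move is wanted for \<open>n\<close>, use a twist about the axis of \<open>A\<close>: it commutes with \<open>A\<close>.\<close>
  define jj where "jj n = (if q n = None then i else j)" for n
  define \<beta> where "\<beta> n = (case q n of None \<Rightarrow> layer_coord n | Some t \<Rightarrow> cc j (fst t))" for n
  have \<beta>: "\<not> is_inf (\<beta> n)" "idx e (\<beta> n) = n" if "n > m" for n
    using qS[OF that] layer_coord[of n] unfolding \<beta>_def by (auto split: option.split)
  obtain f' where f': "seg\<^sup>*\<^sup>* f f'" and val: "\<And>c. lo_i c \<le> m \<Longrightarrow> f' c = (if hi_i c > m then 
      act (qt i \<alpha>) (act (qt (jj (hi_i c)) (\<beta> (hi_i c))) (act (iqt i \<alpha>) (act (iqt (jj (hi_i c)) (\<beta> (hi_i c)))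
       (act (qt k \<gamma>) (act (qt (jj (hi_i c)) (\<beta> (hi_i c))) (act (qt i \<alpha>) (act (iqt (jj (hi_i c)) (\<beta> (hi_i c)))
        (act (iqt i \<alpha>) (act (iqt k \<gamma>) f))))))))) c else f c)"
    using commutator_pattern[where \<beta> = \<beta> and i = i and k = k and j = jj, OF f ik(4,3,2) \<beta>] by blast
  have "f' c = (if hi_i c > m then (case q (hi_i c) of None \<Rightarrow> f c | Some t \<Rightarrow> move t f c) else f c)"
    if c: "lo_i c \<le> m" for c
  proof (cases "hi_i c > m")
    case False
    then show ?thesis using val[OF c] by simp
  next
    case hm: True
    show ?thesis
    proof (cases "q (hi_i c)")
      case None
      then show ?thesis using val[OF c] hm commutator_same_axis[of i \<alpha> "\<beta> (hi_i c)" k \<gamma> f] by (simp add: jj_def)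
    next
      case (Some t)
      obtain p where p: "t = (p, i, k)" "cc i p = \<alpha>" "cc k p = \<gamma>" "\<not> center_cell p"
        using qS[OF hm Some] by blast
      have "\<beta> (hi_i c) = cc j p" "jj (hi_i c) = j" using Some p(1) by (simp_all add: \<beta>_def jj_def)
      moreover have "is_inf (cc k p)" using p ik by simp
      ultimately have "f' c = act3 p (qt i \<alpha> p) (qt k \<gamma> p) f c"
        using val[OF c] hm commutator_twists[OF j(1) j(2) ik(1) _ p(4), of f] p(2,3) by simp
      then show ?thesis using hm Some p(1-3) by (simp add: move_def)
    qed
  qed
  with f' show ?thesis by blast
qed

text \<open>The same three-element superset serves n = 0 and n > 0, which is where the 3 comes
  from.\<close>

lemma finite_idx: "finite {\<alpha> :: 'l ext. \<not> is_inf \<alpha> \<and> idx e \<alpha> = n}"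
  and card_idx: "card {\<alpha> :: 'l ext. \<not> is_inf \<alpha> \<and> idx e \<alpha> = n} \<le> 3"
proof -
  let ?S = "{Fin Zero, Fin (Pos (inv e (n - 1))), Fin (Neg (inv e (n - 1)))}"
  have sub: "{\<alpha>. \<not> is_inf \<alpha> \<and> idx e \<alpha> = n} \<subseteq> ?S"
  proof
    fix \<alpha> assume "\<alpha> \<in> {\<alpha>. \<not> is_inf \<alpha> \<and> idx e \<alpha> = n}"
    then show "\<alpha> \<in> ?S" using inv_f_f[OF bij_is_inj[OF e]]
      by (cases "(e, \<alpha>)" rule: idx.cases) auto
  qed
  show "finite {\<alpha> :: 'l ext. \<not> is_inf \<alpha> \<and> idx e \<alpha> = n}" by (rule finite_subset[OF sub]) simp
  have "card {\<alpha>. \<not> is_inf \<alpha> \<and> idx e \<alpha> = n} \<le> card ?S" by (rule card_mono[OF _ sub]) simp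
  then show "card {\<alpha> :: 'l ext. \<not> is_inf \<alpha> \<and> idx e \<alpha> = n} \<le> 3" by simp
qed

lemma finite_axis: "finite (UNIV :: axis set)"
proof -
  have "(UNIV :: axis set) = {AX, AY, AZ}" using axis.exhaust by blast
  moreover have "finite {AX, AY, AZ}" by simp
  ultimately show ?thesis by simp
qed

text \<open>There are only finitely many kinds: two axes, a coordinate of layer m and a face.
  Running through them one after another gives each n its move exactly once.\<close>

lemma one_round:
  assumes f: "agrees f" and q: "\<And>n t. n > m \<Longrightarrow> q n = Some t \<Longrightarrow> valid n t"
  shows "\<exists>f'. seg\<^sup>*\<^sup>* f f' \<and> (\<forall>c. lo_i c \<le> m \<longrightarrow> f' c =
    (if hi_i c > m then (case q (hi_i c) of None \<Rightarrow> f c | Some t \<Rightarrow> move t f c) else f c))"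
proof -
  define Ks where "Ks = (UNIV :: axis set) \<times> {\<alpha> :: 'l ext. \<not> is_inf \<alpha> \<and> idx e \<alpha> = m} \<times> (UNIV :: axis set) \<times> {PInf, MInf :: 'l ext}"
  have "finite Ks" unfolding Ks_def using finite_axis finite_idx by simp
  then have "\<exists>f'. seg\<^sup>*\<^sup>* f f' \<and> (\<forall>c. lo_i c \<le> m \<longrightarrow> f' c =
    (if hi_i c > m then (case q (hi_i c) of None \<Rightarrow> f c | Some t \<Rightarrow> if kind t \<in> Ks then move t f c else f c) else f c))"
  proof (induction Ks rule: finite_induct)
    case empty
    show ?case by (intro exI[of _ f]) (auto split: option.split)
  next
    case (insert \<kappa> Ks)
    then obtain f1 where f1: "seg\<^sup>*\<^sup>* f f1" "\<And>c. lo_i c \<le> m \<Longrightarrow> f1 c =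
      (if hi_i c > m then (case q (hi_i c) of None \<Rightarrow> f c | Some t \<Rightarrow> if kind t \<in> Ks then move t f c else f c) else f c)"
      by blast
    define q' where "q' n = (case q n of None \<Rightarrow> None | Some t \<Rightarrow> if kind t = \<kappa> then Some t else None)" for n
    have q': "valid n t \<and> kind t = \<kappa>" if "n > m" "q' n = Some t" for n t
      using that q[OF that(1)] unfolding q'_def by (auto split: option.splits if_splits)
    obtain f2 where f2: "seg\<^sup>*\<^sup>* f1 f2" "\<And>c. lo_i c \<le> m \<Longrightarrow> f2 c =
      (if hi_i c > m then (case q' (hi_i c) of None \<Rightarrow> f1 c | Some t \<Rightarrow> move t f1 c) else f1 c)"
      using one_kind[OF rtranclp_seg_agrees[OF f1(1) f] q'] by blast
    have "f2 c = (if hi_i c > m then (case q (hi_i c) of None \<Rightarrow> f c | Some t \<Rightarrow> if kind t \<in> insert \<kappa> Ks then move t f c else f c) else f c)"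
      if c: "lo_i c \<le> m" for c
    proof (cases "hi_i c > m \<and> (\<exists>t. q (hi_i c) = Some t \<and> kind t = \<kappa>)")
      case True
      then obtain t where t: "hi_i c > m" "q (hi_i c) = Some t" "kind t = \<kappa>" by blast
      have v: "valid (hi_i c) t" using q t by blast
      \<comment> \<open>This n has the new kind \<kappa>, so the kinds handled so far have not
        touched its cells.\<close>
      have f1f: "f1 d = f d" if "d \<in> layer_cells (hi_i c)" for d
        using f1(2)[of d] that t insert.hyps(2) by (simp add: layer_cells_def)
      have "move t f1 c = move t f c"
      proof (cases "lo_i c = m")
        case True
        then show ?thesis using move_cong[OF v f1f] by (simp add: layer_cells_def)
      next
        case False
        then have "c \<notin> layer_cells (hi_i c)" by (simp add: layer_cells_def)
        moreover have "f1 c = f c" using f1(2)[OF c] t insert.hyps(2) by simp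
        ultimately show ?thesis using move_outside[OF v] by simp
      qed
      then show ?thesis using f2(2)[OF c] t by (simp add: q'_def)
    next
      case False
      then have "hi_i c > m \<Longrightarrow> q' (hi_i c) = None" by (auto simp: q'_def split: option.split)
      then have "f2 c = f1 c" using f2(2)[OF c] by (cases "hi_i c > m") simp_all
      then show ?thesis using f1(2)[OF c] False by (auto split: option.split)
    qed
    then show ?case using rtranclp_trans[OF f1(1) f2(1)] by blast
  qed
  then obtain f' where f': "seg\<^sup>*\<^sup>* f f'" "\<And>c. lo_i c \<le> m \<Longrightarrow> f' c =
    (if hi_i c > m then (case q (hi_i c) of None \<Rightarrow> f c | Some t \<Rightarrow> if kind t \<in> Ks then move t f c else f c) else f c)"
    by blast
  have "kind t \<in> Ks" if "n > m" "q n = Some t" for n t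
    using q[OF that] cell_not_inf unfolding Ks_def valid_def kind_def by (auto simp: is_inf_cases)
  then have "f' c = (if hi_i c > m then (case q (hi_i c) of None \<Rightarrow> f c | Some t \<Rightarrow> move t f c) else f c)"
    if "lo_i c \<le> m" for c
    using f'(2)[OF that] by (auto split: option.split)
  with f'(1) show ?thesis by blast
qed

text \<open>\<open>None\<close> is mere filler here. Erasing the colours outside
  \<open>layer_cells n\<close> leaves a finite space of configurations in which paths can be
  counted.\<close>

definition restr :: "nat \<Rightarrow> 'l config \<Rightarrow> 'l config" where
  "restr n f = (\<lambda>c. if c \<in> layer_cells n then f c else None)"

lemma twist_cycles_valid: "(a, b, c) \<in> twist_cycles e (layer_cells n) m \<Longrightarrow> \<exists>t. valid n t \<and> (\<forall>f. act3 a b c f = move t f) \<and> {a, b, c} \<subseteq> layer_cells n"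
proof -
  assume "(a, b, c) \<in> twist_cycles e (layer_cells n) m"
  then obtain p i k where "a = p" "b = qt i (cc i p) p" "c = qt k (cc k p) p" "valid n (p, i, k)"
    unfolding twist_cycles_def valid_def by blast
  moreover from this have "{a, b, c} \<subseteq> layer_cells n" by (simp add: valid_def)
  ultimately show ?thesis by (intro exI[of _ "(p, i, k)"]) (simp add: move_def)
qed

text \<open>Induction on a bound N for all n together: a round may take one step for every n > m at
  once, so N rounds suffice although there are infinitely many n.\<close>

lemma many_rounds:
  assumes "\<And>c. lo_i c < m \<or> lo_i c = m \<and> hi_i c = m \<Longrightarrow> f c = g c"
    and "\<And>n. n > m \<Longrightarrow> \<exists>k\<le>N. (restr n f, restr n g) \<in> cycle_step (twist_cycles e (layer_cells n) m) ^^ k"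
  shows "\<exists>f'. seg\<^sup>*\<^sup>* f f' \<and> (\<forall>c. lo_i c \<le> m \<longrightarrow> f' c = g c)"
  using assms
proof (induction N arbitrary: f)
  case 0
  have "f c = g c" if c: "lo_i c \<le> m" for c
  proof (cases "lo_i c = m \<and> hi_i c > m")
    case True
    then have "restr (hi_i c) f = restr (hi_i c) g" using 0(2)[of "hi_i c"] by auto
    then have "restr (hi_i c) f c = restr (hi_i c) g c" by simp
    then show ?thesis using True by (simp add: restr_def layer_cells_def)
  next
    case False
    then have "lo_i c < m \<or> lo_i c = m \<and> hi_i c = m" using c lo_index_le_hi_index[of e c] by arith
    then show ?thesis by (rule 0(1))
  qed
  then show ?case by (intro exI[of _ f]) auto
next
  case (Suc N)
  have okf: "agrees f" unfolding agrees_def using Suc.prems(1) lo_index_le_hi_index[of e] by (meson order.strict_trans1)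
  \<comment> \<open>\<open>None\<close> lets n pause for this round, which is admissible if at most
    N steps remain anyway; otherwise the first step of a path is taken.\<close>
  define Q where "Q n q = (case q of None \<Rightarrow> \<exists>k\<le>N. (restr n f, restr n g) \<in> cycle_step (twist_cycles e (layer_cells n) m) ^^ k
      | Some t \<Rightarrow> valid n t \<and> (\<exists>k\<le>N. (restr n (move t f), restr n g) \<in> cycle_step (twist_cycles e (layer_cells n) m) ^^ k))" for n q
  have ex: "\<exists>q. Q n q" if n: "n > m" for n
  proof -
    obtain k where k: "k \<le> Suc N" "(restr n f, restr n g) \<in> cycle_step (twist_cycles e (layer_cells n) m) ^^ k" using Suc.prems(2)[OF n] by blast
    show ?thesis
    proof (cases k)
      case 0
      then show ?thesis using k(2) by (intro exI[of _ None]) (auto simp: Q_def)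
    next
      case (Suc k')
      then obtain h where h: "(restr n f, h) \<in> cycle_step (twist_cycles e (layer_cells n) m)" "(h, restr n g) \<in> cycle_step (twist_cycles e (layer_cells n) m) ^^ k'"
        using k(2) relpow_Suc_D2[of "restr n f" "restr n g"] by blast
      from h(1) obtain a b c where abc: "h = act3 a b c (restr n f)" "(a, b, c) \<in> twist_cycles e (layer_cells n) m"
        unfolding cycle_step_def by blast
      obtain t where t: "valid n t" "\<And>f. act3 a b c f = move t f" "{a, b, c} \<subseteq> layer_cells n"
        using twist_cycles_valid[OF abc(2)] by blast
      have "a \<in> layer_cells n" "b \<in> layer_cells n" "c \<in> layer_cells n" using t(3) by simp_all
      then have "h = restr n (act3 a b c f)" unfolding abc(1)
        by (intro ext) (simp add: act3_def restr_def)
      then have "h = restr n (move t f)" unfolding t(2) .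
      then show ?thesis using t(1) h(2) k(1) Suc by (intro exI[of _ "Some t"]) (auto simp: Q_def)
    qed
  qed
  define q where "q n = (SOME x. Q n x)" for n
  have q: "Q n (q n)" if "n > m" for n unfolding q_def by (rule someI_ex[OF ex[OF that]])
  have qv: "valid n t" if "n > m" "q n = Some t" for n t using q[OF that(1)] that(2) by (simp add: Q_def)
  obtain f1 where f1: "seg\<^sup>*\<^sup>* f f1" "\<And>c. lo_i c \<le> m \<Longrightarrow> f1 c =
    (if hi_i c > m then (case q (hi_i c) of None \<Rightarrow> f c | Some t \<Rightarrow> move t f c) else f c)"
    using one_round[OF okf qv] by blast
  have "\<exists>f'. seg\<^sup>*\<^sup>* f1 f' \<and> (\<forall>c. lo_i c \<le> m \<longrightarrow> f' c = g c)"
  proof (rule Suc.IH)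
    show "f1 c = g c" if c: "lo_i c < m \<or> lo_i c = m \<and> hi_i c = m" for c
    proof -
      have "move t f c = f c" if "hi_i c > m" "q (hi_i c) = Some t" for t
      proof -
        have "c \<notin> layer_cells (hi_i c)" using c that(1) by (auto simp: layer_cells_def)
        then show ?thesis by (rule move_outside[OF qv[OF that]])
      qed
      then have "f1 c = f c" using f1(2)[of c] c by (auto split: option.split)
      then show ?thesis using Suc.prems(1)[OF c] by simp
    qed
    show "\<exists>k\<le>N. (restr n f1, restr n g) \<in> cycle_step (twist_cycles e (layer_cells n) m) ^^ k" if n: "n > m" for n
    proof (cases "q n")
      case None
      have "restr n f1 = restr n f" using f1(2) n None by (auto simp: restr_def layer_cells_def fun_eq_iff)
      then show ?thesis using q[OF n] None by (simp add: Q_def)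
    next
      case (Some t)
      have "restr n f1 = restr n (move t f)" using f1(2) n Some by (auto simp: restr_def layer_cells_def fun_eq_iff)
      then show ?thesis using q[OF n] Some by (simp add: Q_def)
    qed
  qed
  then show ?case using rtranclp_trans[OF f1(1)] by blast
qed

end

section \<open>Solving one layer\<close>

lemma finite_UNIV_colour: "finite (UNIV :: colour set)"
proof -
  have "(UNIV :: colour set) = {Red, White, Green, Orange, Yellow, Blue}"
    using colour.exhaust by blast
  moreover have "finite {Red, White, Green, Orange, Yellow, Blue}" by simp
  ultimately show ?thesis by simp
qed

lemma finite_UNIV_colour_option: "finite (UNIV :: colour option set)"
  using finite_UNIV_colour by (simp add: UNIV_option_conv)

lemma relpow_mono:
  fixes R S :: "('a \<times> 'a) set"
  assumes "R \<subseteq> S"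
  shows "R ^^ k \<subseteq> S ^^ k"
  by (induction k) (use assms in auto)

lemma twist_closed_lo_index_hi_index: "twist_closed {c. lo_index e c = a \<and> hi_index e c = b}"
  by (rule twist_closedI) simp

lemma standard_cards:
  assumes "standard f" "standard g" "\<not> center_cell c"
  shows "card {d \<in> cluster c. f d = v} = card {d \<in> cluster c. g d = v}" "card {d \<in> cluster c. f d = f c} = 4"
proof -
  have n: "{d \<in> cluster c. h d = None} = {}" if "standard h" for h
    using that by (auto simp: standard_def legal_def)
  have 4: "card {d \<in> cluster c. h d = Some col} = 4" if "standard h" for h col
    using that assms(3) unfolding standard_alt by blast
  show "card {d \<in> cluster c. f d = v} = card {d \<in> cluster c. g d = v}"
  proof (cases v)
    case None
    then show ?thesis by (simp only: n[OF assms(1)] n[OF assms(2)])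
  next
    case (Some col)
    then show ?thesis using 4[OF assms(1)] 4[OF assms(2)] by simp
  qed
  have "f c \<noteq> None" using assms(1) by (simp add: standard_def legal_def)
  then obtain col where "f c = Some col" by blast
  then show "card {d \<in> cluster c. f d = f c} = 4" using 4[OF assms(1)] by simp
qed

context stage
begin

text \<open>Each of the three coordinates is infinite or has layer m or n, which leaves at most 2 +
  3 + 3 = 8 values, and 8^3 = 512. The bound does not depend on n.\<close>

lemma finite_layer_cells: "finite (layer_cells n)" and card_layer_cells: "card (layer_cells n) \<le> 512"
proof -
  let ?I = "\<lambda>n. {\<alpha> :: 'l ext. \<not> is_inf \<alpha> \<and> idx e \<alpha> = n}"
  let ?S = "{PInf, MInf} \<union> ?I m \<union> ?I n"
  have finS: "finite ?S" using finite_idx by simp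
  have "card ?S \<le> card ({PInf, MInf} \<union> ?I m) + card (?I n)" by (rule card_Un_le)
  also have "\<dots> \<le> (card {PInf, MInf :: 'l ext} + card (?I m)) + card (?I n)"
    by (rule add_right_mono[OF card_Un_le])
  also have "\<dots> \<le> (2 + 3) + 3" by (intro add_mono card_idx) (simp add: card_insert_if)
  finally have S8: "card ?S \<le> 8" by simp
  have coord: "cc i c \<in> ?S" if "c \<in> layer_cells n" for i c
  proof (cases "is_inf (cc i c)")
    case True
    then show ?thesis by (auto simp: is_inf_cases)
  next
    case False
    then have "idx e (cc i c) \<in> {m, n}"
      using index_set_axis[OF False, of e] index_set_lo_index_hi_index[of e c] that by (simp add: layer_cells_def)
    then show ?thesis using False by auto
  qed
  have sub: "Rep_cell ` layer_cells n \<subseteq> ?S \<times> ?S \<times> ?S"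
  proof
    fix p assume "p \<in> Rep_cell ` layer_cells n"
    then obtain c where c: "c \<in> layer_cells n" "p = Rep_cell c" by blast
    obtain x y z where xyz: "Rep_cell c = (x, y, z)" by (cases "Rep_cell c")
    have "x \<in> ?S" "y \<in> ?S" "z \<in> ?S"
      using coord[OF c(1), of AX] coord[OF c(1), of AY] coord[OF c(1), of AZ] unfolding xyz co.simps .
    then show "p \<in> ?S \<times> ?S \<times> ?S" unfolding c(2) xyz by (intro SigmaI)
  qed
  have inj: "inj_on Rep_cell (layer_cells n)" by (auto simp: inj_on_def Rep_cell_inject)
  have fin3: "finite (?S \<times> ?S \<times> ?S)" using finS by (intro finite_SigmaI)
  show "finite (layer_cells n)" using finite_subset[OF sub fin3] inj by (rule finite_imageD)
  have "card (layer_cells n) = card (Rep_cell ` layer_cells n)" by (rule card_image[OF inj, symmetric])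
  also have "\<dots> \<le> card (?S \<times> ?S \<times> ?S)" by (rule card_mono[OF fin3 sub])
  also have "\<dots> = card ?S * (card ?S * card ?S)" by (simp only: card_cartesian_product)
  also have "\<dots> \<le> 8 * (8 * 8)" using S8 by (intro mult_le_mono)
  finally show "card (layer_cells n) \<le> 512" by simp
qed

lemma finite_restricted: "finite {u :: 'l config. \<forall>c. c \<notin> layer_cells n \<longrightarrow> u c = None}" (is "finite ?V")
  and card_restricted: "card {u :: 'l config. \<forall>c. c \<notin> layer_cells n \<longrightarrow> u c = None} \<le> card (UNIV :: colour option set) ^ 512"
proof -
  let ?E = "layer_cells n \<rightarrow>\<^sub>E (UNIV :: colour option set)"
  have inj: "inj_on (\<lambda>u. restrict u (layer_cells n)) ?V"
  proof (rule inj_onI)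
    fix u v assume "u \<in> ?V" "v \<in> ?V" and eq: "restrict u (layer_cells n) = restrict v (layer_cells n)"
    then show "u = v"
    proof (intro ext)
      fix c show "u c = v c"
        using \<open>u \<in> ?V\<close> \<open>v \<in> ?V\<close> fun_cong[OF eq, of c] by (cases "c \<in> layer_cells n") simp_all
    qed
  qed
  have sub: "(\<lambda>u. restrict u (layer_cells n)) ` ?V \<subseteq> ?E" by auto
  have finE: "finite ?E" by (intro finite_PiE finite_layer_cells finite_UNIV_colour_option)
  show "finite ?V" by (rule inj_on_finite[OF inj sub finE])
  have "card ?V \<le> card ?E" by (rule card_inj_on_le[OF inj sub finE])
  also have "\<dots> = card (UNIV :: colour option set) ^ card (layer_cells n)" by (simp only: card_funcsetE[OF finite_layer_cells])
  also have "\<dots> \<le> card (UNIV :: colour option set) ^ 512"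
  proof (rule power_increasing[OF card_layer_cells])
    show "1 \<le> card (UNIV :: colour option set)"
      using finite_UNIV_colour_option by (simp add: Suc_leI card_gt_0_iff)
  qed
  finally show "card ?V \<le> card (UNIV :: colour option set) ^ 512" .
qed

text \<open>In a finite directed graph, connected vertices are connected by a path with at most as
  many steps as there are edges. The vertices are the colourings supported on
  \<open>layer_cells n\<close>, whose number is bounded independently of n; squaring it bounds the
  edges.\<close>

lemma bounded_rounds:
  "\<exists>N. \<forall>n (u :: 'l config) v. (u, v) \<in> (cycle_step (twist_cycles e (layer_cells n) m))\<^sup>* \<longrightarrow> (\<forall>c. c \<notin> layer_cells n \<longrightarrow> u c = None) \<longrightarrow>
    (\<exists>k\<le>N. (u, v) \<in> cycle_step (twist_cycles e (layer_cells n) m) ^^ k)"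
proof -
  let ?q = "card (UNIV :: colour option set) ^ 512"
  have "\<exists>k\<le>?q * ?q. (u, v) \<in> cycle_step (twist_cycles e (layer_cells n) m) ^^ k"
    if uv: "(u, v) \<in> (cycle_step (twist_cycles e (layer_cells n) m))\<^sup>*" and u: "\<And>c. c \<notin> layer_cells n \<Longrightarrow> u c = None" for n and u v :: "'l config"
  proof -
    define V where "V = {u :: 'l config. \<forall>c. c \<notin> layer_cells n \<longrightarrow> u c = None}"
    define R where "R = cycle_step (twist_cycles e (layer_cells n) m) \<inter> V \<times> V"
    have finV: "finite V" and cV: "card V \<le> ?q"
      unfolding V_def by (rule finite_restricted, rule card_restricted)
    have finR: "finite R" unfolding R_def using finV by simp
    have "card R \<le> card (V \<times> V)" unfolding R_def using finV by (intro card_mono) auto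
    also have "\<dots> \<le> ?q * ?q" unfolding card_cartesian_product using cV by (intro mult_le_mono)
    finally have cR: "card R \<le> ?q * ?q" .
    have "(u, v) \<in> R\<^sup>* \<and> v \<in> V" using uv
    proof (induction rule: rtrancl_induct)
      case base
      show ?case using u by (simp add: V_def)
    next
      case (step x y)
      from step(2) obtain a b c where abc: "y = act3 a b c x" "(a, b, c) \<in> twist_cycles e (layer_cells n) m"
        unfolding cycle_step_def by blast
      have "{a, b, c} \<subseteq> layer_cells n" using twist_cycles_valid[OF abc(2)] by blast
      then have "y d = x d" if "d \<notin> layer_cells n" for d using that unfolding abc(1) act3_def by auto
      then have "y \<in> V" using step(3) by (simp add: V_def)
      then have "(x, y) \<in> R" using step(2,3) by (simp add: R_def)
      then show ?case using step(3) \<open>y \<in> V\<close> by (meson rtrancl.rtrancl_into_rtrancl)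
    qed
    then obtain k where "k \<le> card R" "(u, v) \<in> R ^^ k"
      using rtrancl_finite_eq_relpow[OF finR] by auto
    moreover have "R ^^ k \<subseteq> cycle_step (twist_cycles e (layer_cells n) m) ^^ k" by (rule relpow_mono) (simp add: R_def)
    ultimately show ?thesis using cR by (meson order_trans subsetD)
  qed
  then show ?thesis by blast
qed

lemma layer_cells_reach:
  assumes "standard f" "n \<ge> m" "n > 0"
  shows "(f, \<lambda>c. if c \<in> layer_cells n then g c else f c) \<in> (cycle_step (twist_cycles e (layer_cells n) m))\<^sup>*"
proof (rule recolour_P)
  have nc: "\<not> center_cell c" if "c \<in> layer_cells n" for c
    using that assms(3) center_cell_iff_hi_index[of c e] by (simp add: layer_cells_def)
  then show "\<not> center_cell c" if "c \<in> layer_cells n" for c using that .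
  show "twist_closed (layer_cells n)" unfolding layer_cells_def by (rule twist_closed_lo_index_hi_index)
  show "m \<in> index_set e c" if "c \<in> layer_cells n" for c using that index_set_lo_index_hi_index[of e c] by (simp add: layer_cells_def)
  show "finite (layer_cells n)" by (rule finite_layer_cells)
  show "card {d \<in> cluster c. f d = v} = card {d \<in> cluster c. g d = v}" if "c \<in> layer_cells n" for c v
    using standard_cards(1)[OF assms(1) g_std nc[OF that]] .
  show "card {d \<in> cluster c. f d = f c} = 4" if "c \<in> layer_cells n" for c
    using standard_cards(2)[OF assms(1) g_std nc[OF that]] .
qed

lemma solve_offdiagonal:
  assumes "standard f" and eq: "\<And>c. lo_i c < m \<or> lo_i c = m \<and> hi_i c = m \<Longrightarrow> f c = g c"
  shows "\<exists>f'. seg\<^sup>*\<^sup>* f f' \<and> (\<forall>c. lo_i c \<le> m \<longrightarrow> f' c = g c)"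
proof -
  obtain N where N: "\<And>n (u :: 'l config) v. (u, v) \<in> (cycle_step (twist_cycles e (layer_cells n) m))\<^sup>* \<Longrightarrow> (\<And>c. c \<notin> layer_cells n \<Longrightarrow> u c = None) \<Longrightarrow>
    \<exists>k\<le>N. (u, v) \<in> cycle_step (twist_cycles e (layer_cells n) m) ^^ k"
    using bounded_rounds by blast
  show ?thesis
  proof (rule many_rounds[OF eq])
    fix n assume n: "n > m"
    \<comment> \<open>Applying a 3-cycle inside \<open>layer_cells n\<close> commutes with erasing
      the colours elsewhere.\<close>
    have rsE: "(restr n u, restr n v) \<in> (cycle_step (twist_cycles e (layer_cells n) m))\<^sup>*" if "(u, v) \<in> (cycle_step (twist_cycles e (layer_cells n) m))\<^sup>*" for u v
      using that
    proof (induction rule: rtrancl_induct)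
      case (step x y)
      from step(2) obtain a b c where abc: "y = act3 a b c x" "(a, b, c) \<in> twist_cycles e (layer_cells n) m"
        unfolding cycle_step_def by blast
      have "a \<in> layer_cells n" "b \<in> layer_cells n" "c \<in> layer_cells n" using twist_cycles_valid[OF abc(2)] by auto
      then have "restr n y = act3 a b c (restr n x)" unfolding abc(1)
        by (intro ext) (simp add: act3_def restr_def)
      then have "(restr n x, restr n y) \<in> cycle_step (twist_cycles e (layer_cells n) m)" using abc(2) unfolding cycle_step_def by blast
      with step(3) show ?case by (rule rtrancl_into_rtrancl)
    qed simp
    have "restr n (\<lambda>c. if c \<in> layer_cells n then g c else f c) = restr n g" by (simp add: restr_def fun_eq_iff)
    then have "(restr n f, restr n g) \<in> (cycle_step (twist_cycles e (layer_cells n) m))\<^sup>*"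
      using rsE[OF layer_cells_reach[OF assms(1), of n]] n by simp
    then show "\<exists>k\<le>N. (restr n f, restr n g) \<in> cycle_step (twist_cycles e (layer_cells n) m) ^^ k"
      by (rule N) (simp add: restr_def)
  qed
qed

text \<open>Both slices through p have layer m, so nothing is left to be done for many n
  simultaneously. The ten twists of the commutator are carried out individually, each padded to a
  segment.\<close>

lemma seg_move_diagonal:
  assumes v: "valid m t" and h: "agrees h" and m: "m > 0"
  shows "seg\<^sup>*\<^sup>* h (move t h)"
proof -
  obtain p i k where t: "t = (p, i, k)" by (cases t)
  have p: "p \<in> layer_cells m" "i \<noteq> k" "is_inf (cc k p)" using v by (simp_all add: t valid_def)
  obtain j where j: "i \<noteq> j" "j \<noteq> k" using third_axis[OF p(2)] .
  have fin: "\<not> is_inf (cc i p)" "\<not> is_inf (cc j p)" using cell_not_inf p j by blast+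
  have ix: "idx e (cc i p) = m" "idx e (cc j p) = m"
  proof -
    have "index_set e p = {m}" using index_set_lo_index_hi_index[of e p] p(1) by (simp add: layer_cells_def)
    then show "idx e (cc i p) = m" "idx e (cc j p) = m"
      using index_set_axis[OF fin(1), of e] index_set_axis[OF fin(2), of e] by simp_all
  qed
  have nc: "\<not> center_cell p" using p(1) m center_cell_iff_hi_index[of p e] by (simp add: layer_cells_def)
  have sl: "seg h (act (qt i (cc i p)) h)" "seg h (act (iqt i (cc i p)) h)"
     "seg h (act (qt j (cc j p)) h)" "seg h (act (iqt j (cc j p)) h)" for h
    by (rule seg_slice[OF sliceI(1)[OF fin(1) ix(1)]], simp, rule seg_slice[OF sliceI(2)[OF fin(1) ix(1)]], simp,
      rule seg_slice[OF sliceI(1)[OF fin(2) ix(2)]], simp, rule seg_slice[OF sliceI(2)[OF fin(2) ix(2)]], simp)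
  have st: "seg\<^sup>*\<^sup>* h (act (qt i (cc i p)) h')" "seg\<^sup>*\<^sup>* h (act (iqt i (cc i p)) h')"
     "seg\<^sup>*\<^sup>* h (act (qt j (cc j p)) h')" "seg\<^sup>*\<^sup>* h (act (iqt j (cc j p)) h')" if "seg\<^sup>*\<^sup>* h h'" for h'
    by (rule rtranclp.rtrancl_into_rtrancl[OF that], rule sl)+
  define h1 where "h1 = act (iqt k (cc k p)) h"
  have w1: "seg\<^sup>*\<^sup>* h h1" unfolding h1_def by (rule r_into_rtranclp, rule seg_face(2)[OF p(3) h])
  define h5 where "h5 = act (qt j (cc j p)) (act (qt i (cc i p)) (act (iqt j (cc j p)) (act (iqt i (cc i p)) h1)))"
  have w5: "seg\<^sup>*\<^sup>* h h5" unfolding h5_def by (intro st w1)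
  have "agrees h5" by (rule rtranclp_seg_agrees[OF w5 h])
  then have w6: "seg\<^sup>*\<^sup>* h (act (qt k (cc k p)) h5)"
    by (intro rtranclp.rtrancl_into_rtrancl[OF w5] seg_face(1)[OF p(3)])
  have w: "seg\<^sup>*\<^sup>* h (act (qt i (cc i p)) (act (qt j (cc j p)) (act (iqt i (cc i p)) (act (iqt j (cc j p)) (act (qt k (cc k p)) h5)))))"
    by (intro st w6)
  have eq: "act (qt i (cc i p)) (act (qt j (cc j p)) (act (iqt i (cc i p)) (act (iqt j (cc j p)) (act (qt k (cc k p)) h5)))) = move t h"
    unfolding h5_def h1_def t move_def prod.case by (rule commutator_twists[OF j p(2,3) nc])
  show ?thesis using w unfolding eq .
qed

lemma solve_diagonal:
  assumes f: "standard f" and eq: "\<And>c. lo_i c < m \<Longrightarrow> f c = g c"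
  shows "\<exists>f'. seg\<^sup>*\<^sup>* f f' \<and> (\<forall>c. lo_i c < m \<or> lo_i c = m \<and> hi_i c = m \<longrightarrow> f' c = g c)"
proof (cases "m = 0")
  case True
  \<comment> \<open>For m = 0 the diagonal cells are the centers. They lie outside the reach of the
    3-cycles, but finitely many turns of layer 0 place them.\<close>
  obtain ws where ws: "\<forall>c. center_cell c \<longrightarrow> fold (\<lambda>i. act (qt i (Fin Zero))) ws f c = g c"
    using center_reach[of f g] f g_std unfolding standard_alt by blast
  have "seg h (act (qt i (Fin Zero)) h)" for h i
    by (rule seg_slice[of 0]) (auto simp: True intro: sliceI)
  then have "seg\<^sup>*\<^sup>* h (fold (\<lambda>i. act (qt i (Fin Zero))) ws h)" for h
    by (induction ws arbitrary: h) (auto intro: converse_rtranclp_into_rtranclp)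
  moreover have "center_cell c" if "lo_i c < m \<or> lo_i c = m \<and> hi_i c = m" for c
    using that True center_cell_iff_hi_index[of c e] by simp
  ultimately show ?thesis using ws by blast
next
  case False
  let ?f' = "\<lambda>c. if c \<in> layer_cells m then g c else f c"
  have okf: "agrees f" unfolding agrees_def using eq lo_index_le_hi_index[of e] by (meson order.strict_trans1)
  have "(f, ?f') \<in> (cycle_step (twist_cycles e (layer_cells m) m))\<^sup>*" using layer_cells_reach[OF f, of m] False by simp
  then have "seg\<^sup>*\<^sup>* f ?f'"
  proof (induction rule: rtrancl_induct)
    case (step x y)
    from step(2) obtain a b c where abc: "y = act3 a b c x" "(a, b, c) \<in> twist_cycles e (layer_cells m) m"
      unfolding cycle_step_def by blast
    obtain t where t: "valid m t" "\<And>f. act3 a b c f = move t f" using twist_cycles_valid[OF abc(2)] by blast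
    have "agrees x" using rtranclp_seg_agrees[OF step(3) okf] .
    then have "seg\<^sup>*\<^sup>* x y" using seg_move_diagonal[OF t(1)] False unfolding abc(1) t(2) by simp
    with step(3) show ?case by (rule rtranclp_trans)
  qed simp
  moreover have "?f' c = g c" if "lo_i c < m \<or> lo_i c = m \<and> hi_i c = m" for c
    using that eq[of c] by (auto simp: layer_cells_def)
  ultimately show ?thesis by blast
qed

lemma stage_step:
  assumes f: "standard f" and eq: "\<And>c. lo_i c < m \<Longrightarrow> f c = g c"
  shows "\<exists>f'. seg\<^sup>+\<^sup>+ f f' \<and> standard f' \<and> (\<forall>c. lo_i c \<le> m \<longrightarrow> f' c = g c)"
proof -
  obtain f1 where f1: "seg\<^sup>*\<^sup>* f f1" "\<And>c. lo_i c < m \<or> lo_i c = m \<and> hi_i c = m \<Longrightarrow> f1 c = g c"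
    using solve_diagonal[OF f eq] by blast
  have s1: "standard f1" by (rule rtranclp_seg_standard[OF f1(1) f])
  obtain f2 where f2: "seg\<^sup>*\<^sup>* f1 f2" "\<And>c. lo_i c \<le> m \<Longrightarrow> f2 c = g c"
    using solve_offdiagonal[OF s1 f1(2)] by blast
  \<comment> \<open>The idle segment guarantees that the stage contains at least one segment, as the
    concatenation of stages requires.\<close>
  have "seg\<^sup>+\<^sup>+ f f2" using seg_refl rtranclp_trans[OF f1(1) f2(1)] by (rule rtranclp_into_tranclp2)
  moreover have "standard f2" by (rule rtranclp_seg_standard[OF f2(1) s1])
  ultimately show ?thesis using f2(2) by blast
qed

end

section \<open>Runs of length omega squared\<close>

lemma omega2_iff: "((a, b), (c, d)) \<in> omega2 \<longleftrightarrow> a < c \<or> a = c \<and> b \<le> d"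
  by (simp add: omega2_def)

text \<open>The order of type omega^2 is carried over to an arbitrary index type, so that one
  construction yields runs indexed by \<open>nat\<close> as well as by \<open>omega2\<close>
  itself.\<close>

definition pull_omega2 :: "('o \<Rightarrow> nat \<times> nat) \<Rightarrow> 'o rel" where
  "pull_omega2 d = inv_image omega2 d"

context
  fixes d :: "'o \<Rightarrow> nat \<times> nat"
  assumes d: "bij d"
begin

abbreviation "ord \<equiv> pull_omega2 d"

lemma ord_iff: "(x, y) \<in> ord \<longleftrightarrow> fst (d x) < fst (d y) \<or> fst (d x) = fst (d y) \<and> snd (d x) \<le> snd (d y)"
  by (cases "d x"; cases "d y") (simp add: pull_omega2_def omega2_iff)

lemma d_eq_iff: "d x = d y \<longleftrightarrow> x = y"
  using d by (metis bij_pointE)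

lemma d_surj: obtains x where "d x = p"
  using d by (metis bij_pointE)

lemma ord_refl [simp]: "(x, x) \<in> ord"
  by (simp add: ord_iff)

lemma Field_ord: "Field ord = UNIV"
proof -
  have "x \<in> Field ord" for x using FieldI1[OF ord_refl] .
  then show ?thesis by blast
qed

lemma ord_total: "(x, y) \<in> ord \<or> (y, x) \<in> ord"
  unfolding ord_iff by linarith

lemma ord_trans: "trans ord"
  unfolding trans_def ord_iff by auto

lemma ord_antisym: "(x, y) \<in> ord \<Longrightarrow> (y, x) \<in> ord \<Longrightarrow> x = y"
  unfolding ord_iff d_eq_iff[symmetric] by (auto simp: prod_eq_iff)

lemma Well_order_ord: "Well_order ord"
proof -
  have "ord - Id \<subseteq> inv_image (less_than <*lex*> less_than) d"
  proof
    fix z assume "z \<in> ord - Id"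
    then obtain x y where z: "z = (x, y)" "(x, y) \<in> ord" "x \<noteq> y" by (cases z) auto
    then have "d x \<noteq> d y" by (simp add: d_eq_iff)
    then show "z \<in> inv_image (less_than <*lex*> less_than) d"
      using z(2) unfolding z(1) ord_iff by (cases "d x"; cases "d y") auto
  qed
  then have "wf (ord - Id)" by (rule wf_subset[rotated]) (intro wf_inv_image wf_lex_prod wf_less_than)
  moreover have "refl_on UNIV ord" by (auto simp: refl_on_def)
  ultimately show ?thesis
    unfolding Field_ord well_order_on_def linear_order_on_def partial_order_on_def preorder_on_def
    using ord_trans ord_total ord_antisym by (auto simp: antisym_def total_on_def)
qed

text \<open>\<open>F m k\<close> is the configuration at the ordinal omega * m + k. Pairs with k > 0
  are successors, pairs (m, 0) with m > 0 are limits; \<open>lim\<close> serves these limits and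
  \<open>fin\<close> the terminal one.\<close>

lemma accessible_via_ord:
  fixes F :: "nat \<Rightarrow> nat \<Rightarrow> 'l config"
  assumes \<sigma>: "\<And>m k. \<sigma> m k \<in> basic_twists" and F0: "F 0 0 = f"
    and FS: "\<And>m k. F m (Suc k) = act (\<sigma> m k) (F m k)"
    and lim: "\<And>m c. \<exists>K. \<forall>k\<ge>K. F m k c = F (Suc m) 0 c"
    and fin: "\<And>c. \<exists>M. \<forall>m\<ge>M. \<forall>k. F m k c = g c"
  shows "accessible_via ord f g"
proof -
  define \<sigma>' where "\<sigma>' x = \<sigma> (fst (d x)) (snd (d x))" for x
  define F' where "F' x = F (fst (d x)) (snd (d x))" for x
  have "run_ok ord \<sigma>' f F'"
    unfolding run_ok_def Field_ord
  proof
    fix \<eta>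
    let ?pred = "\<lambda>\<zeta>. (\<zeta>, \<eta>) \<in> ord \<and> \<zeta> \<noteq> \<eta> \<and> (\<forall>\<xi>. (\<zeta>, \<xi>) \<in> ord \<and> (\<xi>, \<eta>) \<in> ord \<longrightarrow> \<xi> = \<zeta> \<or> \<xi> = \<eta>)"
    obtain m k where mk: "d \<eta> = (m, k)" by (cases "d \<eta>")
    obtain z where z: "d z = (0, 0)" using d_surj .
    show "F' \<eta> = (if \<forall>\<zeta>\<in>UNIV. (\<eta>, \<zeta>) \<in> ord then f
            else if \<exists>\<zeta>. ?pred \<zeta> then (let \<zeta> = (THE \<zeta>. ?pred \<zeta>) in act (\<sigma>' \<zeta>) (F' \<zeta>))
            else evconst ord (\<lambda>\<zeta>. (\<zeta>, \<eta>) \<in> ord \<and> \<zeta> \<noteq> \<eta>) F')"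
    proof (cases k)
      case (Suc k')
      obtain \<zeta> where \<zeta>: "d \<zeta> = (m, k')" using d_surj .
      have nmin: "\<not> (\<forall>\<zeta>\<in>UNIV. (\<eta>, \<zeta>) \<in> ord)" using z mk Suc by (auto simp: ord_iff intro!: exI[of _ z])
      have p: "?pred \<zeta>"
      proof (intro conjI allI impI)
        show "(\<zeta>, \<eta>) \<in> ord" by (simp add: ord_iff \<zeta> mk Suc)
        show "\<zeta> \<noteq> \<eta>" using \<zeta> mk Suc by auto
        fix \<xi> assume "(\<zeta>, \<xi>) \<in> ord \<and> (\<xi>, \<eta>) \<in> ord"
        then have "d \<xi> = (m, k') \<or> d \<xi> = (m, Suc k')"
          by (cases "d \<xi>") (auto simp: ord_iff \<zeta> mk Suc)
        then show "\<xi> = \<zeta> \<or> \<xi> = \<eta>" using \<zeta> mk Suc d_eq_iff by metis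
      qed
      have "(THE \<zeta>. ?pred \<zeta>) = \<zeta>"
      proof (rule the_equality)
        show "?pred \<zeta>" by (rule p)
        fix \<xi> assume x: "?pred \<xi>"
        from ord_total[of \<xi> \<zeta>] show "\<xi> = \<zeta>" using x p by blast
      qed
      moreover have "\<exists>\<zeta>. ?pred \<zeta>" using p by blast
      moreover have "F' \<eta> = act (\<sigma>' \<zeta>) (F' \<zeta>)" by (simp add: F'_def \<sigma>'_def mk \<zeta> Suc FS)
      ultimately show ?thesis using nmin by (simp only: if_True if_False Let_def)
    next
      case k0: 0
      show ?thesis
      proof (cases m)
        case 0
        have "\<forall>\<zeta>\<in>UNIV. (\<eta>, \<zeta>) \<in> ord" by (auto simp: ord_iff mk k0 0)
        then show ?thesis by (simp add: F'_def mk k0 0 F0)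
      next
        case (Suc m')
        have nmin: "\<not> (\<forall>\<zeta>\<in>UNIV. (\<eta>, \<zeta>) \<in> ord)" using z mk Suc by (auto simp: ord_iff intro!: exI[of _ z])
        \<comment> \<open>Between any (a, b) with a at most m' and the limit (m' + 1, 0) there is
          always (a, b + 1).\<close>
        have npred: "\<not> (\<exists>\<zeta>. ?pred \<zeta>)"
        proof
          assume "\<exists>\<zeta>. ?pred \<zeta>"
          then obtain \<zeta> where p: "?pred \<zeta>" by blast
          obtain a b where ab: "d \<zeta> = (a, b)" by (cases "d \<zeta>")
          have a: "a < Suc m'"
          proof (rule ccontr)
            assume "\<not> a < Suc m'"
            then have "(\<eta>, \<zeta>) \<in> ord" by (auto simp: ord_iff mk k0 Suc ab)
            then show False using p ord_antisym by blast
          qed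
          obtain \<xi> where \<xi>: "d \<xi> = (a, Suc b)" using d_surj .
          have "(\<zeta>, \<xi>) \<in> ord \<and> (\<xi>, \<eta>) \<in> ord" using a by (simp add: ord_iff \<xi> ab mk k0 Suc)
          then have "\<xi> = \<zeta> \<or> \<xi> = \<eta>" using p by blast
          then show False using \<xi> ab mk k0 by auto
        qed
        have "evconst ord (\<lambda>\<zeta>. (\<zeta>, \<eta>) \<in> ord \<and> \<zeta> \<noteq> \<eta>) F' c = F' \<eta> c" for c
        proof -
          obtain K where K: "\<forall>k\<ge>K. F m' k c = F (Suc m') 0 c" using lim by blast
          obtain \<zeta> where \<zeta>: "d \<zeta> = (m', K)" using d_surj .
          show ?thesis
          proof (rule evconst_eqI[where ?\<eta>0.0 = \<zeta>])
            show "(\<zeta>, \<eta>) \<in> ord \<and> \<zeta> \<noteq> \<eta>" using \<zeta> mk k0 Suc by (auto simp: ord_iff)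
            fix \<xi> assume x: "(\<xi>, \<eta>) \<in> ord \<and> \<xi> \<noteq> \<eta>" "(\<zeta>, \<xi>) \<in> ord"
            obtain a b where ab: "d \<xi> = (a, b)" by (cases "d \<xi>")
            have "(a, b) \<noteq> (Suc m', 0)" using x(1) ab mk k0 Suc d_eq_iff[of \<xi> \<eta>] by simp
            then have "a = m' \<and> b \<ge> K" using x by (auto simp: ord_iff \<zeta> ab mk k0 Suc)
            then show "F' \<xi> c = F' \<eta> c" using K by (simp add: F'_def ab mk k0 Suc)
          qed (use ord_total in blast)+
        qed
        then have "F' \<eta> = evconst ord (\<lambda>\<zeta>. (\<zeta>, \<eta>) \<in> ord \<and> \<zeta> \<noteq> \<eta>) F'" by (intro ext) simp
        then show ?thesis using nmin npred by (simp only: if_False)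
      qed
    qed
  qed
  moreover have "g = terminal ord \<sigma>' f F'"
  proof -
    have nomax: "\<not> (\<exists>m\<in>UNIV. \<forall>\<zeta>\<in>UNIV. (\<zeta>, m) \<in> ord)"
    proof
      assume "\<exists>m\<in>UNIV. \<forall>\<zeta>\<in>UNIV. (\<zeta>, m) \<in> ord"
      then obtain m where m: "\<And>\<zeta>. (\<zeta>, m) \<in> ord" by blast
      obtain z where "d z = (Suc (fst (d m)), 0)" using d_surj .
      then show False using m[of z] by (simp add: ord_iff)
    qed
    have "evconst ord (\<lambda>\<zeta>. \<zeta> \<in> UNIV) F' c = g c" for c
    proof -
      obtain M where M: "\<forall>m\<ge>M. \<forall>k. F m k c = g c" using fin by blast
      obtain \<zeta> where \<zeta>: "d \<zeta> = (M, 0)" using d_surj .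
      show ?thesis
      proof (rule evconst_eqI[where ?\<eta>0.0 = \<zeta>])
        fix \<xi> assume "(\<zeta>, \<xi>) \<in> ord"
        then have "fst (d \<xi>) \<ge> M" by (auto simp: ord_iff \<zeta>)
        then show "F' \<xi> c = g c" using M by (simp add: F'_def)
      qed (use ord_total in blast)+
    qed
    then have "g = evconst ord (\<lambda>\<zeta>. \<zeta> \<in> UNIV) F'" by (intro ext) simp
    then show ?thesis unfolding terminal_def Field_ord using nomax by (simp only: if_False UNIV_not_empty)
  qed
  moreover have "\<forall>\<eta>\<in>Field ord. \<sigma>' \<eta> \<in> basic_twists" using \<sigma> by (simp add: \<sigma>'_def)
  ultimately show ?thesis unfolding accessible_via_def using Well_order_ord by blast
qed

end

text \<open>The stages consist of finitely many segments each, in varying number. They are strung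
  together into one sequence of segments, with \<open>st s\<close> the stage of the s-th. Since
  every stage is nonempty, \<open>st\<close> tends to infinity.\<close>

lemma flatten_chain:
  fixes D :: "nat \<Rightarrow> 'l cell set" and fs :: "nat \<Rightarrow> 'l config"
  assumes "\<And>m. (omega_segment (D m))\<^sup>+\<^sup>+ (fs m) (fs (Suc m))"
  shows "\<exists>h st. h 0 = fs 0 \<and> (\<forall>s::nat. omega_segment (D (st s)) (h s) (h (Suc s))) \<and>
    (\<forall>s. \<forall>c\<in>D (st s). h s c = fs (st s) c) \<and> (\<forall>M. \<exists>s0. \<forall>s\<ge>s0. st s \<ge> M)"
proof -
  have "\<exists>l p. l > 0 \<and> p 0 = fs m \<and> p l = fs (Suc m) \<and> (\<forall>i<l. omega_segment (D m) (p i) (p (Suc i)))" for m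
    using assms[of m] unfolding tranclp_power relpowp_fun_conv by blast
  then obtain l p where l: "\<And>m. l m > (0::nat)" and p0: "\<And>m. p m 0 = fs m" and pl: "\<And>m. p m (l m) = fs (Suc m)"
    and ps: "\<And>m i. i < l m \<Longrightarrow> omega_segment (D m) (p m i) (p m (Suc i))" by metis
  \<comment> \<open>A pair (m, i) stands for the i-th segment of stage m; after the last of its
    \<open>l m\<close> segments the counter passes to the next stage.\<close>
  define nxt where "nxt = (\<lambda>(m, i). if Suc i < l m then (m, Suc i) else (Suc m, 0 :: nat))"
  define st where "st s = (nxt ^^ s) (0 :: nat, 0 :: nat)" for s
  define h where "h s = p (fst (st s)) (snd (st s))" for s
  have st0: "st 0 = (0, 0)" and stS: "st (Suc s) = nxt (st s)" for s by (simp_all add: st_def)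
  have bnd: "snd (st s) < l (fst (st s))" for s
    by (induction s) (auto simp: st0 stS nxt_def l split: prod.split)
  have seg: "omega_segment (D (fst (st s))) (h s) (h (Suc s))" for s
  proof -
    obtain m i where mi: "st s = (m, i)" by (cases "st s")
    have i: "i < l m" using bnd[of s] mi by simp
    have "h (Suc s) = p m (Suc i)"
    proof (cases "Suc i < l m")
      case True
      then show ?thesis by (simp add: h_def stS mi nxt_def)
    next
      case False
      then have "Suc i = l m" using i by simp
      then show ?thesis by (simp add: h_def stS mi nxt_def p0 pl)
    qed
    then show ?thesis using ps[OF i] by (simp add: h_def mi)
  qed
  have pc: "p m i c = fs m c" if "c \<in> D m" "i \<le> l m" for m i c
    using that(2)
  proof (induction i)
    case (Suc i)
    then show ?case using omega_segment_const[OF ps[of i m] that(1)] by simp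
  qed (simp add: p0)
  have hc: "h s c = fs (fst (st s)) c" if "c \<in> D (fst (st s))" for s c
    unfolding h_def using pc[OF that] bnd[of s] by simp
  have mono: "fst (st s) \<le> fst (st (Suc s))" for s
    by (auto simp: stS nxt_def split: prod.split)
  have unb: "\<exists>s. st s = (M, 0)" for M
  proof (induction M)
    case 0
    then show ?case using st0 by blast
  next
    case (Suc M)
    then obtain s where s: "st s = (M, 0)" by blast
    have *: "i < l M \<Longrightarrow> st (s + i) = (M, i)" for i
      by (induction i) (simp_all add: s stS nxt_def)
    obtain i where i: "l M = Suc i" using l[of M] gr0_implies_Suc by blast
    then have "st (s + i) = (M, i)" using *[of i] by simp
    then have "st (Suc (s + i)) = (Suc M, 0)" using i by (simp add: stS nxt_def)
    then show ?case by blast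
  qed
  have "\<exists>s0. \<forall>s\<ge>s0. fst (st s) \<ge> M" for M
  proof -
    obtain s0 where "st s0 = (M, 0)" using unb by blast
    then have "fst (st s) \<ge> M" if "s \<ge> s0" for s
      using lift_Suc_mono_le[of "\<lambda>s. fst (st s)", OF mono that] by simp
    then show ?thesis by blast
  qed
  moreover have "h 0 = fs 0" by (simp add: h_def st0 p0)
  ultimately show ?thesis using seg hc by (intro exI[of _ h] exI[of _ "\<lambda>s. fst (st s)"]) blast
qed

lemma accessible_S_face:
  fixes f g :: "'l config" and d :: "'o \<Rightarrow> nat \<times> nat"
  assumes cnt: "countable (UNIV :: 'l set)" "infinite (UNIV :: 'l set)" and d: "bij d"
    and f: "f \<in> S_std" and g: "g \<in> S_face"
  shows "accessible_via (pull_omega2 d) f g"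
proof -
  obtain e :: "'l \<Rightarrow> nat" where e: "bij e" using countableE_infinite[OF cnt] .
  have st: "stage e g" using g e by unfold_locales (auto simp: S_face_def)
  define D where "D m = {c :: 'l cell. hi_index e c < m}" for m
  let ?G = "\<lambda>m h. standard h \<and> (\<forall>c. lo_index e c < m \<longrightarrow> h c = g c)"
  \<comment> \<open>The clause for m = 0 pins the beginning of the chain to f.\<close>
  have "\<exists>fs. \<forall>m. (?G m (fs m) \<and> (m = 0 \<longrightarrow> fs m = f)) \<and> (omega_segment (D m))\<^sup>+\<^sup>+ (fs m) (fs (Suc m))"
  proof (rule dependent_nat_choice)
    show "\<exists>x. ?G 0 x \<and> (0 = (0::nat) \<longrightarrow> x = f)" using f by (auto simp: S_std_def)
    fix x :: "'l config" and m :: nat assume x: "?G m x \<and> (m = 0 \<longrightarrow> x = f)"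
    then show "\<exists>y. (?G (Suc m) y \<and> (Suc m = 0 \<longrightarrow> y = f)) \<and> (omega_segment (D m))\<^sup>+\<^sup>+ x y"
      using stage.stage_step[OF st, of x m] unfolding stage.seg_def[OF st] D_def by (auto simp: less_Suc_eq_le)
  qed
  then obtain fs where fs: "\<And>m. ?G m (fs m)" "fs 0 = f" "\<And>m. (omega_segment (D m))\<^sup>+\<^sup>+ (fs m) (fs (Suc m))" by blast
  obtain h st where h0: "h 0 = f" and seg: "\<And>s::nat. omega_segment (D (st s)) (h s) (h (Suc s))"
    and hc: "\<And>s c. c \<in> D (st s) \<Longrightarrow> h s c = fs (st s) c" and unb: "\<And>M. \<exists>s0. \<forall>s\<ge>s0. st s \<ge> M"
    using flatten_chain[of D fs, OF fs(3)] fs(2) by blast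
  have "\<exists>\<sigma> F. (\<forall>k::nat. \<sigma> k \<in> basic_twists) \<and> F 0 = h s \<and> (\<forall>k. F (Suc k) = act (\<sigma> k) (F k)) \<and>
     (\<forall>c. \<exists>K. \<forall>k\<ge>K. F k c = h (Suc s) c) \<and> (\<forall>c\<in>D (st s). \<forall>k. F k c = h s c)" for s
    using seg[of s] unfolding omega_segment_def .
  then obtain \<sigma> F where F: "\<And>s k. \<sigma> s k \<in> basic_twists" "\<And>s. F s 0 = h s" "\<And>s k. F s (Suc k) = act (\<sigma> s k) (F s k)"
    "\<And>s c. \<exists>K. \<forall>k\<ge>K. F s k c = h (Suc s) c" "\<And>s c k. c \<in> D (st s) \<Longrightarrow> F s k c = h s c" by metis
  show ?thesis
  proof (rule accessible_via_ord[OF d, of \<sigma> F])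
    show "\<exists>M. \<forall>m\<ge>M. \<forall>k. F m k c = g c" for c
    proof -
      obtain s0 where s0: "\<forall>s\<ge>s0. st s \<ge> Suc (hi_index e c)" using unb by blast
      have "F s k c = g c" if "s \<ge> s0" for s k
      proof -
        \<comment> \<open>Once the stage exceeds both layers of c, the cell is protected during
          every segment and carries the colour that g prescribes.\<close>
        have c: "hi_index e c < st s" using s0 that by (simp add: Suc_le_eq)
        then have cD: "c \<in> D (st s)" by (simp add: D_def)
        have "lo_index e c < st s" using c lo_index_le_hi_index[of e c] by simp
        then show ?thesis using F(5)[OF cD] hc[OF cD] fs(1)[of "st s"] by simp
      qed
      then show ?thesis by blast
    qed
  qed (use F h0 in auto)
qed

theorem theorem5p10:
  assumes "countable (UNIV :: 'l set)" and "infinite (UNIV :: 'l set)"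
  shows
    "(S_face :: 'l config set) \<subseteq> L_solved TYPE(nat)
     \<and> (\<exists>f. f \<in> (L_solved TYPE(nat) :: 'l config set) \<and> f \<notin> S_face)
     \<and> (L_solved TYPE('o) :: 'l config set) \<subseteq> S_std
     \<and> (\<forall>f\<in>(S_std :: 'l config set). \<forall>g\<in>S_face.
          \<exists>r :: (nat \<times> nat) rel. (r, omega2) \<in> ordLeq \<and> accessible_via r f g)
     \<and> (\<forall>(f :: 'l config) g. legal g \<and> g \<notin> S_std \<and> f \<in> S_std \<longrightarrow>
          \<not> accessible TYPE('o) f g \<and> \<not> accessible TYPE('o) g f)"
proof (intro conjI)
  have solved: "(f_solved :: 'l config) \<in> S_std" using standard_f_solved by (simp add: S_std_def)
  show "(S_face :: 'l config set) \<subseteq> L_solved TYPE(nat)"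
  proof
    fix g :: "'l config" assume g: "g \<in> S_face"
    \<comment> \<open>\<open>prod_decode\<close> transports the order of type omega^2 to the natural
      numbers.\<close>
    have "accessible TYPE(nat) f_solved g"
      unfolding accessible_def
      using accessible_S_face[OF assms bij_prod_decode solved g] by blast
    moreover have "legal g" using g by (simp add: S_face_def standard_def)
    ultimately show "g \<in> L_solved TYPE(nat)" by (simp add: L_solved_def)
  qed
  show "\<exists>f. f \<in> (L_solved TYPE(nat) :: 'l config set) \<and> f \<notin> S_face"
  proof -
    \<comment> \<open>The witness outside \<open>S_face\<close> is one slice turn away from the
      solved cube, by a run over a one-element order.\<close>
    obtain a :: 'l where True by blast
    let ?A = "qt AX (Fin (Pos a)) :: 'l cell \<Rightarrow> 'l cell"
    let ?f = "act ?A f_solved"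
    let ?r = "{(0, 0)} :: nat rel"
    have "Well_order ?r"
      by (auto simp: well_order_on_def linear_order_on_def partial_order_on_def preorder_on_def
          refl_on_def trans_def antisym_def total_on_def Field_def)
    moreover have "run_ok ?r (\<lambda>_. ?A) f_solved (\<lambda>_. f_solved)" by (simp add: run_ok_def Field_def)
    moreover have "?f = terminal ?r (\<lambda>_. ?A) f_solved (\<lambda>_. f_solved)" by (simp add: terminal_def Field_def)
    ultimately have "accessible_via ?r f_solved ?f"
      unfolding accessible_via_def by (intro conjI exI[of _ "\<lambda>_. ?A"] exI[of _ "\<lambda>_. f_solved"]) auto
    then have "?f \<in> L_solved TYPE(nat)"
      using legal_f_solved unfolding L_solved_def accessible_def legal_def act_def by blast
    moreover have "?f \<notin> S_face"
    proof
      assume "?f \<in> S_face"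
      moreover have "(qt AY PInf :: 'l cell \<Rightarrow> 'l cell) \<in> face_twists" unfolding face_twists_def by blast
      ultimately have eq: "act (qt AY PInf) ?f = ?f" by (simp add: S_face_def)
      \<comment> \<open>The slice turn has put a yellow strip on the face y = +infinity, and this
        cell lies on it. Turning the face moves the strip away, and the cell shows blue.\<close>
      let ?c = "Abs_cell (Fin (Pos a), PInf, Fin Zero)"
      have "act (qt AY PInf) ?f ?c = Some Blue" "?f ?c = Some Yellow"
        by (simp_all add: act_def iqt_Abs is_cell_def f_solved_def Abs_cell_inverse solved_pt_def)
      then show False using eq by simp
    qed
    ultimately show ?thesis by blast
  qed
  show "(L_solved TYPE('o) :: 'l config set) \<subseteq> S_std"
    using accessible_standard_iff[where ?'o = 'o] legal_f_solved standard_f_solved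
    unfolding L_solved_def S_std_def by blast
  show "\<forall>f\<in>(S_std :: 'l config set). \<forall>g\<in>S_face.
          \<exists>r :: (nat \<times> nat) rel. (r, omega2) \<in> ordLeq \<and> accessible_via r f g"
  proof (intro ballI)
    fix f g :: "'l config" assume "f \<in> S_std" "g \<in> S_face"
    then have "accessible_via omega2 f g"
      using accessible_S_face[OF assms bij_id, of f g] by (simp add: pull_omega2_def inv_image_def)
    moreover from this have "(omega2, omega2) \<in> ordLeq"
      unfolding accessible_via_def by (simp add: ordLeq_reflexive)
    ultimately show "\<exists>r :: (nat \<times> nat) rel. (r, omega2) \<in> ordLeq \<and> accessible_via r f g" by blast
  qed
  show "\<forall>(f :: 'l config) g. legal g \<and> g \<notin> S_std \<and> f \<in> S_std \<longrightarrow>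
          \<not> accessible TYPE('o) f g \<and> \<not> accessible TYPE('o) g f"
    using accessible_standard_iff[where ?'o = 'o] unfolding S_std_def standard_def by blast
qed

end
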